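(* The following evaluations hold: $$r_{7,6}=2^{-1/2}\left\{(\sqrt 7+\sqrt 3)(\sqrt 3+\sqrt 2)\right\}^{1/2},$$ $$r_{7,3/2}=2^{-1/2}\left\{(\sqrt 7-\sqrt 3)(\sqrt 3+\sqrt 2)\right\}^{1/2},$$ $$r'_{7,6}=2^{-1/2}(5+\sqrt{21})^{1/2}(2-\sqrt{3})^{1/2}(\sqrt 7-\sqrt 6)^{1/4}(5+2\sqrt 6)^{1/4},$$ $$r'_{7,3/2}=2^{-1/2}(5-\sqrt{21})^{1/2}(2+\sqrt{3})^{1/2}(\sqrt 7-\sqrt 6)^{1/4}(5+2\sqrt 6)^{1/4}.$$
   Context: For $|x|<1$, $f(-x):=\sum_{m=-\infty}^{\infty}(-1)^m x^{m(3m-1)/2}$; thus $f(x)=\sum_{m=-\infty}^{\infty}(-1)^m(-x)^{m(3m-1)/2}$. For positive real $k,n$, $$r_{k,n}:=\frac{f(-q)}{k^{1/4}q^{(k-1)/24}f(-q^k)}\ \text{ with } q=e^{-2\pi\sqrt{n/k}},\qquad r'_{k,n}:=\frac{f(q)}{k^{1/4}q^{(k-1)/24}f(q^k)}\ \text{ with } q=e^{-\pi\sqrt{n/k}}.$$ All roots and fractional powers of positive reals are the positive real ones. *)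

theory Defs
  imports "HOL-Analysis.Analysis"
begin

text \<open>
  Ramanujan's one-variable theta function. The exponent \<open>m (3 m - 1) / 2\<close> is a nonnegative
  integer for every integer \<open>m\<close>, so \<open>div\<close> and \<open>nat\<close> are exact. The series converges
  absolutely for \<open>norm x < 1\<close>; outside that disc the value is meaningless.
\<close>

definition theta_f :: "'a::{real_normed_field,banach} \<Rightarrow> 'a" where
  "theta_f x = (\<Sum>\<^sub>\<infinity>m::int. (-1) powi m * (- x) ^ nat (m * (3 * m - 1) div 2))"

definition theta_r :: "real \<Rightarrow> real \<Rightarrow> real" where
  "theta_r k n =
     (let q = exp (- 2 * pi * sqrt (n / k))
      in theta_f (- q) / (k powr (1/4) * q powr ((k - 1) / 24) * theta_f (- (q powr k))))"

definition theta_r' :: "real \<Rightarrow> real \<Rightarrow> real" where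
  "theta_r' k n =
     (let q = exp (- pi * sqrt (n / k))
      in theta_f q / (k powr (1/4) * q powr ((k - 1) / 24) * theta_f (q powr k)))"

end

theory Submission
  imports Defs "HOL-Real_Asymp.Real_Asymp"
begin

text \<open>
  Write \<open>q = exp (- \<pi> t)\<close>. Up to elementary factors the four quantities are quotients of the
  Dedekind eta function \<open>\<eta>(i t)\<close> and of Weber's functions \<open>\<ff>, \<ff>\<^sub>1, \<ff>\<^sub>2\<close> at the points
  \<open>t\<close> and \<open>7 t\<close>. Jacobi's triple product turns the Weierstrass three-term relation into
  modular equations of degrees 3 and 7 between the Weber functions at \<open>t\<close> and at \<open>3 t\<close> or \<open>7 t\<close>.
  With \<open>u = sqrt 42\<close>, the degree 7 equation at \<open>u / 7\<close>, the degree 3 equation at \<open>u / 3\<close> and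
  the inversion \<open>t \<mapsto> 2 / t\<close>, which exchanges \<open>u / 7\<close> and \<open>u / 3\<close>, form a system of algebraic equations
  for the quotient and the product of \<open>r\<^sub>7\<^sub>,\<^sub>6\<close> and \<open>r\<^sub>7\<^sub>,\<^sub>3\<^sub>/\<^sub>2\<close>; crude numerical bounds select the
  right solution. The degree 7 equation for \<open>\<ff>\<close> then gives the two values of \<open>r'\<close>.
\<close>

section \<open>Infinite products\<close>

text \<open>Degree 3 enters a degree 7 problem because \<open>42 = 2 * 3 * 7\<close>. By the
  inversion \<open>weber1 (2 / t) * weber1 t = sqrt 2\<close>, the product of the two
  \<open>weber1\<close> values in the degree 7 equation becomes, up to a constant, their quotient in
  the degree 3 equation, and conversely; so both equations involve the same two unknowns. One of
  these is exactly the quotient of the two \<open>theta_r\<close> values. Their product needs a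
  further degree 3 relation, one that still contains an eta quotient. Only real nomes occur, and the
  single transformation law needed is that of eta under \<open>t\<close> to \<open>1 / t\<close>,
  which is reduced to the one for Gaussian sums. The theta function at a positive argument leads to
  products with negative base, which is why the product identities are stated for real bases of
  either sign.\<close>

definition qpoch :: "real \<Rightarrow> real \<Rightarrow> real" where
  "qpoch a q = (\<Prod>n. 1 - a * q ^ n)"

lemma convergent_prod_qpoch:
  fixes a q :: real
  assumes "\<bar>q\<bar> < 1"
  shows "convergent_prod (\<lambda>n. 1 - a * q ^ n)"
proof -
  have "summable (\<lambda>n. \<bar>a\<bar> * \<bar>q\<bar> ^ n)"
    using assms by (intro summable_mult summable_geometric) auto
  then have "summable (\<lambda>n. norm ((1 - a * q ^ n) - 1))"
    by (simp add: abs_mult power_abs)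
  then show ?thesis
    by (intro abs_convergent_prod_imp_convergent_prod summable_imp_abs_convergent_prod)
qed

lemma qpoch_LIMSEQ:
  assumes "\<bar>q\<bar> < 1"
  shows "(\<lambda>n. \<Prod>k<n. 1 - a * q ^ k) \<longlonglongrightarrow> qpoch a q"
  using convergent_prod_LIMSEQ[OF convergent_prod_qpoch[OF assms, of a]]
  unfolding qpoch_def by (subst LIMSEQ_lessThan_iff_atMost) simp

text \<open>Factors are grouped by the residue of the exponent modulo \<open>N\<close>. Rewriting
  the Weber products as theta products in a larger base rests on this.\<close>

lemma qpoch_split:
  assumes "\<bar>q\<bar> < 1" "N > 0"
  shows "qpoch a q = (\<Prod>i<N. qpoch (a * q ^ i) (q ^ N))"
proof -
  have N: "\<bar>q ^ N\<bar> < 1"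
    using assms by (simp add: power_abs power_less_one_iff)
  have "(\<lambda>n. \<Prod>i<N. \<Prod>k<n. 1 - (a * q ^ i) * (q ^ N) ^ k) \<longlonglongrightarrow> (\<Prod>i<N. qpoch (a * q ^ i) (q ^ N))"
    by (intro tendsto_prod qpoch_LIMSEQ N)
  moreover have "(\<Prod>i<N. \<Prod>k<n. 1 - (a * q ^ i) * (q ^ N) ^ k) = (\<Prod>k<n*N. 1 - a * q ^ k)" for n
  proof -
    have "(\<Prod>k<n*N. 1 - a * q ^ k) = (\<Prod>m<n. \<Prod>k=m*N..<m*N+N. 1 - a * q ^ k)"
      using prod.nat_group[of "\<lambda>k. 1 - a * q ^ k" N n] by simp
    also have "\<dots> = (\<Prod>m<n. \<Prod>i<N. 1 - a * q ^ (i + m * N))"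
    proof (rule prod.cong)
      fix m
      show "(\<Prod>k=m*N..<m*N+N. 1 - a * q ^ k) = (\<Prod>i<N. 1 - a * q ^ (i + m * N))"
        using prod.shift_bounds_nat_ivl[of "\<lambda>k. 1 - a * q ^ k" 0 "m * N" N]
        by (simp add: atLeast0LessThan add.commute)
    qed simp
    also have "\<dots> = (\<Prod>i<N. \<Prod>m<n. 1 - a * q ^ (i + m * N))"
      by (rule prod.swap)
    finally show ?thesis
      by (simp add: power_add power_mult mult.assoc mult.commute[of _ N])
  qed
  moreover have "(\<lambda>n. \<Prod>k<n*N. 1 - a * q ^ k) \<longlonglongrightarrow> qpoch a q"
  proof -
    have "filterlim (\<lambda>n. n * N) at_top sequentially"
      using assms(2) by (intro filterlim_at_top_mono[OF filterlim_ident]) auto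
    then show ?thesis
      by (rule filterlim_compose[OF qpoch_LIMSEQ[OF assms(1), of a]])
  qed
  ultimately show ?thesis
    using LIMSEQ_unique by fastforce
qed

lemma qpoch_unfold:
  assumes "\<bar>q\<bar> < 1"
  shows "qpoch a q = (1 - a) * qpoch (a * q) q"
proof -
  have "(\<lambda>n. (1 - a) * (\<Prod>k<n. 1 - (a * q) * q ^ k)) \<longlonglongrightarrow> (1 - a) * qpoch (a * q) q"
    by (intro tendsto_intros qpoch_LIMSEQ assms)
  moreover have "(1 - a) * (\<Prod>k<n. 1 - (a * q) * q ^ k) = (\<Prod>k<Suc n. 1 - a * q ^ k)" for n
    by (subst prod.lessThan_Suc_shift) (simp add: mult.assoc)
  ultimately have "(\<lambda>n. \<Prod>k<Suc n. 1 - a * q ^ k) \<longlonglongrightarrow> (1 - a) * qpoch (a * q) q"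
    by simp
  moreover have "(\<lambda>n. \<Prod>k<Suc n. 1 - a * q ^ k) \<longlonglongrightarrow> qpoch a q"
    using qpoch_LIMSEQ[OF assms, of a] by (rule LIMSEQ_Suc)
  ultimately show ?thesis
    using LIMSEQ_unique by blast
qed

lemma qpoch_mult_minus:
  assumes "\<bar>q\<bar> < 1"
  shows "qpoch a q * qpoch (- a) q = qpoch (a\<^sup>2) (q\<^sup>2)"
proof -
  have "(\<lambda>n. (\<Prod>k<n. 1 - a * q ^ k) * (\<Prod>k<n. 1 - (- a) * q ^ k)) \<longlonglongrightarrow> qpoch a q * qpoch (- a) q"
    by (intro tendsto_mult qpoch_LIMSEQ assms)
  moreover have "(\<Prod>k<n. 1 - a * q ^ k) * (\<Prod>k<n. 1 - (- a) * q ^ k) = (\<Prod>k<n. 1 - a\<^sup>2 * (q\<^sup>2) ^ k)" for n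
    unfolding prod.distrib[symmetric]
    by (intro prod.cong) (simp_all add: algebra_simps power2_eq_square power_mult_distrib)
  moreover have "(\<lambda>n. \<Prod>k<n. 1 - a\<^sup>2 * (q\<^sup>2) ^ k) \<longlonglongrightarrow> qpoch (a\<^sup>2) (q\<^sup>2)"
    using assms by (intro qpoch_LIMSEQ) (simp add: abs_square_less_1)
  ultimately show ?thesis
    using LIMSEQ_unique by fastforce
qed

lemma qpoch_pos:
  assumes "\<bar>q\<bar> < 1" "\<bar>a\<bar> < 1"
  shows "qpoch a q > 0"
proof -
  have "0 < 1 - a * q ^ n" for n
  proof -
    have "\<bar>a * q ^ n\<bar> \<le> \<bar>a\<bar> * 1"
      unfolding abs_mult power_abs using assms by (intro mult_left_mono power_le_one) auto
    then show ?thesis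
      using assms by linarith
  qed
  then show ?thesis
    unfolding qpoch_def using convergent_prod_qpoch[OF assms(1)] less_0_prodinf by blast
qed

section \<open>Jacobi's triple product\<close>

text \<open>Tannery's theorem, as dominated convergence for the counting measure. It carries both
  limit passages: the triple product and the inversion formula.\<close>

lemma tendsto_infsum_dominated:
  fixes f :: "nat \<Rightarrow> 'a \<Rightarrow> real"
  assumes g: "g summable_on UNIV" and le: "\<And>n k. \<bar>f n k\<bar> \<le> g k"
    and lim: "\<And>k. (\<lambda>n. f n k) \<longlonglongrightarrow> h k"
  shows "(\<lambda>n. \<Sum>\<^sub>\<infinity>k. f n k) \<longlonglongrightarrow> (\<Sum>\<^sub>\<infinity>k. h k)"
proof -
  have g0: "0 \<le> g k" for k
    using le[of 0 k] by linarith
  have ga: "(\<lambda>x. norm (g x)) summable_on UNIV"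
    using g g0 by simp
  have hle: "\<bar>h k\<bar> \<le> g k" for k
    using le by (intro LIMSEQ_le_const2[OF tendsto_rabs[OF lim]]) auto
  have fs: "(\<lambda>k. norm (f n k)) summable_on UNIV" for n
    using le g0 by (intro Infinite_Sum.abs_summable_on_comparison_test[OF ga]) simp
  have hs: "(\<lambda>k. norm (h k)) summable_on UNIV"
    using hle g0 by (intro Infinite_Sum.abs_summable_on_comparison_test[OF ga]) simp
  have "(\<lambda>n. integral\<^sup>L (count_space UNIV) (f n)) \<longlonglongrightarrow> integral\<^sup>L (count_space UNIV) h"
  proof (rule integral_dominated_convergence[where w=g])
    show "integrable (count_space UNIV) g"
      using iffD1[OF abs_summable_equivalent ga] by (simp add: abs_summable_on_def)
  qed (use le lim in auto)
  moreover have "integral\<^sup>L (count_space UNIV) (f n) = infsum (f n) UNIV" for n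
    using infsetsum_infsum[OF iffD1[OF abs_summable_equivalent fs[of n]]] by (simp add: infsetsum_def)
  moreover have "integral\<^sup>L (count_space UNIV) h = infsum h UNIV"
    using infsetsum_infsum[OF iffD1[OF abs_summable_equivalent hs]] by (simp add: infsetsum_def)
  ultimately show ?thesis
    by simp
qed

lemma summable_on_int_halves:
  fixes f :: "int \<Rightarrow> real"
  assumes "\<And>k. 0 \<le> f k" "summable (\<lambda>n. f (int n))" "summable (\<lambda>n. f (- int n))"
  shows "f summable_on UNIV"
proof -
  have "(\<lambda>n. f (int n)) summable_on UNIV" "(\<lambda>n. f (- int n)) summable_on UNIV"
    using assms by (auto intro: summable_nonneg_imp_summable_on)
  then have "f summable_on range int" "f summable_on range (\<lambda>n. - int n)"
    by (simp_all add: summable_on_reindex inj_on_def o_def)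
  then have "f summable_on (range int \<union> range (\<lambda>n. - int n))"
    by (rule summable_on_union)
  moreover have "range int \<union> range (\<lambda>n. - int n) = UNIV"
  proof (intro equalityI subsetI)
    fix k :: int
    show "k \<in> range int \<union> range (\<lambda>n. - int n)"
      by (cases k rule: int_cases2) auto
  qed simp
  ultimately show ?thesis
    by simp
qed

text \<open>The quotient of consecutive terms is \<open>c * r ^ n\<close>, which tends to 0 whatever
  the size of \<open>c\<close>.\<close>

lemma summable_power_times_triangle:
  fixes c r :: real
  assumes "0 < r" "r < 1" "0 < c"
  shows "summable (\<lambda>n. c ^ n * r ^ (n choose 2))"
proof -
  have "(\<lambda>n. c * r ^ n) \<longlonglongrightarrow> c * 0"
    using assms by (intro tendsto_intros) auto
  then have "eventually (\<lambda>n. c * r ^ n < 1/2) sequentially"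
    by (rule order_tendstoD) simp
  then obtain N where N: "\<And>n. n \<ge> N \<Longrightarrow> c * r ^ n < 1/2"
    unfolding eventually_sequentially by blast
  show ?thesis
  proof (rule summable_ratio_test[of "1/2" N])
    fix n assume "n \<ge> N"
    have "c ^ Suc n * r ^ (Suc n choose 2) = (c * r ^ n) * (c ^ n * r ^ (n choose 2))"
      by (simp add: numeral_2_eq_2 power_add)
    also have "\<dots> \<le> 1/2 * (c ^ n * r ^ (n choose 2))"
      using N[OF \<open>n \<ge> N\<close>] assms by (intro mult_right_mono) auto
    finally show "norm (c ^ Suc n * r ^ (Suc n choose 2)) \<le> 1/2 * norm (c ^ n * r ^ (n choose 2))"
      using assms by simp
  qed simp
qed

lemma int_triangle: "int n * (int n - 1) div 2 = int (n choose 2)"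
proof (induction n)
  case (Suc n)
  have "int (Suc n) * (int (Suc n) - 1) = int n * (int n - 1) + 2 * int n"
    by (simp add: algebra_simps)
  then show ?case
    using Suc by (simp add: numeral_2_eq_2)
qed simp

lemma int_triangle_neg: "- int n * (- int n - 1) div 2 = int (n choose 2) + int n"
proof -
  have "- int n * (- int n - 1) = int (Suc n) * (int (Suc n) - 1)"
    by (simp add: algebra_simps)
  also have "\<dots> div 2 = int (Suc n choose 2)"
    by (rule int_triangle)
  finally show ?thesis
    by (simp add: numeral_2_eq_2)
qed

abbreviation tri :: "int \<Rightarrow> int" where "tri k \<equiv> k * (k - 1) div 2"

lemma summable_on_theta:
  fixes z p :: real
  assumes "z \<noteq> 0" "p \<noteq> 0" "\<bar>p\<bar> < 1"
  shows "(\<lambda>k. \<bar>z powi k * p powi tri k\<bar>) summable_on UNIV"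
proof (rule summable_on_int_halves)
  show "summable (\<lambda>n. \<bar>z powi int n * p powi tri (int n)\<bar>)"
    using summable_power_times_triangle[of "\<bar>p\<bar>" "\<bar>z\<bar>"] assms
    by (simp add: int_triangle abs_mult power_abs)
  \<comment> \<open>For negative indices the triangular exponent is \<open>(n choose 2) + n\<close>;
    the extra \<open>n\<close> turns \<open>1 / z\<close> into \<open>p / z\<close>.\<close>
  have "\<bar>z powi (- int n) * p powi tri (- int n)\<bar> = (\<bar>p\<bar> / \<bar>z\<bar>) ^ n * \<bar>p\<bar> ^ (n choose 2)" for n
    unfolding int_triangle_neg using assms
    by (simp add: power_int_minus abs_mult power_abs power_divide power_int_add field_simps)
  then show "summable (\<lambda>n. \<bar>z powi (- int n) * p powi tri (- int n)\<bar>)"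
    using summable_power_times_triangle[of "\<bar>p\<bar>" "\<bar>p\<bar> / \<bar>z\<bar>"] assms by simp
qed simp

section \<open>Gaussian binomial coefficients and the finite form of the triple product\<close>

fun gauss_binomial :: "real \<Rightarrow> nat \<Rightarrow> nat \<Rightarrow> real" where
  "gauss_binomial p N 0 = 1"
| "gauss_binomial p 0 (Suc j) = 0"
| "gauss_binomial p (Suc N) (Suc j) = gauss_binomial p N (Suc j) + p ^ (N - j) * gauss_binomial p N j"

lemma gauss_binomial_eq_0: "N < j \<Longrightarrow> gauss_binomial p N j = 0"
  by (induction p N j rule: gauss_binomial.induct) auto

lemma gauss_binomial_self: "gauss_binomial p N N = 1"
  by (induction N) (simp_all add: gauss_binomial_eq_0)

text \<open>Rothe's finite q-binomial theorem. The induction splits off the last factor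
  \<open>1 - x * p ^ N\<close>, which matches the Pascal rule in the form with weight
  \<open>p ^ (N - j)\<close>.\<close>

lemma gauss_binomial_theorem:
  "(\<Prod>i<N. 1 - x * p ^ i) = (\<Sum>j\<le>N. (- x) ^ j * p ^ (j choose 2) * gauss_binomial p N j)"
proof (induction N)
  case (Suc N)
  let ?t = "\<lambda>N j. (- x) ^ j * p ^ (j choose 2) * gauss_binomial p N j"
  have step: "?t (Suc N) (Suc j) = ?t N (Suc j) - x * p ^ N * ?t N j" if "j \<le> N" for j
  proof -
    have "p ^ (Suc j choose 2) * p ^ (N - j) = p ^ N * p ^ (j choose 2)"
      using that by (simp add: numeral_2_eq_2 power_add[symmetric] add.commute)
    then show ?thesis
      by (simp add: algebra_simps)
  qed
  have "(\<Sum>j\<le>Suc N. ?t (Suc N) j) = 1 + (\<Sum>j\<le>N. ?t (Suc N) (Suc j))"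
    by (subst sum.atMost_Suc_shift) (simp add: binomial_eq_0)
  also have "\<dots> = 1 + (\<Sum>j\<le>N. ?t N (Suc j)) - x * p ^ N * (\<Sum>j\<le>N. ?t N j)"
    using step by (simp add: sum_subtractf sum_distrib_left)
  also have "1 + (\<Sum>j\<le>N. ?t N (Suc j)) = (\<Sum>j\<le>Suc N. ?t N j)"
    by (subst sum.atMost_Suc_shift) (simp add: binomial_eq_0)
  also have "\<dots> = (\<Sum>j\<le>N. ?t N j)"
    by (simp add: gauss_binomial_eq_0)
  finally show ?case
    using Suc by (simp add: algebra_simps)
qed (simp add: binomial_eq_0)

text \<open>The quotient formula by q-factorials, kept free of division so that the Pascal rule can
  be applied directly. It later supplies the bounds and limits of the coefficients.\<close>

lemma gauss_binomial_fact:
  "j \<le> N \<Longrightarrow> gauss_binomial p N j * (\<Prod>i<j. 1 - p * p ^ i) * (\<Prod>i<N-j. 1 - p * p ^ i) = (\<Prod>i<N. 1 - p * p ^ i)"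
proof (induction p N j rule: gauss_binomial.induct)
  case (3 p N j)
  let ?P = "\<lambda>n. \<Prod>i<n. 1 - p * p ^ i"
  show ?case
  proof (cases "j = N")
    case True
    then show ?thesis
      by (simp add: gauss_binomial_eq_0 gauss_binomial_self)
  next
    case False
    then have j: "Suc j \<le> N" "j \<le> N"
      using 3(3) by auto
    then obtain d where d: "N = Suc j + d"
      using le_Suc_ex by blast
    have 1: "gauss_binomial p N (Suc j) * ?P (Suc j) * ?P d = ?P N"
      and 2: "gauss_binomial p N j * ?P j * ?P (Suc d) = ?P N"
      using 3(1)[OF j(1)] 3(2)[OF j(2)] d by simp_all
    have "gauss_binomial p (Suc N) (Suc j) * ?P (Suc j) * ?P (Suc N - Suc j) =
      (gauss_binomial p N (Suc j) + p ^ Suc d * gauss_binomial p N j) * ?P (Suc j) * ?P (Suc d)"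
      using d by simp
    also have "\<dots> = (gauss_binomial p N (Suc j) * ?P (Suc j) * ?P d) * (1 - p * p ^ d)
       + p ^ Suc d * (1 - p * p ^ j) * (gauss_binomial p N j * ?P j * ?P (Suc d))"
      by (simp add: algebra_simps)
    also have "\<dots> = ?P N * (1 - p ^ Suc d + p ^ Suc d * (1 - p * p ^ j))"
      unfolding 1 2 by (simp add: algebra_simps)
    also have "\<dots> = ?P (Suc N)"
      using d by (simp add: algebra_simps power_add)
    finally show ?thesis .
  qed
qed auto

lemma two_tri: "2 * tri k = k * (k - 1)"
  by simp

text \<open>The binomial theorem with \<open>2 * n\<close> factors, centred: for
  \<open>x = z / p ^ n\<close> the last \<open>n\<close> factors are those of \<open>z\<close>, and
  the first \<open>n\<close>, read backwards, are those of \<open>p / z\<close> up to monomials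
  whose product is \<open>c n\<close>. Dividing by \<open>c n\<close> shifts the summation index by
  \<open>n\<close>.\<close>

lemma finite_triple_product:
  fixes z p :: real
  assumes "z \<noteq> 0" "p \<noteq> 0"
  shows "(\<Prod>i<n. 1 - z * p ^ i) * (\<Prod>i<n. 1 - p / z * p ^ i) =
    (\<Sum>j\<le>2*n. (- z) powi (int j - int n) * p powi tri (int j - int n) * gauss_binomial p (2*n) j)"
proof -
  define x where "x = z / p ^ n"
  define c where "c n = (- z) ^ n / p ^ (Suc n choose 2)" for n :: nat
  have c0: "c n \<noteq> 0"
    using assms by (simp add: c_def)
  have cn: "(\<Prod>i<n. - z / p ^ Suc i) = c n"
    by (induction n) (simp_all add: c_def numeral_2_eq_2 power_add mult_ac)
  have fac: "1 - x * p ^ (n - Suc i) = (- z / p ^ Suc i) * (1 - p / z * p ^ i)" if "i < n" for i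
  proof -
    have "p ^ n = p ^ (n - Suc i) * p ^ Suc i"
      using that by (simp only: power_add[symmetric]) simp
    then have "x * p ^ (n - Suc i) = z / p ^ Suc i"
      using assms by (simp add: x_def)
    then show ?thesis
      using assms by (simp add: field_simps)
  qed
  have "(\<Prod>i<n. 1 - x * p ^ i) = (\<Prod>i<n. 1 - x * p ^ (n - Suc i))"
    by (rule prod.nat_diff_reindex[symmetric])
  also have "\<dots> = (\<Prod>i<n. (- z / p ^ Suc i) * (1 - p / z * p ^ i))"
    by (intro prod.cong refl fac) simp
  also have "\<dots> = c n * (\<Prod>i<n. 1 - p / z * p ^ i)"
    unfolding prod.distrib cn ..
  finally have 1: "(\<Prod>i<n. 1 - x * p ^ i) = c n * (\<Prod>i<n. 1 - p / z * p ^ i)" .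
  have "(\<Prod>i<2*n. 1 - x * p ^ i) = (\<Prod>i<n. 1 - x * p ^ i) * (\<Prod>i<n. 1 - x * p ^ (i + n))"
    using prod.nat_group[of "\<lambda>i. 1 - x * p ^ i" n 2]
      prod.shift_bounds_nat_ivl[of "\<lambda>i. 1 - x * p ^ i" 0 n n]
    by (simp add: numeral_2_eq_2 atLeast0LessThan)
  also have "(\<Prod>i<n. 1 - x * p ^ (i + n)) = (\<Prod>i<n. 1 - z * p ^ i)"
    using assms by (intro prod.cong) (simp_all add: x_def power_add)
  finally have "(\<Prod>i<n. 1 - z * p ^ i) * (\<Prod>i<n. 1 - p / z * p ^ i) = (\<Prod>i<2*n. 1 - x * p ^ i) / c n"
    using c0 by (simp add: 1)
  also have "\<dots> = (\<Sum>j\<le>2*n. (- x) ^ j * p ^ (j choose 2) * gauss_binomial p (2*n) j / c n)"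
    by (simp add: gauss_binomial_theorem sum_divide_distrib)
  also have "\<dots> = (\<Sum>j\<le>2*n. (- z) powi (int j - int n) * p powi tri (int j - int n) * gauss_binomial p (2*n) j)"
  proof (rule sum.cong)
    fix j
    \<comment> \<open>The exponent identity is verified after doubling, which removes the division
      by 2.\<close>
    have "2 * tri (int j - int n) = (int j - int n) * (int j - int n - 1)"
      by (rule two_tri)
    also have "\<dots> = int j * (int j - 1) + int (Suc n) * (int (Suc n) - 1) - 2 * int (n * j)"
      by (simp add: algebra_simps)
    also have "\<dots> = 2 * tri (int j) + 2 * tri (int (Suc n)) - 2 * int (n * j)"
      by (simp only: two_tri)
    finally have t: "tri (int j - int n) = int (j choose 2) + int (Suc n choose 2) - int (n * j)"
      unfolding int_triangle by linarith
    have "p powi tri (int j - int n) = p ^ (j choose 2) * p ^ (Suc n choose 2) / p ^ (n * j)"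
      unfolding t using assms by (simp add: power_int_diff power_int_add del: of_nat_mult)
    moreover have "(- x) ^ j = (- z) ^ j / p ^ (n * j)"
      unfolding x_def minus_divide_left power_divide power_mult ..
    moreover have "(- z) powi (int j - int n) = (- z) ^ j / (- z) ^ n"
      using assms by (simp add: power_int_diff)
    ultimately show "(- x) ^ j * p ^ (j choose 2) * gauss_binomial p (2*n) j / c n =
      (- z) powi (int j - int n) * p powi tri (int j - int n) * gauss_binomial p (2*n) j"
      by (simp add: c_def mult_ac)
  qed simp
  finally show ?thesis .
qed

definition theta_series :: "real \<Rightarrow> real \<Rightarrow> real" where
  "theta_series z p = (\<Sum>\<^sub>\<infinity>k. (- z) powi k * p powi tri k)"

definition theta_prod :: "real \<Rightarrow> real \<Rightarrow> real" where
  "theta_prod z p = qpoch z p * qpoch (p / z) p"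

text \<open>Limit of the finite version: for fixed \<open>k\<close> the Gaussian coefficient at
  distance \<open>k\<close> from the centre tends to \<open>1 / qpoch p p\<close>. Negative bases
  are included because \<open>theta_f\<close> at positive arguments leads to them.\<close>

theorem jacobi_triple_product:
  assumes "z \<noteq> 0" "p \<noteq> 0" "\<bar>p\<bar> < 1"
  shows "theta_series z p = theta_prod z p * qpoch p p"
proof -
  define P where "P n = (\<Prod>i<n. 1 - p * p ^ i)" for n
  have P_lim: "P \<longlonglongrightarrow> qpoch p p"
    unfolding P_def using qpoch_LIMSEQ[OF assms(3)] .
  have qpos: "qpoch p p > 0"
    using qpoch_pos assms by blast
  have "1 - p * p ^ i \<noteq> 0" for i
  proof -
    have "\<bar>p * p ^ i\<bar> < 1"
      using power_Suc_less_one[of "\<bar>p\<bar>" i] assms by (simp add: abs_mult power_abs)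
    then show ?thesis
      by auto
  qed
  then have P0: "P n \<noteq> 0" for n
    by (simp add: P_def)
  \<comment> \<open>The partial products and their inverses are bounded, so the Gaussian
    coefficients are bounded uniformly in both indices; this yields the dominating series.\<close>
  have "Bseq P"
    by (rule convergent_imp_Bseq[OF convergentI[OF P_lim]])
  then obtain M where M: "M > 0" "\<And>n. \<bar>P n\<bar> \<le> M"
    by (auto simp: Bseq_def)
  have "Bseq (\<lambda>n. inverse (P n))"
    by (rule convergent_imp_Bseq[OF convergentI[OF tendsto_inverse[OF P_lim]]]) (use qpos in simp)
  then obtain D where D: "D > 0" "\<And>n. \<bar>inverse (P n)\<bar> \<le> D"
    by (auto simp: Bseq_def)
  have gb: "gauss_binomial p N j = P N * inverse (P j) * inverse (P (N - j))" if "j \<le> N" for N j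
    using gauss_binomial_fact[OF that, of p] P0 unfolding P_def[symmetric] by (simp add: field_simps)
  define t where "t k = (- z) powi k * p powi tri k" for k
  define f where "f n k = (if \<bar>k\<bar> \<le> int n then t k * gauss_binomial p (2*n) (nat (k + int n)) else 0)" for n k
  have bound: "\<bar>gauss_binomial p N j\<bar> \<le> M * D * D" for N j
  proof (cases "j \<le> N")
    case True
    then show ?thesis
      unfolding gb[OF True] abs_mult using M D by (intro mult_mono) auto
  next
    case False
    then show ?thesis
      using M D by (simp add: gauss_binomial_eq_0)
  qed
  have fsum: "infsum (f n) UNIV = (\<Prod>i<n. 1 - z * p ^ i) * (\<Prod>i<n. 1 - p / z * p ^ i)" for n
  proof -
    have "infsum (f n) UNIV = infsum (f n) {- int n..int n}"
      by (rule infsum_cong_neutral) (auto simp: f_def)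
    also have "\<dots> = (\<Sum>k\<in>{- int n..int n}. f n k)"
      by simp
    also have "\<dots> = (\<Sum>j\<le>2*n. t (int j - int n) * gauss_binomial p (2*n) j)"
      by (rule sum.reindex_bij_witness[where i="\<lambda>j. int j - int n" and j="\<lambda>k. nat (k + int n)"])
        (auto simp: f_def)
    finally show ?thesis
      using finite_triple_product[OF assms(1,2), of n] by (simp add: t_def)
  qed
  have "(\<lambda>n. infsum (f n) UNIV) \<longlonglongrightarrow> (\<Sum>\<^sub>\<infinity>k. t k * inverse (qpoch p p))"
  proof (rule tendsto_infsum_dominated)
    show "(\<lambda>k. \<bar>t k\<bar> * (M * D * D)) summable_on UNIV"
      unfolding t_def using summable_on_theta[of "-z" p] assms by (intro summable_on_cmult_left) auto
    show "\<bar>f n k\<bar> \<le> \<bar>t k\<bar> * (M * D * D)" for n k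
      using M D bound by (auto simp: f_def abs_mult intro!: mult_left_mono)
    fix k
    have ev: "eventually (\<lambda>n. f n k = t k * (P (2*n) * inverse (P (nat (k + int n))) * inverse (P (nat (int n - k))))) sequentially"
      using eventually_ge_at_top[of "nat \<bar>k\<bar>"]
    proof eventually_elim
      case (elim n)
      then have "\<bar>k\<bar> \<le> int n"
        by linarith
      moreover have "nat (k + int n) \<le> 2 * n" "2 * n - nat (k + int n) = nat (int n - k)"
        using calculation by linarith+
      ultimately show ?case
        by (simp add: f_def gb)
    qed
    have l1: "filterlim (\<lambda>n. 2 * n) at_top (sequentially :: nat filter)"
      by (intro filterlim_at_top_mono[OF filterlim_ident]) auto
    have l: "filterlim (\<lambda>n. nat (m + int n)) at_top sequentially" for m
      unfolding filterlim_at_top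
    proof (intro allI)
      fix Z
      show "eventually (\<lambda>n. Z \<le> nat (m + int n)) sequentially"
        using eventually_ge_at_top[of "Z + nat \<bar>m\<bar>"] by eventually_elim linarith
    qed
    have "(\<lambda>n. t k * (P (2*n) * inverse (P (nat (k + int n))) * inverse (P (nat (- k + int n)))))
      \<longlonglongrightarrow> t k * (qpoch p p * inverse (qpoch p p) * inverse (qpoch p p))"
      using qpos by (intro tendsto_intros filterlim_compose[OF P_lim] l1 l) auto
    moreover have "t k * (qpoch p p * inverse (qpoch p p) * inverse (qpoch p p)) = t k * inverse (qpoch p p)"
      using qpos by simp
    ultimately show "(\<lambda>n. f n k) \<longlonglongrightarrow> t k * inverse (qpoch p p)"
      using tendsto_cong[OF ev] by (simp add: add.commute)
  qed
  moreover have "(\<lambda>n. infsum (f n) UNIV) \<longlonglongrightarrow> theta_prod z p"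
    unfolding fsum theta_prod_def by (intro tendsto_mult qpoch_LIMSEQ assms)
  ultimately have "theta_prod z p = (\<Sum>\<^sub>\<infinity>k. t k * inverse (qpoch p p))"
    using LIMSEQ_unique by blast
  also have "\<dots> = theta_series z p * inverse (qpoch p p)"
    unfolding theta_series_def t_def[symmetric] by (rule infsum_cmult_left')
  finally show ?thesis
    using qpos by (simp add: field_simps)
qed

section \<open>The Weierstrass three-term relation\<close>

lemma infsum_mult_infsum:
  fixes f :: "'a \<Rightarrow> real" and g :: "'b \<Rightarrow> real"
  assumes "(\<lambda>x. \<bar>f x\<bar>) summable_on UNIV" "(\<lambda>y. \<bar>g y\<bar>) summable_on UNIV"
  shows "(\<lambda>(x, y). f x * g y) summable_on UNIV"
    and "infsum f UNIV * infsum g UNIV = (\<Sum>\<^sub>\<infinity>(x, y). f x * g y)"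
proof -
  have "(\<lambda>z. norm ((\<lambda>(x, y). f x * g y) z)) summable_on UNIV \<times> UNIV"
    by (subst Infinite_Sum.abs_summable_on_Sigma_iff)
      (use assms in \<open>auto simp: abs_mult infsum_cmult_right' intro!: summable_on_cmult_right summable_on_cmult_left\<close>)
  then show s: "(\<lambda>(x, y). f x * g y) summable_on UNIV"
    using abs_summable_summable[of "\<lambda>(x, y). f x * g y" "UNIV \<times> UNIV"] by simp
  have "(\<Sum>\<^sub>\<infinity>(x, y). f x * g y) = (\<Sum>\<^sub>\<infinity>x. \<Sum>\<^sub>\<infinity>y. f x * g y)"
    using infsum_Sigma_banach[of "\<lambda>(x, y). f x * g y" UNIV "\<lambda>_. UNIV"] s by simp
  also have "\<dots> = infsum f UNIV * infsum g UNIV"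
    by (simp add: infsum_cmult_right' infsum_cmult_left')
  finally show "infsum f UNIV * infsum g UNIV = (\<Sum>\<^sub>\<infinity>(x, y). f x * g y)" ..
qed

context
  fixes p :: real
  assumes p: "p \<noteq> 0" "\<bar>p\<bar> < 1"
begin

text \<open>\<open>theta_odd x / x\<close> has odd powers of \<open>x\<close> only,
  \<open>theta_even x\<close> even ones. In multiplicative notation with nome \<open>p\<close> they
  are Jacobi's theta_2 and theta_3, the first without its constant power
  \<open>p^(1/4)\<close>.\<close>

definition theta_odd :: "real \<Rightarrow> real" where
  "theta_odd x = (\<Sum>\<^sub>\<infinity>k. x powi (2 * k) * p powi (k * (k - 1)))"

definition theta_even :: "real \<Rightarrow> real" where
  "theta_even x = (\<Sum>\<^sub>\<infinity>k. x powi (2 * k) * p powi (k * k))"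

lemma powi_tri_square: "(p\<^sup>2) powi tri k = p powi (k * (k - 1))"
proof -
  have "p powi (2 * tri k) = (p powi 2) powi tri k"
    by (rule power_int_mult)
  then show ?thesis
    unfolding two_tri by simp
qed

lemma summable_theta_odd:
  assumes "x \<noteq> 0"
  shows "(\<lambda>k. \<bar>x powi (2 * k) * p powi (k * (k - 1))\<bar>) summable_on UNIV"
proof -
  have "x powi (2 * k) * p powi (k * (k - 1)) = (x\<^sup>2) powi k * (p\<^sup>2) powi tri k" for k
    unfolding powi_tri_square by (simp add: power_int_mult)
  then show ?thesis
    using summable_on_theta[of "x\<^sup>2" "p\<^sup>2"] assms p by (simp add: abs_square_less_1)
qed

lemma summable_theta_even:
  assumes "x \<noteq> 0"
  shows "(\<lambda>k. \<bar>x powi (2 * k) * p powi (k * k)\<bar>) summable_on UNIV"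
proof -
  have "x powi (2 * k) * p powi (k * k) = (x\<^sup>2 * p) powi k * (p\<^sup>2) powi tri k" for k
  proof -
    have "p powi k * p powi (k * (k - 1)) = p powi (k * k)"
      using p by (subst power_int_add[symmetric]) (simp_all add: algebra_simps)
    then show ?thesis
      unfolding powi_tri_square power_int_mult_distrib power_int_mult[of x 2 k] by simp
  qed
  then show ?thesis
    using summable_on_theta[of "x\<^sup>2 * p" "p\<^sup>2"] assms p by (simp add: abs_square_less_1)
qed

lemma theta_odd_shift:
  assumes "y \<noteq> 0"
  shows "(\<Sum>\<^sub>\<infinity>k. y powi (2 * k) * p powi (k * (k + 1))) = theta_odd y / y\<^sup>2"
proof -
  have "theta_odd y = (\<Sum>\<^sub>\<infinity>k. y powi (2 * (k + 1)) * p powi ((k + 1) * ((k + 1) - 1)))"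
    unfolding theta_odd_def
    by (rule infsum_reindex_bij_witness[where i="\<lambda>k. k + 1" and j="\<lambda>k. k - 1"]) auto
  also have "\<dots> = (\<Sum>\<^sub>\<infinity>k. y\<^sup>2 * (y powi (2 * k) * p powi (k * (k + 1))))"
    using assms by (intro infsum_cong) (simp add: power_int_add distrib_left mult_ac)
  finally show ?thesis
    using assms by (simp add: infsum_cmult_right')
qed

text \<open>The double series over \<open>(m, n)\<close> is split by the parity of
  \<open>m + n\<close>. With \<open>m = a + b\<close>, \<open>n = a - b\<close> in the even class
  and \<open>m = a + b + 1\<close>, \<open>n = a - b\<close> in the odd class, each term factors
  into a function of \<open>a\<close> and a function of \<open>b\<close>.\<close>

lemma theta_series_mult:
  assumes "x \<noteq> 0" "y \<noteq> 0"
  shows "theta_series (x * y) p * theta_series (x / y) p =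
    theta_odd x * theta_even y - x / y * theta_even x * theta_odd y"
proof -
  define F where "F = (\<lambda>(m, n). ((- (x * y)) powi m * p powi tri m) * ((- (x / y)) powi n * p powi tri n))"
  have F: "F summable_on UNIV" "theta_series (x * y) p * theta_series (x / y) p = infsum F UNIV"
    unfolding F_def theta_series_def
    by (rule infsum_mult_infsum; use summable_on_theta assms p in simp)+
  define E :: "(int \<times> int) set" where "E = {(m, n). even (m + n)}"
  define O' :: "(int \<times> int) set" where "O' = {(m, n). odd (m + n)}"
  have sgn: "(-1::real) powi m * (-1) powi n = (if even (m + n) then 1 else -1)" for m n
    by (auto simp: power_int_minus_left)
  have F_eq: "F (m, n) = (if even (m + n) then 1 else -1) * x powi (m + n) * y powi (m - n) * p powi (tri m + tri n)" for m n
  proof -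
    have "F (m, n) = ((-1) powi m * (-1) powi n) * (x powi m * x powi n) * (y powi m / y powi n) * (p powi tri m * p powi tri n)"
      using power_int_mult_distrib[of "-1" "x * y" m] power_int_mult_distrib[of "-1" "x / y" n]
      by (simp add: F_def power_int_mult_distrib power_int_divide_distrib)
    then show ?thesis
      unfolding sgn using assms p by (simp add: power_int_add power_int_diff)
  qed
  have tri_e: "tri (a + b) + tri (a - b) = a * (a - 1) + b * b" for a b
  proof -
    have "2 * (tri (a + b) + tri (a - b)) = (a + b) * (a + b - 1) + (a - b) * (a - b - 1)"
      by (simp only: distrib_left two_tri)
    also have "\<dots> = 2 * (a * (a - 1) + b * b)"
      by (simp add: algebra_simps)
    finally show ?thesis
      by (rule mult_left_cancel[THEN iffD1, rotated]) simp
  qed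
  have tri_o: "tri (a + b + 1) + tri (a - b) = a * a + b * (b + 1)" for a b
  proof -
    have "2 * (tri (a + b + 1) + tri (a - b)) = (a + b + 1) * (a + b + 1 - 1) + (a - b) * (a - b - 1)"
      by (simp only: distrib_left two_tri)
    also have "\<dots> = 2 * (a * a + b * (b + 1))"
      by (simp add: algebra_simps)
    finally show ?thesis
      by (rule mult_left_cancel[THEN iffD1, rotated]) simp
  qed
  have e: "infsum F E = theta_odd x * theta_even y"
  proof -
    have "infsum F E = (\<Sum>\<^sub>\<infinity>(a, b). (x powi (2 * a) * p powi (a * (a - 1))) * (y powi (2 * b) * p powi (b * b)))"
    proof (rule infsum_reindex_bij_witness[where i="\<lambda>(a, b). (a + b, a - b)" and j="\<lambda>(m, n). ((m + n) div 2, (m - n) div 2)"])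
      fix mn assume "mn \<in> E"
      then obtain m n where mn: "mn = (m, n)" "even (m + n)"
        by (auto simp: E_def)
      define a where "a = (m + n) div 2"
      have a: "m + n = 2 * a"
        using mn by (simp add: a_def)
      then have b: "m - n = 2 * (a - n)" "(m - n) div 2 = a - n"
        by auto
      have m: "m = a + (a - n)" "n = a - (a - n)"
        using a by auto
      show "(case case mn of (m, n) \<Rightarrow> ((m + n) div 2, (m - n) div 2) of (a, b) \<Rightarrow> (a + b, a - b)) = mn"
        using mn a b m by (simp add: a_def[symmetric])
      have t: "tri m + tri n = a * (a - 1) + (a - n) * (a - n)"
        using tri_e[of a "a - n"] m by simp
      have "F (m, n) = x powi (2 * a) * y powi (2 * (a - n)) * p powi (a * (a - 1) + (a - n) * (a - n))"
        unfolding F_eq t b(1) a using mn by simp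
      then show "(case case mn of (m, n) \<Rightarrow> ((m + n) div 2, (m - n) div 2) of (a, b) \<Rightarrow>
          x powi (2 * a) * p powi (a * (a - 1)) * (y powi (2 * b) * p powi (b * b))) = F mn"
        using p b by (simp add: mn a_def[symmetric] power_int_add)
    qed (auto simp: E_def)
    then show ?thesis
      using infsum_mult_infsum(2)[OF summable_theta_odd[of x] summable_theta_even[of y]] assms
      by (simp add: theta_odd_def theta_even_def)
  qed
  have o: "infsum F O' = - x * y * theta_even x * (theta_odd y / y\<^sup>2)"
  proof -
    have "infsum F O' = (\<Sum>\<^sub>\<infinity>(a, b). (x powi (2 * a) * p powi (a * a)) * (- x * y * (y powi (2 * b) * p powi (b * (b + 1)))))"
    proof (rule infsum_reindex_bij_witness[where i="\<lambda>(a, b). (a + b + 1, a - b)" and j="\<lambda>(m, n). ((m + n) div 2, (m - n) div 2)"])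
      fix mn assume "mn \<in> O'"
      then obtain m n where mn: "mn = (m, n)" "odd (m + n)"
        by (auto simp: O'_def)
      define a where "a = (m + n) div 2"
      have a: "m + n = 2 * a + 1"
        using mn by (simp add: a_def)
      then have b: "m - n = 2 * (a - n) + 1" "(m - n) div 2 = a - n"
        by auto
      have m: "m = a + (a - n) + 1" "n = a - (a - n)"
        using a by auto
      show "(case case mn of (m, n) \<Rightarrow> ((m + n) div 2, (m - n) div 2) of (a, b) \<Rightarrow> (a + b + 1, a - b)) = mn"
        using mn a b m by (simp add: a_def[symmetric])
      have t: "tri m + tri n = a * a + (a - n) * (a - n + 1)"
        using tri_o[of a "a - n"] m by simp
      have "F (m, n) = - (x powi (2 * a + 1) * y powi (2 * (a - n) + 1) * p powi (a * a + (a - n) * (a - n + 1)))"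
        unfolding F_eq t b(1) a using mn by simp
      then show "(case case mn of (m, n) \<Rightarrow> ((m + n) div 2, (m - n) div 2) of (a, b) \<Rightarrow>
          x powi (2 * a) * p powi (a * a) * (- x * y * (y powi (2 * b) * p powi (b * (b + 1))))) = F mn"
        using p b assms by (simp add: mn a_def[symmetric] power_int_add)
    qed (auto simp: O'_def)
    also have "\<dots> = theta_even x * (\<Sum>\<^sub>\<infinity>b. - x * y * (y powi (2 * b) * p powi (b * (b + 1))))"
    proof -
      have "y powi (2 * b) * p powi (b * (b + 1)) = inverse (y\<^sup>2) * (y powi (2 * (b + 1)) * p powi ((b + 1) * (b + 1 - 1)))" for b
        using assms by (simp add: power_int_add distrib_left mult_ac)
      moreover have "(\<lambda>b. \<bar>y powi (2 * (b + 1)) * p powi ((b + 1) * (b + 1 - 1))\<bar>) summable_on UNIV"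
        using summable_theta_odd[OF assms(2)]
        by (subst summable_on_reindex_bij_witness[where i="\<lambda>b. b - 1" and j="\<lambda>b. b + 1"]) auto
      ultimately have "(\<lambda>b. \<bar>(- x * y) * (y powi (2 * b) * p powi (b * (b + 1)))\<bar>) summable_on UNIV"
        by (simp add: abs_mult summable_on_cmult_right)
      then show ?thesis
        unfolding theta_even_def
        by (rule infsum_mult_infsum(2)[OF summable_theta_even[OF assms(1)], symmetric])
    qed
    also have "(\<Sum>\<^sub>\<infinity>b. - x * y * (y powi (2 * b) * p powi (b * (b + 1)))) = - x * y * (theta_odd y / y\<^sup>2)"
      by (simp only: infsum_cmult_right' theta_odd_shift[OF assms(2)])
    finally show ?thesis by simp
  qed
  have "infsum F UNIV = infsum F E + infsum F O'"
  proof -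
    have "E \<union> O' = UNIV" "E \<inter> O' = {}"
      by (auto simp: E_def O'_def)
    moreover have "F summable_on E" "F summable_on O'"
      using F(1) by (auto intro: summable_on_subset_banach)
    ultimately show ?thesis
      using infsum_Un_disjoint[of F E O'] by simp
  qed
  then show ?thesis
    unfolding F(2) e o using assms by (simp add: power2_eq_square)
qed

text \<open>
  By the previous lemma \<open>J (x * y) * J (x / y) / x\<close> is a \<open>2 \<times> 2\<close> determinant with one row depending on \<open>x\<close>
  and one on \<open>y\<close>, so the relation is the Pluecker relation for four rows.
\<close>

theorem weierstrass_three_term:
  assumes "x \<noteq> 0" "y \<noteq> 0" "u \<noteq> 0" "v \<noteq> 0"
  defines "J \<equiv> \<lambda>z. theta_prod z p"
  shows "y * (J (x * y) * J (x / y) * J (u * v) * J (u / v))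
    + u * (J (x * v) * J (x / v) * J (y * u) * J (y / u))
    = u * (J (x * u) * J (x / u) * J (y * v) * J (y / v))"
proof -
  define E where "E = qpoch p p"
  have E: "E \<noteq> 0"
    using qpoch_pos[of p p] p by (simp add: E_def)
  define a where "a s = theta_odd s / s" for s
  have D: "J (s * t) * J (s / t) = inverse E ^ 2 * (s * (a s * theta_even t - theta_even s * a t))"
    if "s \<noteq> 0" "t \<noteq> 0" for s t
  proof -
    have "(J (s * t) * E) * (J (s / t) * E) = s * (a s * theta_even t - theta_even s * a t)"
      using theta_series_mult[OF that] that p
      by (simp add: jacobi_triple_product J_def E_def a_def right_diff_distrib)
    moreover have "J (s * t) * J (s / t) = inverse E ^ 2 * ((J (s * t) * E) * (J (s / t) * E))"
      using E by (simp add: field_simps power2_eq_square)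
    ultimately show ?thesis
      by simp
  qed
  have "y * ((J (x * y) * J (x / y)) * (J (u * v) * J (u / v)))
    + u * ((J (x * v) * J (x / v)) * (J (y * u) * J (y / u)))
    = u * ((J (x * u) * J (x / u)) * (J (y * v) * J (y / v)))"
    unfolding D[OF assms(1,2)] D[OF assms(3,4)] D[OF assms(1,4)] D[OF assms(2,3)] D[OF assms(1,3)] D[OF assms(2,4)]
    by algebra
  then show ?thesis
    by (simp only: mult.assoc)
qed

end

text \<open>Passing from \<open>z\<close> to \<open>1 / z\<close> exchanges the leading factor
  \<open>1 - z\<close> for \<open>1 - 1 / z\<close>. This brings the negative powers of
  \<open>q\<close> that arise in the three-term relation back to positive ones.\<close>

lemma theta_prod_inverse:
  assumes "z \<noteq> 0" "\<bar>p\<bar> < 1"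
  shows "theta_prod (1 / z) p = - theta_prod z p / z"
proof (cases "z = 1")
  case True
  then show ?thesis
    using qpoch_unfold[OF assms(2), of 1] by (simp add: theta_prod_def)
next
  case False
  have "p / (1 / z) = z * p" "1 / z * p = p / z" "1 - 1 / z = - ((1 - z) / z)"
    using assms by (simp_all add: diff_divide_distrib)
  then have "theta_prod (1 / z) p = - ((1 - z) / z) * qpoch (p / z) p * qpoch (z * p) p"
    using qpoch_unfold[OF assms(2), of "1 / z"] by (simp only: theta_prod_def)
  then show ?thesis
    using qpoch_unfold[OF assms(2), of z] by (simp add: theta_prod_def)
qed

section \<open>Modular equations of degrees 3 and 7 for the Weber products\<close>

text \<open>Weber's functions stripped of their fractional powers of \<open>q\<close> and of the
  factor \<open>sqrt 2\<close> in the third: the products of \<open>1 + q ^ (2 * n + 1)\<close>,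
  \<open>1 - q ^ (2 * n + 1)\<close> and \<open>1 + q ^ (2 * n + 2)\<close>.\<close>

definition w0 :: "real \<Rightarrow> real" where "w0 q = qpoch (- q) (q\<^sup>2)"
definition w1 :: "real \<Rightarrow> real" where "w1 q = qpoch q (q\<^sup>2)"
definition w2 :: "real \<Rightarrow> real" where "w2 q = qpoch (- (q\<^sup>2)) (q\<^sup>2)"

context
  fixes q :: real
  assumes q: "0 < q" "q < 1"
begin

lemma q_power_lt: "n > 0 \<Longrightarrow> \<bar>q ^ n\<bar> < 1"
  using q by (simp add: power_less_one_iff)

lemma qpoch_neg_pos: "n > 0 \<Longrightarrow> m > 0 \<Longrightarrow> qpoch (- (q ^ n)) (q ^ m) > 0"
  and qpoch_pos': "n > 0 \<Longrightarrow> m > 0 \<Longrightarrow> qpoch (q ^ n) (q ^ m) > 0"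
  using qpoch_pos q_power_lt by auto

lemma w_pos: "w0 q > 0" "w1 q > 0" "w2 q > 0"
  using qpoch_neg_pos[of 1 2] qpoch_pos'[of 1 2] qpoch_neg_pos[of 2 2] by (simp_all add: w0_def w1_def w2_def)

lemma qpoch_q_q: "qpoch q q = w1 q * qpoch (q\<^sup>2) (q\<^sup>2)"
  using qpoch_split[of q 2 q] q by (simp add: w1_def eval_nat_numeral)

text \<open>Euler's identity: multiplying \<open>1 - q ^ n\<close> by \<open>1 + q ^ n\<close> for
  all \<open>n >= 1\<close> gives the product over even exponents, which also occurs on the other
  side and cancels.\<close>

lemma w_prod: "w0 q * w1 q * w2 q = 1"
proof -
  have "qpoch (q\<^sup>2) (q\<^sup>2) = qpoch q q * qpoch (- q) q"
    using qpoch_mult_minus[of q q] q by simp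
  also have "qpoch (- q) q = w0 q * w2 q"
    using qpoch_split[of q 2 "-q"] q by (simp add: w0_def w2_def eval_nat_numeral)
  finally have "qpoch (q\<^sup>2) (q\<^sup>2) * 1 = qpoch (q\<^sup>2) (q\<^sup>2) * (w0 q * w1 q * w2 q)"
    by (simp add: qpoch_q_q mult_ac)
  then show ?thesis
    using qpoch_pos'[of 2 2] by simp
qed

lemma w1_square: "w1 (q\<^sup>2) * w2 q = 1"
proof -
  have "w1 (q\<^sup>2) = w0 q * w1 q"
    using qpoch_mult_minus[of "q\<^sup>2" q] q_power_lt[of 2] by (simp add: w0_def w1_def mult.commute)
  then show ?thesis
    using w_prod by simp
qed

lemma qpoch_square: "qpoch ((q\<^sup>2)\<^sup>2) ((q\<^sup>2)\<^sup>2) = w2 q * qpoch (q\<^sup>2) (q\<^sup>2)"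
  using qpoch_mult_minus[of "q\<^sup>2" "q\<^sup>2"] q_power_lt[of 2] by (simp add: w2_def mult.commute)

text \<open>For a sign \<open>c\<close> the two halves of \<open>theta_prod\<close> belong to the
  exponents \<open>k\<close> and \<open>N - k\<close>, so residue classes modulo \<open>N\<close>
  are paired off.\<close>

lemma theta_monomial:
  assumes "k \<le> N" "c = 1 \<or> c = -1"
  shows "theta_prod (c * q ^ k) (q ^ N) = qpoch (c * q ^ k) (q ^ N) * qpoch (c * q ^ (N - k)) (q ^ N)"
proof -
  have "q ^ N / (c * q ^ k) = c * q ^ (N - k)"
    using assms q by (auto simp: power_diff)
  then show ?thesis
    by (simp add: theta_prod_def)
qed

lemma theta_monomial_sym:
  assumes "k \<le> N" "c = 1 \<or> c = -1"
  shows "theta_prod (c * q ^ (N - k)) (q ^ N) = theta_prod (c * q ^ k) (q ^ N)"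
  using assms by (simp add: theta_monomial mult.commute)

lemma theta_monomial_inverse:
  assumes "N > 0" "c = 1 \<or> c = -1"
  shows "theta_prod (c / q ^ k) (q ^ N) = - c * theta_prod (c * q ^ k) (q ^ N) / q ^ k"
  using theta_prod_inverse[of "c * q ^ k" "q ^ N"] q_power_lt[of N] assms q by auto

lemma qpoch_minus_1: "N > 0 \<Longrightarrow> qpoch (- 1) (q ^ N) = 2 * qpoch (- (q ^ N)) (q ^ N)"
  using qpoch_unfold[of "q ^ N" "-1"] q_power_lt[of N] by simp

lemma theta_prod_minus_1: "N > 0 \<Longrightarrow> theta_prod (- 1) (q ^ N) = 2 * (qpoch (- (q ^ N)) (q ^ N))\<^sup>2"
  using theta_monomial[of 0 N "-1"] by (simp add: qpoch_minus_1 power2_eq_square)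

text \<open>Jacobi's theta_3^4 = theta_4^4 + theta_2^4 after removal of the common factor. It is the
  three-term relation in base \<open>q ^ 2\<close> with parameters
  \<open>1, -1, q, -q\<close>.\<close>

lemma w_jacobi: "w0 q ^ 8 = w1 q ^ 8 + 16 * q * w2 q ^ 8"
proof -
  let ?J = "\<lambda>z. theta_prod z (q\<^sup>2)"
  have J: "?J (- 1) = 2 * (w2 q)\<^sup>2" "?J q = (w1 q)\<^sup>2" "?J (- q) = (w0 q)\<^sup>2" "?J (- (q\<^sup>2)) = 2 * (w2 q)\<^sup>2"
    using theta_prod_minus_1[of 2] theta_monomial[of 1 2 1] theta_monomial[of 1 2 "-1"]
      theta_monomial_sym[of 0 2 "-1"]
    by (simp_all add: w0_def w1_def w2_def power2_eq_square)
  have J': "?J (1 / q) = - (w1 q)\<^sup>2 / q" "?J (- 1 / q) = (w0 q)\<^sup>2 / q"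
    using theta_monomial_inverse[of 2 1 1] theta_monomial_inverse[of 2 "-1" 1] by (simp_all add: J)
  have args: "1 * (- 1) = (- 1 :: real)" "1 / (- 1) = (- 1 :: real)" "q * - q = - (q\<^sup>2)" "q / - q = - 1"
    "1 * - q = - q" "1 / - q = - 1 / q" "- 1 * q = - q" "1 * q = q" "- 1 * - q = q" "- 1 / - q = 1 / q"
    using q by (simp_all add: power2_eq_square)
  have "- 1 * (?J (- 1) * ?J (- 1) * ?J (- (q\<^sup>2)) * ?J (- 1)) + q * (?J (- q) * ?J (- 1 / q) * ?J (- q) * ?J (- 1 / q))
    = q * (?J q * ?J (1 / q) * ?J q * ?J (1 / q))"
    using weierstrass_three_term[of "q\<^sup>2" 1 "-1" q "-q"] q q_power_lt[of 2] by (simp only: args) simp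
  then show ?thesis
    unfolding J J' using q by (simp add: field_simps eval_nat_numeral)
qed

text \<open>Guetzlaff's modular equation of degree 7. In base \<open>q ^ 14\<close> its terms are
  the theta products at \<open>- (q ^ k)\<close> and at \<open>q ^ k\<close> for odd
  \<open>k\<close>, and at \<open>- (q ^ k)\<close> for even \<open>k\<close>; the relation between
  them is a single three-term relation.\<close>

lemma w_degree_7: "w0 q * w0 (q ^ 7) = w1 q * w1 (q ^ 7) + 2 * q * w2 q * w2 (q ^ 7)"
proof -
  let ?J = "\<lambda>z. theta_prod z (q ^ 14)"
  \<comment> \<open>The classes pair as 1, 13 and 3, 11 and 5, 9. The class 7 is paired with itself,
    and its second copy is the product at \<open>q ^ 7\<close>.\<close>
  have odd_prod: "theta_prod (c * q ^ 1) (q ^ 14) * theta_prod (c * q ^ 3) (q ^ 14) *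
      theta_prod (c * q ^ 5) (q ^ 14) * theta_prod (c * q ^ 7) (q ^ 14) = qpoch (c * q) (q\<^sup>2) * qpoch (c * q ^ 7) ((q ^ 7)\<^sup>2)"
    if "c = 1 \<or> c = -1" for c
  proof -
    have "qpoch (c * q) (q\<^sup>2) = qpoch (c * q ^ 1) (q ^ 14) * qpoch (c * q ^ 3) (q ^ 14) * qpoch (c * q ^ 5) (q ^ 14) * qpoch (c * q ^ 7) (q ^ 14)
        * qpoch (c * q ^ 9) (q ^ 14) * qpoch (c * q ^ 11) (q ^ 14) * qpoch (c * q ^ 13) (q ^ 14)"
      using qpoch_split[of "q\<^sup>2" 7 "c * q"] q_power_lt[of 2]
      by (simp add: lessThan_Suc numeral_eq_Suc mult_ac)
    then show ?thesis
      using that theta_monomial[of 1 14 c] by (simp add: theta_monomial flip: power_mult)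
  qed
  have J: "?J (- q) * ?J (- (q ^ 3)) * ?J (- (q ^ 5)) * ?J (- (q ^ 7)) = w0 q * w0 (q ^ 7)"
     "?J q * ?J (q ^ 3) * ?J (q ^ 5) * ?J (q ^ 7) = w1 q * w1 (q ^ 7)"
    using odd_prod[of "-1"] odd_prod[of 1] by (simp_all add: w0_def w1_def)
  have J2: "?J (- 1) * ?J (- (q ^ 2)) * ?J (- (q ^ 4)) * ?J (- (q ^ 6)) = 2 * w2 q * w2 (q ^ 7)"
  proof -
    have "w2 q = qpoch (- (q ^ 2)) (q ^ 14) * qpoch (- (q ^ 4)) (q ^ 14) * qpoch (- (q ^ 6)) (q ^ 14) * qpoch (- (q ^ 8)) (q ^ 14)
        * qpoch (- (q ^ 10)) (q ^ 14) * qpoch (- (q ^ 12)) (q ^ 14) * qpoch (- (q ^ 14)) (q ^ 14)"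
      using qpoch_split[of "q\<^sup>2" 7 "- (q\<^sup>2)"] q_power_lt[of 2]
      by (simp add: w2_def lessThan_Suc numeral_eq_Suc mult_ac)
    moreover have "w2 (q ^ 7) = qpoch (- (q ^ 14)) (q ^ 14)"
      by (simp add: w2_def flip: power_mult)
    ultimately show ?thesis
      using theta_prod_minus_1[of 14] theta_monomial[of 2 14 "-1"] theta_monomial[of 4 14 "-1"] theta_monomial[of 6 14 "-1"]
      by (simp add: power2_eq_square)
  qed
  have J': "?J (- 1 / q ^ 4) = ?J (- (q ^ 4)) / q ^ 4" "?J (- 1 / q ^ 5) = ?J (- (q ^ 5)) / q ^ 5" "?J (- 1 / q) = ?J (- q) / q"
     "?J (1 / q) = - ?J q / q" "?J (1 / q ^ 5) = - ?J (q ^ 5) / q ^ 5" "?J (- (q ^ 8)) = ?J (- (q ^ 6))"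
    using theta_monomial_inverse[of 14 "-1" 4] theta_monomial_inverse[of 14 "-1" 5] theta_monomial_inverse[of 14 "-1" 1]
      theta_monomial_inverse[of 14 1 1] theta_monomial_inverse[of 14 1 5] theta_monomial_sym[of 6 14 "-1"] by simp_all
  have args: "q * - q = - (q ^ 2)" "q / - q = - 1" "q ^ 2 * - (q ^ 6) = - (q ^ 8)" "q ^ 2 / - (q ^ 6) = - 1 / q ^ 4"
    "q * - (q ^ 6) = - (q ^ 7)" "q / - (q ^ 6) = - 1 / q ^ 5" "- q * q ^ 2 = - (q ^ 3)" "- q / q ^ 2 = - 1 / q"
    "q * q ^ 2 = q ^ 3" "q / q ^ 2 = 1 / q" "- q * - (q ^ 6) = q ^ 7" "- q / - (q ^ 6) = 1 / q ^ 5"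
    using q by (simp_all add: field_simps eval_nat_numeral)
  \<comment> \<open>The parameters are chosen so that, up to sign and inversion, products and
    quotients are the powers 2, 0, 8, 4, then 7, 5, 3, 1, then 3, 1, 7, 5 of \<open>q\<close>; the
    power 8 is equivalent to 6.\<close>
  have "- q * (?J (- (q ^ 2)) * ?J (- 1) * ?J (- (q ^ 8)) * ?J (- 1 / q ^ 4))
      + q ^ 2 * (?J (- (q ^ 7)) * ?J (- 1 / q ^ 5) * ?J (- (q ^ 3)) * ?J (- 1 / q))
    = q ^ 2 * (?J (q ^ 3) * ?J (1 / q) * ?J (q ^ 7) * ?J (1 / q ^ 5))"
    using weierstrass_three_term[of "q ^ 14" q "-q" "q ^ 2" "- (q ^ 6)"] q q_power_lt[of 14] by (simp only: args) simp
  then have "- q * (?J (- 1) * ?J (- (q ^ 2)) * ?J (- (q ^ 4)) * ?J (- (q ^ 6)))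
      + ?J (- q) * ?J (- (q ^ 3)) * ?J (- (q ^ 5)) * ?J (- (q ^ 7)) = ?J q * ?J (q ^ 3) * ?J (q ^ 5) * ?J (q ^ 7)"
    unfolding J' using q by (simp add: field_simps eval_nat_numeral)
  then show ?thesis
    unfolding J J2 by simp
qed

text \<open>Of the odd residues 1, 3, 5 and the even residues 2, 4, 6 modulo 6, the classes 3 and 6
  form the Weber products at \<open>q ^ 3\<close>; the remaining pairs are therefore
  quotients.\<close>

lemma theta_prod_6:
  defines "J \<equiv> \<lambda>z. theta_prod z (q ^ 6)"
  shows "J q = w1 q / w1 (q ^ 3)" "J (- q) = w0 q / w0 (q ^ 3)" "J (- (q ^ 2)) = w2 q / w2 (q ^ 3)"
    "J (q ^ 3) = (w1 (q ^ 3))\<^sup>2" "J (- (q ^ 3)) = (w0 (q ^ 3))\<^sup>2" "J (- 1) = 2 * (w2 (q ^ 3))\<^sup>2"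
proof -
  have split: "qpoch (c * q) (q\<^sup>2) = qpoch (c * q) (q ^ 6) * qpoch (c * q ^ 3) (q ^ 6) * qpoch (c * q ^ 5) (q ^ 6)" for c
    using qpoch_split[of "q\<^sup>2" 3 "c * q"] q_power_lt[of 2]
    by (simp add: lessThan_Suc numeral_eq_Suc mult_ac)
  have a: "w1 q = qpoch q (q ^ 6) * qpoch (q ^ 3) (q ^ 6) * qpoch (q ^ 5) (q ^ 6)"
    "w0 q = qpoch (- q) (q ^ 6) * qpoch (- (q ^ 3)) (q ^ 6) * qpoch (- (q ^ 5)) (q ^ 6)"
    "w2 q = qpoch (- (q ^ 2)) (q ^ 6) * qpoch (- (q ^ 4)) (q ^ 6) * qpoch (- (q ^ 6)) (q ^ 6)"
    using split[of 1] split[of "-1"] split[of "-q"] by (simp_all add: w0_def w1_def w2_def power2_eq_square eval_nat_numeral)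
  have b: "w1 (q ^ 3) = qpoch (q ^ 3) (q ^ 6)" "w0 (q ^ 3) = qpoch (- (q ^ 3)) (q ^ 6)" "w2 (q ^ 3) = qpoch (- (q ^ 6)) (q ^ 6)"
    by (simp_all add: w0_def w1_def w2_def flip: power_mult)
  have nz: "qpoch (q ^ 3) (q ^ 6) \<noteq> 0" "qpoch (- (q ^ 3)) (q ^ 6) \<noteq> 0" "qpoch (- (q ^ 6)) (q ^ 6) \<noteq> 0"
    using qpoch_pos'[of 3 6] qpoch_neg_pos[of 3 6] qpoch_neg_pos[of 6 6] by auto
  show "J q = w1 q / w1 (q ^ 3)" "J (- q) = w0 q / w0 (q ^ 3)" "J (- (q ^ 2)) = w2 q / w2 (q ^ 3)"
    "J (q ^ 3) = (w1 (q ^ 3))\<^sup>2" "J (- (q ^ 3)) = (w0 (q ^ 3))\<^sup>2" "J (- 1) = 2 * (w2 (q ^ 3))\<^sup>2"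
    unfolding J_def a b
    using theta_monomial[of 1 6 1] theta_monomial[of 1 6 "-1"] theta_monomial[of 2 6 "-1"]
      theta_monomial[of 3 6 1] theta_monomial[of 3 6 "-1"] theta_prod_minus_1[of 6] nz
    by (simp_all add: power2_eq_square)
qed

text \<open>Two instances of the three-term relation in base \<open>q ^ 6\<close>. Combined with
  \<open>w_jacobi\<close> they will give the rational parametrization of degree 3.\<close>

lemma w_degree_3:
  shows "w1 (q ^ 3) ^ 3 / w1 q = w0 (q ^ 3) ^ 3 / w0 q + 2 * q * w2 (q ^ 3) ^ 3 / w2 q"
    and "2 * w2 q ^ 3 / w2 (q ^ 3) = w0 q ^ 3 / w0 (q ^ 3) + w1 q ^ 3 / w1 (q ^ 3)"
proof -
  let ?J = "\<lambda>z. theta_prod z (q ^ 6)"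
  have pos: "w0 q > 0" "w1 q > 0" "w2 q > 0" "w0 (q ^ 3) > 0" "w1 (q ^ 3) > 0" "w2 (q ^ 3) > 0"
    using w_pos qpoch_neg_pos[of 3 6] qpoch_pos'[of 3 6] qpoch_neg_pos[of 6 6]
    by (simp_all add: w0_def w1_def w2_def flip: power_mult)
  have J': "?J (- 1 / q) = ?J (- q) / q" "?J (1 / q) = - ?J q / q" "?J (1 / q ^ 2) = - ?J (q ^ 2) / q ^ 2"
    "?J (- 1 / q ^ 2) = ?J (- (q ^ 2)) / q ^ 2" "?J (q ^ 4) = ?J (q ^ 2)"
    using theta_monomial_inverse[of 6 "-1" 1] theta_monomial_inverse[of 6 1 1]
      theta_monomial_inverse[of 6 1 2] theta_monomial_inverse[of 6 "-1" 2] theta_monomial_sym[of 2 6 1]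
    by simp_all
  \<comment> \<open>This value is an eta quotient, not a Weber quotient. It occurs in all three
    terms and cancels.\<close>
  have J2: "?J (q ^ 2) \<noteq> 0"
    using theta_monomial[of 2 6 1] qpoch_pos'[of 2 6] qpoch_pos'[of 4 6] by simp
  \<comment> \<open>Half-integral powers of \<open>q\<close> may serve as parameters, because only
    their products and quotients enter and these are integral powers.\<close>
  define s where "s = sqrt q"
  have s: "s * s = q" "s > 0"
    using q by (simp_all add: s_def)
  have q_s: "q = s ^ 2"
    using s by (simp add: power2_eq_square)
  have args: "s * - s = - q" "s / - s = - 1" "s ^ 3 * s ^ 5 = q ^ 4" "s ^ 3 / s ^ 5 = 1 / q"
    "s * s ^ 5 = q ^ 3" "s / s ^ 5 = 1 / q ^ 2" "- s * s ^ 3 = - (q ^ 2)" "- s / s ^ 3 = - 1 / q"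
    "s * s ^ 3 = q ^ 2" "s / s ^ 3 = 1 / q" "- s * s ^ 5 = - (q ^ 3)" "- s / s ^ 5 = - 1 / q ^ 2"
    using s(2) unfolding q_s by (simp_all add: field_simps eval_nat_numeral)
  have "- s * (?J (- q) * ?J (- 1) * ?J (q ^ 4) * ?J (1 / q)) + s ^ 3 * (?J (q ^ 3) * ?J (1 / q ^ 2) * ?J (- (q ^ 2)) * ?J (- 1 / q))
    = s ^ 3 * (?J (q ^ 2) * ?J (1 / q) * ?J (- (q ^ 3)) * ?J (- 1 / q ^ 2))"
    using weierstrass_three_term[of "q ^ 6" s "-s" "s ^ 3" "s ^ 5"] s(2) q q_power_lt[of 6] by (simp only: args) simp
  then have "s * (- (?J (- q) * ?J (- 1) * ?J (q ^ 4) * ?J (1 / q)) + q * (?J (q ^ 3) * ?J (1 / q ^ 2) * ?J (- (q ^ 2)) * ?J (- 1 / q)))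
    = s * (q * (?J (q ^ 2) * ?J (1 / q) * ?J (- (q ^ 3)) * ?J (- 1 / q ^ 2)))"
    by (simp add: q_s algebra_simps eval_nat_numeral)
  then have "- (?J (- q) * ?J (- 1) * ?J (q ^ 4) * ?J (1 / q)) + q * (?J (q ^ 3) * ?J (1 / q ^ 2) * ?J (- (q ^ 2)) * ?J (- 1 / q))
    = q * (?J (q ^ 2) * ?J (1 / q) * ?J (- (q ^ 3)) * ?J (- 1 / q ^ 2))"
    using s(2) by (simp only: mult_cancel_left) simp
  then have "q ^ 2 * ?J (q ^ 2) * (q * ?J (- 1) * ?J (- q) * ?J q + ?J q * ?J (- (q ^ 3)) * ?J (- (q ^ 2)))
    = q ^ 2 * ?J (q ^ 2) * (?J (q ^ 3) * ?J (- q) * ?J (- (q ^ 2)))"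
    unfolding J' using q by (simp add: field_simps eval_nat_numeral)
  then have "q * ?J (- 1) * ?J (- q) * ?J q + ?J q * ?J (- (q ^ 3)) * ?J (- (q ^ 2)) = ?J (q ^ 3) * ?J (- q) * ?J (- (q ^ 2))"
    using J2 q by simp
  then have "q * (2 * (w2 (q ^ 3))\<^sup>2) * (w0 q / w0 (q ^ 3)) * (w1 q / w1 (q ^ 3)) + w1 q / w1 (q ^ 3) * (w0 (q ^ 3))\<^sup>2 * (w2 q / w2 (q ^ 3))
     = (w1 (q ^ 3))\<^sup>2 * (w0 q / w0 (q ^ 3)) * (w2 q / w2 (q ^ 3))"
    unfolding theta_prod_6 .
  note eq = this
  have alg: "b1 ^ 3 / a1 = b0 ^ 3 / a0 + 2 * q * b2 ^ 3 / a2"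
    if "q * (2 * b2\<^sup>2) * (a0 / b0) * (a1 / b1) + a1 / b1 * b0\<^sup>2 * (a2 / b2) = b1\<^sup>2 * (a0 / b0) * (a2 / b2)"
      and nz: "a0 > 0" "a1 > 0" "a2 > 0" "b0 > 0" "b1 > 0" "b2 > 0" for a0 a1 a2 b0 b1 b2 :: real
  proof -
    have "b1 ^ 3 / a1 = (b1\<^sup>2 * (a0 / b0) * (a2 / b2)) * (b0 * b1 * b2 / (a0 * a1 * a2))"
      using nz by (simp add: field_simps eval_nat_numeral)
    moreover have "b0 ^ 3 / a0 + 2 * q * b2 ^ 3 / a2 =
        (q * (2 * b2\<^sup>2) * (a0 / b0) * (a1 / b1) + a1 / b1 * b0\<^sup>2 * (a2 / b2)) * (b0 * b1 * b2 / (a0 * a1 * a2))"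
      using nz by (simp add: field_simps eval_nat_numeral)
    ultimately show ?thesis
      using that(1) by simp
  qed
  show "w1 (q ^ 3) ^ 3 / w1 q = w0 (q ^ 3) ^ 3 / w0 q + 2 * q * w2 (q ^ 3) ^ 3 / w2 q"
    by (rule alg[OF eq pos])
  have args: "1 * q = q" "- (q ^ 2) * - q = q ^ 3" "- (q ^ 2) / - q = q"
    "1 * - q = - q" "1 / - q = - 1 / q" "q * - (q ^ 2) = - (q ^ 3)" "q / - (q ^ 2) = - 1 / q"
    "1 * - (q ^ 2) = - (q ^ 2)" "1 / - (q ^ 2) = - 1 / q ^ 2" "q * - q = - (q ^ 2)" "q / - q = - 1"
    using q by (simp_all add: field_simps eval_nat_numeral)
  have "q * (?J q * ?J (1 / q) * ?J (q ^ 3) * ?J q) + - (q ^ 2) * (?J (- q) * ?J (- 1 / q) * ?J (- (q ^ 3)) * ?J (- 1 / q))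
    = - (q ^ 2) * (?J (- (q ^ 2)) * ?J (- 1 / q ^ 2) * ?J (- (q ^ 2)) * ?J (- 1))"
    using weierstrass_three_term[of "q ^ 6" 1 q "- (q ^ 2)" "- q"] q q_power_lt[of 6] by (simp only: args) simp
  then have "?J q ^ 3 * ?J (q ^ 3) + ?J (- q) ^ 3 * ?J (- (q ^ 3)) = ?J (- (q ^ 2)) ^ 3 * ?J (- 1)"
    unfolding J' using q by (simp add: field_simps eval_nat_numeral)
  then have "(w1 q / w1 (q ^ 3)) ^ 3 * (w1 (q ^ 3))\<^sup>2 + (w0 q / w0 (q ^ 3)) ^ 3 * (w0 (q ^ 3))\<^sup>2 = (w2 q / w2 (q ^ 3)) ^ 3 * (2 * (w2 (q ^ 3))\<^sup>2)"
    unfolding theta_prod_6 .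
  note eq2 = this
  have alg2: "2 * a2 ^ 3 / b2 = a0 ^ 3 / b0 + a1 ^ 3 / b1"
    if "(a1 / b1) ^ 3 * b1\<^sup>2 + (a0 / b0) ^ 3 * b0\<^sup>2 = (a2 / b2) ^ 3 * (2 * b2\<^sup>2)"
      and nz: "b0 > 0" "b1 > 0" "b2 > 0" for a0 a1 a2 b0 b1 b2 :: real
  proof -
    have "(a / b) ^ 3 * b\<^sup>2 = a ^ 3 / b" if "b > 0" for a b :: real
      using that by (simp add: field_simps eval_nat_numeral)
    from this[OF nz(1), of a0] this[OF nz(2), of a1] this[OF nz(3), of a2] show ?thesis
      using that(1) by simp
  qed
  show "2 * w2 q ^ 3 / w2 (q ^ 3) = w0 q ^ 3 / w0 (q ^ 3) + w1 q ^ 3 / w1 (q ^ 3)"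
    by (rule alg2[OF eq2 pos(4-6)])
qed

lemma theta_prod_12:
  defines "J \<equiv> \<lambda>z. theta_prod z (q ^ 12)"
  shows "J q * J (q ^ 5) = w1 q / w1 (q ^ 3)" "J (q ^ 3) = w1 (q ^ 3)" "J (q ^ 6) = (w1 (q ^ 6))\<^sup>2"
    "J (q ^ 2) = w1 (q ^ 2) / w1 (q ^ 6)" "J (q ^ 4) = qpoch (q ^ 4) (q ^ 4) / qpoch (q ^ 12) (q ^ 12)"
proof -
  have "w1 q = qpoch q (q ^ 12) * qpoch (q ^ 3) (q ^ 12) * qpoch (q ^ 5) (q ^ 12) * qpoch (q ^ 7) (q ^ 12) * qpoch (q ^ 9) (q ^ 12) * qpoch (q ^ 11) (q ^ 12)"
    using qpoch_split[of "q\<^sup>2" 6 q] q_power_lt[of 2]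
    by (simp add: w1_def lessThan_Suc numeral_eq_Suc mult_ac)
  moreover have "w1 (q ^ 3) = qpoch (q ^ 3) (q ^ 12) * qpoch (q ^ 9) (q ^ 12)"
    using qpoch_split[of "q ^ 6" 2 "q ^ 3"] q_power_lt[of 6]
    by (simp add: w1_def lessThan_Suc numeral_2_eq_2 flip: power_mult power_add)
  moreover have "w1 (q ^ 6) = qpoch (q ^ 6) (q ^ 12)"
    by (simp add: w1_def flip: power_mult)
  moreover have "w1 (q ^ 2) = qpoch (q ^ 2) (q ^ 12) * qpoch (q ^ 6) (q ^ 12) * qpoch (q ^ 10) (q ^ 12)"
    using qpoch_split[of "q ^ 4" 3 "q ^ 2"] q_power_lt[of 4]
    by (simp add: w1_def lessThan_Suc numeral_eq_Suc mult_ac)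
  moreover have "qpoch (q ^ 4) (q ^ 4) = qpoch (q ^ 4) (q ^ 12) * qpoch (q ^ 8) (q ^ 12) * qpoch (q ^ 12) (q ^ 12)"
    using qpoch_split[of "q ^ 4" 3 "q ^ 4"] q_power_lt[of 4]
    by (simp add: lessThan_Suc numeral_3_eq_3 mult_ac flip: power_mult power_add)
  moreover have "qpoch (q ^ 3) (q ^ 12) \<noteq> 0" "qpoch (q ^ 9) (q ^ 12) \<noteq> 0" "qpoch (q ^ 6) (q ^ 12) \<noteq> 0" "qpoch (q ^ 12) (q ^ 12) \<noteq> 0"
    using qpoch_pos'[of 3 12] qpoch_pos'[of 9 12] qpoch_pos'[of 6 12] qpoch_pos'[of 12 12] by auto
  ultimately show "J q * J (q ^ 5) = w1 q / w1 (q ^ 3)" "J (q ^ 3) = w1 (q ^ 3)" "J (q ^ 6) = (w1 (q ^ 6))\<^sup>2"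
    "J (q ^ 2) = w1 (q ^ 2) / w1 (q ^ 6)" "J (q ^ 4) = qpoch (q ^ 4) (q ^ 4) / qpoch (q ^ 12) (q ^ 12)"
    unfolding J_def
    using theta_monomial[of 1 12 1] theta_monomial[of 5 12 1] theta_monomial[of 3 12 1]
      theta_monomial[of 6 12 1] theta_monomial[of 2 12 1] theta_monomial[of 4 12 1]
    by (simp_all add: power2_eq_square)
qed

end

text \<open>Here the eta quotient survives: in base \<open>q ^ 12\<close> the theta value at
  \<open>q ^ 4\<close> is \<open>qpoch (q ^ 4) (q ^ 4) / qpoch (q ^ 12) (q ^ 12)\<close>. The
  relation ties this quotient to Weber quotients and later yields the product of the two
  \<open>theta_r\<close> values.\<close>

lemma w_degree_3_multiplier:
  fixes q :: real
  assumes q: "0 < q" "q < 1"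
  shows "w2 q * w1 (q ^ 3) ^ 3 / (w1 q * w2 (q ^ 3) ^ 3) =
    q + (qpoch (q\<^sup>2) (q\<^sup>2) / qpoch (q ^ 6) (q ^ 6))\<^sup>2 * (w2 q / w2 (q ^ 3)) ^ 4"
proof -
  let ?J = "\<lambda>z. theta_prod z (q ^ 12)"
  have q3: "0 < q ^ 3" "q ^ 3 < 1"
    using q by (simp_all add: power_less_one_iff)
  have pos: "w1 q > 0" "w2 q > 0" "w1 (q ^ 3) > 0" "w2 (q ^ 3) > 0"
    using w_pos[OF q] w_pos[OF q3] by auto
  have J': "?J (1 / q ^ 2) = - ?J (q ^ 2) / q ^ 2" "?J (1 / q ^ 4) = - ?J (q ^ 4) / q ^ 4" "?J (1 / q) = - ?J q / q"
     "?J (1 / q ^ 3) = - ?J (q ^ 3) / q ^ 3" "?J (q ^ 7) = ?J (q ^ 5)"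
    using theta_monomial_inverse[OF q, of 12 1 1] theta_monomial_inverse[OF q, of 12 1 2]
      theta_monomial_inverse[OF q, of 12 1 3] theta_monomial_inverse[OF q, of 12 1 4]
      theta_monomial_sym[OF q, of 5 12 1] by simp_all
  have args: "1 * q ^ 2 = q ^ 2" "q ^ 4 * q ^ 3 = q ^ 7" "q ^ 4 / q ^ 3 = q"
    "1 * q ^ 3 = q ^ 3" "q ^ 2 * q ^ 4 = q ^ 6" "q ^ 2 / q ^ 4 = 1 / q ^ 2"
    "1 * q ^ 4 = q ^ 4" "q ^ 2 * q ^ 3 = q ^ 5" "q ^ 2 / q ^ 3 = 1 / q"
    using q by (simp_all add: field_simps eval_nat_numeral)
  have "q ^ 2 * (?J (q ^ 2) * ?J (1 / q ^ 2) * ?J (q ^ 7) * ?J q) + q ^ 4 * (?J (q ^ 3) * ?J (1 / q ^ 3) * ?J (q ^ 6) * ?J (1 / q ^ 2))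
    = q ^ 4 * (?J (q ^ 4) * ?J (1 / q ^ 4) * ?J (q ^ 5) * ?J (1 / q))"
    using weierstrass_three_term[of "q ^ 12" 1 "q ^ 2" "q ^ 4" "q ^ 3"] q q_power_lt[OF q, of 12]
    by (simp only: args) simp
  then have "?J (q ^ 3) ^ 2 * ?J (q ^ 6) * ?J (q ^ 2) = (?J q * ?J (q ^ 5)) * (?J (q ^ 4) ^ 2 + q * ?J (q ^ 2) ^ 2)"
    unfolding J' using q by (simp add: field_simps eval_nat_numeral)
  then have eq: "w1 (q ^ 3) ^ 2 * (w1 (q ^ 6))\<^sup>2 * (w1 (q ^ 2) / w1 (q ^ 6)) =
     (w1 q / w1 (q ^ 3)) * ((qpoch (q ^ 4) (q ^ 4) / qpoch (q ^ 12) (q ^ 12)) ^ 2 + q * (w1 (q ^ 2) / w1 (q ^ 6)) ^ 2)"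
    unfolding theta_prod_12[OF q] .
  have "w1 (q ^ 2) = 1 / w2 q" "w1 (q ^ 6) = 1 / w2 (q ^ 3)"
    using w1_square[OF q] w1_square[OF q3] pos by (simp_all add: field_simps flip: power_mult)
  moreover have "qpoch (q ^ 4) (q ^ 4) = w2 q * qpoch (q\<^sup>2) (q\<^sup>2)" "qpoch (q ^ 12) (q ^ 12) = w2 (q ^ 3) * qpoch (q ^ 6) (q ^ 6)"
    using qpoch_square[OF q] qpoch_square[OF q3] by (simp_all flip: power_mult)
  ultimately have "w1 (q ^ 3) ^ 2 / (w2 q * w2 (q ^ 3)) =
     (w1 q / w1 (q ^ 3)) * ((w2 q / w2 (q ^ 3)) ^ 2 * (qpoch (q\<^sup>2) (q\<^sup>2) / qpoch (q ^ 6) (q ^ 6)) ^ 2 + q * (w2 (q ^ 3) / w2 q) ^ 2)"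
    using eq pos by (simp add: power2_eq_square power_divide mult_ac)
  then have "w1 (q ^ 3) ^ 2 / (w2 q * w2 (q ^ 3)) * (w1 (q ^ 3) / w1 q * (w2 q / w2 (q ^ 3)) ^ 2) =
     ((w2 q / w2 (q ^ 3)) ^ 2 * (qpoch (q\<^sup>2) (q\<^sup>2) / qpoch (q ^ 6) (q ^ 6)) ^ 2 + q * (w2 (q ^ 3) / w2 q) ^ 2) * (w2 q / w2 (q ^ 3)) ^ 2"
    using pos by (simp only:) (simp add: field_simps)
  also have "\<dots> = q + (qpoch (q\<^sup>2) (q\<^sup>2) / qpoch (q ^ 6) (q ^ 6))\<^sup>2 * (w2 q / w2 (q ^ 3)) ^ 4"
  proof -
    have "(X\<^sup>2 * M + q * (1 / X)\<^sup>2) * X\<^sup>2 = q + M * X ^ 4" if "X > 0" for X M :: real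
      using that by (simp add: field_simps eval_nat_numeral)
    from this[of "w2 q / w2 (q ^ 3)"] show ?thesis
      using pos by simp
  qed
  also have "w1 (q ^ 3) ^ 2 / (w2 q * w2 (q ^ 3)) * (w1 (q ^ 3) / w1 q * (w2 q / w2 (q ^ 3)) ^ 2)
     = w2 q * w1 (q ^ 3) ^ 3 / (w1 q * w2 (q ^ 3) ^ 3)"
    using pos by (simp add: field_simps eval_nat_numeral)
  finally show ?thesis .
qed

section \<open>Inversion of the theta constants\<close>

lemma cos_power_binomial:
  "complex_of_real ((2 * cos x) ^ (2 * m)) = (\<Sum>r\<le>2*m. of_nat ((2 * m) choose r) * cis (2 * (real r - real m) * x))"
proof -
  have "complex_of_real (2 * cos x) = cis x + cis (- x)"
    by (simp add: complex_eq_iff)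
  then have "complex_of_real ((2 * cos x) ^ (2 * m)) = (cis x + cis (- x)) ^ (2 * m)"
    by (simp only: of_real_power)
  also have "\<dots> = (\<Sum>r\<le>2*m. of_nat ((2 * m) choose r) * cis x ^ r * cis (- x) ^ (2 * m - r))"
    by (rule binomial_ring)
  also have "\<dots> = (\<Sum>r\<le>2*m. of_nat ((2 * m) choose r) * cis (2 * (real r - real m) * x))"
  proof (rule sum.cong)
    fix r assume "r \<in> {..2*m}"
    then have "real r * x + real (2 * m - r) * (- x) = 2 * (real r - real m) * x"
      by (simp add: of_nat_diff algebra_simps)
    then have "cis x ^ r * cis (- x) ^ (2 * m - r) = cis (2 * (real r - real m) * x)"
      unfolding Complex.DeMoivre cis_mult by (rule arg_cong)
    then show "of_nat ((2 * m) choose r) * cis x ^ r * cis (- x) ^ (2 * m - r) =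
        of_nat ((2 * m) choose r) * cis (2 * (real r - real m) * x)"
      by (simp only: mult.assoc)
  qed simp
  finally show ?thesis .
qed

text \<open>Orthogonality of the \<open>l\<close>-th roots of unity over the symmetric residues from
  \<open>-h\<close> to \<open>h\<close>; the shift by \<open>h\<close> is the constant factor
  \<open>inverse w ^ h\<close>.\<close>

lemma sum_cis_roots:
  fixes n :: int and h :: nat
  defines "l \<equiv> 2 * h + 1"
  shows "(\<Sum>i<l. cis (2 * real_of_int n * (pi * (real i - real h) / real l))) = (if int l dvd n then of_nat l else 0)"
proof -
  have l0: "real l \<noteq> 0"
    by (simp add: l_def)
  define w where "w = cis (2 * pi * real_of_int n / real l)"
  have "cis (2 * real_of_int n * (pi * (real i - real h) / real l)) = w ^ i * inverse w ^ h" for i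
  proof -
    have "2 * real_of_int n * (pi * (real i - real h) / real l) =
      real i * (2 * pi * real_of_int n / real l) + real h * (- (2 * pi * real_of_int n / real l))"
      using l0 by (simp add: field_simps)
    then show ?thesis
      unfolding w_def cis_inverse Complex.DeMoivre cis_mult by simp
  qed
  then have "(\<Sum>i<l. cis (2 * real_of_int n * (pi * (real i - real h) / real l))) = (\<Sum>i<l. w ^ i) * inverse w ^ h"
    by (simp add: sum_distrib_right)
  also have "\<dots> = (if int l dvd n then of_nat l else 0)"
  proof (cases "int l dvd n")
    case True
    then obtain k where "n = int l * k"
      by blast
    then have "2 * pi * real_of_int n / real l = 2 * pi * real_of_int k"
      by (simp add: l_def)
    then have "w = 1"
      by (simp add: w_def)
    then show ?thesis
      using True by simp
  next
    case False
    have "w \<noteq> 1"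
    proof
      assume "w = 1"
      then have "cos (2 * pi * real_of_int n / real l) = 1"
        by (simp add: w_def complex_eq_iff)
      then obtain k :: int where "2 * pi * real_of_int n / real l = real_of_int k * 2 * pi"
        unfolding cos_one_2pi_int by blast
      then have "pi * (2 * real_of_int n) = pi * (2 * real_of_int (k * int l))"
        using l0 by (simp add: field_simps)
      then have "real_of_int n = real_of_int (k * int l)"
        by simp
      then have "n = k * int l"
        by linarith
      then show False
        using False by simp
    qed
    moreover have "w ^ l = cis (2 * pi * real_of_int n)"
      unfolding w_def Complex.DeMoivre by (simp add: l_def)
    ultimately show ?thesis
      using False by (simp add: geometric_sum)
  qed
  finally show ?thesis .
qed

lemma sum_cos_power:
  fixes h m :: nat
  defines "l \<equiv> 2 * h + 1"
  shows "(\<Sum>i<l. cos (pi * (real i - real h) / real l) ^ (2 * m)) =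
    real l / 4 ^ m * (\<Sum>r | r \<le> 2 * m \<and> int l dvd int r - int m. real ((2 * m) choose r))"
proof -
  have "complex_of_real (\<Sum>i<l. (2 * cos (pi * (real i - real h) / real l)) ^ (2 * m)) =
    (\<Sum>i<l. \<Sum>r\<le>2*m. of_nat ((2 * m) choose r) * cis (2 * real_of_int (int r - int m) * (pi * (real i - real h) / real l)))"
    unfolding of_real_sum cos_power_binomial by simp
  also have "\<dots> = (\<Sum>r\<le>2*m. of_nat ((2 * m) choose r) * (if int l dvd int r - int m then of_nat l else 0))"
    unfolding l_def by (subst sum.swap) (simp only: sum_distrib_left[symmetric] sum_cis_roots)
  also have "\<dots> = (\<Sum>r\<le>2*m. if int l dvd int r - int m then of_nat l * of_nat ((2 * m) choose r) else 0)"
    by (intro sum.cong) auto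
  also have "\<dots> = (\<Sum>r | r \<le> 2 * m \<and> int l dvd int r - int m. of_nat l * of_nat ((2 * m) choose r))"
    by (subst sum.inter_filter[symmetric]) auto
  also have "\<dots> = complex_of_real (real l * (\<Sum>r | r \<le> 2 * m \<and> int l dvd int r - int m. real ((2 * m) choose r)))"
    by (simp add: sum_distrib_left)
  finally have "(\<Sum>i<l. (2 * cos (pi * (real i - real h) / real l)) ^ (2 * m)) =
      real l * (\<Sum>r | r \<le> 2 * m \<and> int l dvd int r - int m. real ((2 * m) choose r))"
    unfolding of_real_eq_iff .
  moreover have "(2 * cos x) ^ (2 * m) = 4 ^ m * cos x ^ (2 * m)" for x :: real
    by (simp add: power_mult_distrib power_mult)
  ultimately have "4 ^ m * (\<Sum>i<l. cos (pi * (real i - real h) / real l) ^ (2 * m)) =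
      real l * (\<Sum>r | r \<le> 2 * m \<and> int l dvd int r - int m. real ((2 * m) choose r))"
    by (simp only: sum_distrib_left)
  moreover have "S = L / 4 ^ m * R" if "4 ^ m * S = L * R" for S L R :: real
    using that by (simp add: field_simps)
  ultimately show ?thesis
    by blast
qed

text \<open>Jordan's inequality: by convexity of \<open>- sin\<close>, the sine lies above its
  chord. It supplies the Gaussian majorant of the cosine powers.\<close>

lemma two_div_pi_le_sin:
  assumes "0 \<le> y" "y \<le> pi / 2"
  shows "2 / pi * y \<le> sin y"
proof -
  have "convex_on {0..pi/2} (\<lambda>x. - sin x)"
    by (rule f''_ge0_imp_convex[where f'="\<lambda>x. - cos x" and f''="\<lambda>x. sin x"])
      (auto intro!: derivative_eq_intros sin_ge_zero)
  then have "- sin ((1 - 2 / pi * y) *\<^sub>R 0 + (2 / pi * y) *\<^sub>R (pi / 2)) \<le>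
     (1 - 2 / pi * y) * (- sin 0) + (2 / pi * y) * (- sin (pi / 2))"
    using assms by (intro convex_onD) (auto simp: field_simps)
  then show ?thesis
    by simp
qed

text \<open>Squeezed between two consequences of \<open>1 + x <= exp x\<close>, at
  \<open>x = - a n\<close> and at \<open>x = a n / (1 - a n)\<close>.\<close>

lemma power_tendsto_exp:
  fixes a :: "nat \<Rightarrow> real"
  assumes a0: "\<And>n. 0 \<le> a n" and a: "a \<longlonglongrightarrow> 0" and ma: "(\<lambda>n. real (m n) * a n) \<longlonglongrightarrow> c"
  shows "(\<lambda>n. (1 - a n) ^ m n) \<longlonglongrightarrow> exp (- c)"
proof (rule tendsto_sandwich)
  have ev: "eventually (\<lambda>n. a n < 1) sequentially"
    using a by (rule order_tendstoD) simp
  show "eventually (\<lambda>n. exp (- (real (m n) * a n / (1 - a n))) \<le> (1 - a n) ^ m n) sequentially"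
    using ev
  proof eventually_elim
    case (elim n)
    have "1 + a n / (1 - a n) \<le> exp (a n / (1 - a n))"
      by simp
    then have "1 / (1 - a n) \<le> exp (a n / (1 - a n))"
      using elim by (simp add: field_simps)
    then have "exp (- (a n / (1 - a n))) \<le> 1 - a n"
      using elim by (simp add: exp_minus field_simps)
    then have "exp (- (a n / (1 - a n))) ^ m n \<le> (1 - a n) ^ m n"
      by (intro power_mono) auto
    then show ?case
      by (simp add: exp_of_nat_mult[symmetric])
  qed
  show "eventually (\<lambda>n. (1 - a n) ^ m n \<le> exp (- (real (m n) * a n))) sequentially"
    using ev
  proof eventually_elim
    case (elim n)
    have "(1 - a n) ^ m n \<le> exp (- a n) ^ m n"
      using elim exp_ge_add_one_self[of "- a n"] by (intro power_mono) auto
    then show ?case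
      by (simp add: exp_of_nat_mult[symmetric])
  qed
  have "(\<lambda>n. exp (- (real (m n) * a n / (1 - a n)))) \<longlonglongrightarrow> exp (- (c / (1 - 0)))"
    by (intro tendsto_intros a ma) auto
  then show "(\<lambda>n. exp (- (real (m n) * a n / (1 - a n)))) \<longlonglongrightarrow> exp (- c)"
    by simp
  show "(\<lambda>n. exp (- (real (m n) * a n))) \<longlonglongrightarrow> exp (- c)"
    by (intro tendsto_intros ma)
qed

text \<open>An exact link to the partial products of Wallis. The induction needs only the ratio of
  consecutive central binomial coefficients, and the limit of the product then replaces Stirling's
  formula.\<close>

lemma central_binomial_wallis:
  "(\<Prod>k=1..n. (4 * real k ^ 2) / (4 * real k ^ 2 - 1)) * (2 * real n + 1) * (real ((2 * n) choose n) / 4 ^ n) ^ 2 = 1"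
proof (induction n)
  case (Suc n)
  define c where "c = real ((2 * n) choose n) / 4 ^ n"
  have "Suc n * ((2 * Suc n) choose Suc n) = (2 * Suc n) * ((2 * n + 1) choose n)"
    using Suc_times_binomial_eq[of "2 * n + 1" n] by simp
  moreover have "Suc n * ((2 * n + 1) choose n) = (2 * n + 1) * ((2 * n) choose n)"
    using binomial_absorb_comp[of "2 * n + 1" n] by simp
  ultimately have "real (Suc n) * (real (Suc n) * real ((2 * Suc n) choose Suc n)) = real (2 * Suc n) * (real (2 * n + 1) * real ((2 * n) choose n))"
    by (metis (no_types, lifting) mult.left_commute of_nat_mult)
  then have "(real n + 1) * ((real n + 1) * real ((2 * Suc n) choose Suc n)) = 2 * (real n + 1) * ((2 * real n + 1) * real ((2 * n) choose n))"
    by (simp add: algebra_simps del: binomial_Suc_Suc mult_Suc_right)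
  moreover have "A = 2 * b / a * B" if "a * (a * A) = 2 * a * (b * B)" "a > 0" for A B a b :: real
    using that by (simp add: field_simps)
  ultimately have A: "real ((2 * Suc n) choose Suc n) = 2 * (2 * real n + 1) / (real n + 1) * real ((2 * n) choose n)"
    by (smt (verit) of_nat_0_le_iff)
  have "real ((2 * Suc n) choose Suc n) / 4 ^ Suc n = (2 * real n + 1) / (2 * (real n + 1)) * c"
  proof -
    have "A / (4 * F) = b / (2 * a) * (B / F)" if "A = 2 * b / a * B" "a > 0" "F > 0" for A B F a b :: real
      using that by (simp add: field_simps)
    from this[OF A] show ?thesis
      by (simp add: c_def del: binomial_Suc_Suc mult_Suc_right)
  qed
  then have "(\<Prod>k=1..Suc n. (4 * real k ^ 2) / (4 * real k ^ 2 - 1)) * (2 * real (Suc n) + 1) * (real ((2 * Suc n) choose Suc n) / 4 ^ Suc n) ^ 2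
    = (\<Prod>k=1..n. (4 * real k ^ 2) / (4 * real k ^ 2 - 1)) * ((4 * real (Suc n) ^ 2) / (4 * real (Suc n) ^ 2 - 1) * (2 * real (Suc n) + 1) *
       ((2 * real n + 1) / (2 * (real n + 1)) * c) ^ 2)"
    by (simp del: binomial_Suc_Suc mult_Suc_right)
  also have "(4 * real (Suc n) ^ 2) / (4 * real (Suc n) ^ 2 - 1) * (2 * real (Suc n) + 1) * ((2 * real n + 1) / (2 * (real n + 1)) * c) ^ 2
     = (2 * real n + 1) * c ^ 2"
  proof -
    have e1: "4 * real (Suc n) ^ 2 - 1 = (2 * real n + 1) * (2 * real n + 3)"
      by (simp add: power2_eq_square algebra_simps)
    have e2: "2 * real (Suc n) + 1 = 2 * real n + 3" and e3: "real (Suc n) = real n + 1"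
      by simp_all
    have alg: "(4 * a ^ 2) / (b * d) * d * (b / (2 * a) * c) ^ 2 = b * c ^ 2" if "a > 0" "b > 0" "d > 0" for a b d :: real
      using that by (simp add: field_simps power2_eq_square)
    show ?thesis
      unfolding e1 e2 unfolding e3 by (rule alg) simp_all
  qed
  finally show ?case
    using Suc by (simp only: c_def mult.assoc)
qed simp

lemma central_binomial_asymptotic:
  "(\<lambda>n. sqrt (real n) * (real ((2 * n) choose n) / 4 ^ n)) \<longlonglongrightarrow> 1 / sqrt pi"
proof -
  define W where "W n = (\<Prod>k=1..n. (4 * real k ^ 2) / (4 * real k ^ 2 - 1))" for n
  have W0: "W n > 0" for n
    unfolding W_def
  proof (intro prod_pos)
    fix k assume "k \<in> {1..n}"
    then have "1 \<le> real k ^ 2"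
      by simp
    then show "0 < (4 * real k ^ 2) / (4 * real k ^ 2 - 1)"
      by (intro divide_pos_pos) linarith+
  qed
  have eq: "sqrt (real n) * (real ((2 * n) choose n) / 4 ^ n) = sqrt (real n / (2 * real n + 1)) / sqrt (W n)" for n
  proof -
    have "(real ((2 * n) choose n) / 4 ^ n) ^ 2 = 1 / (W n * (2 * real n + 1))"
    proof -
      have "W n * (2 * real n + 1) \<noteq> 0"
        using W0[of n] by auto
      then show "(real ((2 * n) choose n) / 4 ^ n) ^ 2 = 1 / (W n * (2 * real n + 1))"
        using central_binomial_wallis[of n] unfolding W_def[symmetric]
        by (simp only: eq_divide_eq mult.commute if_False) simp
    qed
    then have "real ((2 * n) choose n) / 4 ^ n = sqrt (1 / (W n * (2 * real n + 1)))"
      by (intro real_sqrt_unique[symmetric]) auto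
    then show ?thesis
      by (simp add: real_sqrt_divide real_sqrt_mult)
  qed
  have "(\<lambda>n. sqrt (real n / (2 * real n + 1)) / sqrt (W n)) \<longlonglongrightarrow> sqrt (1/2) / sqrt (pi / 2)"
  proof (rule tendsto_divide[OF tendsto_real_sqrt tendsto_real_sqrt])
    show "(\<lambda>n. real n / (2 * real n + 1)) \<longlonglongrightarrow> 1/2"
      by real_asymp
    show "W \<longlonglongrightarrow> pi / 2"
      unfolding W_def by (rule wallis)
  qed auto
  then show ?thesis
    unfolding eq by (simp add: real_sqrt_divide)
qed

text \<open>Writes the deviation from the central coefficient as \<open>r\<close> factors close to
  1; when \<open>r ^ 2\<close> is comparable to \<open>m\<close> their product becomes a
  Gaussian.\<close>

lemma binomial_ratio:
  assumes "r \<le> m"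
  shows "real ((2 * m) choose (m + r)) = real ((2 * m) choose m) * (\<Prod>i<r. 1 - real r / (real m + 1 + real i))"
  using assms
proof -
  have up: "fact (m + k) = (fact m :: real) * (\<Prod>i<k. real m + 1 + real i)" for k
    by (induction k) (simp_all add: algebra_simps)
  have down: "fact m = (fact (m - r) :: real) * (\<Prod>i<r. real m + 1 + real i - real r)"
  proof -
    have "fact (m - r + k) = (fact (m - r) :: real) * (\<Prod>i<k. real m + 1 + real i - real r)" for k
      using assms by (induction k) (simp_all add: algebra_simps of_nat_diff)
    from this[of r] show ?thesis
      using assms by simp
  qed
  have ratio: "(\<Prod>i<r. 1 - real r / (real m + 1 + real i)) = (\<Prod>i<r. real m + 1 + real i - real r) / (\<Prod>i<r. real m + 1 + real i)"
    unfolding prod_dividef[symmetric] by (intro prod.cong) (auto simp: field_simps)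
  have p0: "(\<Prod>i<r. real m + 1 + real i) > 0"
    by (intro prod_pos) auto
  have "real ((2 * m) choose (m + r)) = fact (2 * m) / (fact (m + r) * fact (m - r))"
    using assms by (subst binomial_fact) (simp_all add: diff_add_inverse)
  moreover have "real ((2 * m) choose m) = fact (2 * m) / (fact m * fact m)"
    by (subst binomial_fact) simp_all
  ultimately have *: "real ((2 * m) choose (m + r)) = fact (2 * m) / ((fact m * (\<Prod>i<r. real m + 1 + real i)) * fact (m - r))"
     "real ((2 * m) choose m) = fact (2 * m) / (fact m * (fact (m - r) * (\<Prod>i<r. real m + 1 + real i - real r)))"
    using up[of r] down by simp_all
  have q0: "(\<Prod>i<r. real m + 1 + real i - real r) \<noteq> 0"
    using down fact_nonzero[of m, where 'a=real] by fastforce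
  show ?thesis
    unfolding * ratio using p0 q0 by (simp add: field_simps)
qed

lemma binomial_ratio_bounds:
  assumes "r \<le> m" "m > 0"
  defines "x \<equiv> real ((2 * m) choose (m + r)) / real ((2 * m) choose m)"
  shows "(1 - real r / (real m + 1)) ^ r \<le> x" "x \<le> (1 - real r / (real m + real r)) ^ r"
proof -
  have x: "x = (\<Prod>i<r. 1 - real r / (real m + 1 + real i))"
    using binomial_ratio[OF assms(1)] by (simp add: x_def)
  have "0 \<le> 1 - real r / (real m + 1)"
    using assms by (simp add: field_simps)
  moreover have "real r / (real m + 1 + real i) \<le> real r / (real m + 1)" for i
    by (intro divide_left_mono) auto
  ultimately have "(\<Prod>i<r. 1 - real r / (real m + 1)) \<le> x"
    unfolding x by (intro prod_mono) auto
  then show "(1 - real r / (real m + 1)) ^ r \<le> x"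
    by simp
  \<comment> \<open>The largest factor is the last one, \<open>i = r - 1\<close>, with denominator
    \<open>m + r\<close>; the lower bound above used the first one.\<close>
  have "x \<le> (\<Prod>i<r. 1 - real r / (real m + real r))"
    unfolding x
  proof (intro prod_mono conjI)
    fix i assume "i \<in> {..<r}"
    then have "real i + 1 \<le> real r"
      by (simp flip: of_nat_Suc)
    then show "1 - real r / (real m + 1 + real i) \<le> 1 - real r / (real m + real r)"
      using assms by (simp add: divide_left_mono)
    show "0 \<le> 1 - real r / (real m + 1 + real i)"
      using assms by (simp add: field_simps)
  qed
  then show "x \<le> (1 - real r / (real m + real r)) ^ r"
    by simp
qed

text \<open>Since \<open>k + 2 * tri k\<close> is the square of \<open>k\<close>, the Gaussian is
  the general term of a theta series with \<open>z = exp (- c)\<close> and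
  \<open>p = exp (- 2 * c)\<close>.\<close>

lemma summable_gaussian:
  assumes "c > 0"
  shows "(\<lambda>k::int. exp (- (c * (real_of_int k)\<^sup>2))) summable_on UNIV"
proof -
  have "exp (- c) powi k * exp (- 2 * c) powi tri k = exp (- (c * (real_of_int k)\<^sup>2))" for k
  proof -
    define T where "T = real_of_int (tri k)"
    have T: "2 * T = real_of_int k * (real_of_int k - 1)"
      using arg_cong[OF two_tri[of k], of real_of_int] unfolding T_def
      by (simp only: of_int_mult of_int_diff of_int_numeral of_int_1)
    have "real_of_int k * (- c) + T * (- 2 * c) = - c * (real_of_int k + 2 * T)"
      by (simp add: algebra_simps)
    also have "\<dots> = - (c * (real_of_int k)\<^sup>2)"
      unfolding T by (simp add: algebra_simps power2_eq_square)
    finally show ?thesis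
      unfolding T_def by (simp only: exp_power_int exp_add[symmetric])
  qed
  then show ?thesis
    using summable_on_theta[of "exp (- c)" "exp (- 2 * c)"] assms by simp
qed

text \<open>
  Polya's proof of the inversion formula: averaging \<open>cos (\<pi> k / l) ^ (2 m)\<close> over the
  residues \<open>k\<close> modulo an odd \<open>l\<close> picks out every \<open>l\<close>-th binomial coefficient;
  both sides become Gaussian sums when \<open>l\<close> grows and \<open>m\<close> is close to \<open>s l\<^sup>2\<close>.
\<close>

context
  fixes s :: real
  assumes s: "s > 0"
begin

definition len :: "nat \<Rightarrow> nat" where "len n = 2 * n + 1"
text \<open>Rounding up guarantees \<open>s * len n ^ 2 <= expo n\<close>, on which the exponent in
  \<open>cos_term_bound\<close> depends.\<close>

definition expo :: "nat \<Rightarrow> nat" where "expo n = nat \<lceil>s * real (len n) ^ 2\<rceil>"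

lemma len_pos: "len n > 0" and len_ge_1: "real (len n) \<ge> 1"
  by (simp_all add: len_def)

lemma expo_bounds: "s * real (len n) ^ 2 \<le> real (expo n)" "real (expo n) \<le> (s + 1) * real (len n) ^ 2" "expo n > 0"
proof -
  have p: "s * real (len n) ^ 2 > 0"
    using s len_pos by simp
  then show 1: "s * real (len n) ^ 2 \<le> real (expo n)"
    by (simp add: expo_def)
  have "real (expo n) \<le> s * real (len n) ^ 2 + 1"
    using p unfolding expo_def by (simp add: of_nat_nat le_of_int_ceiling ceiling_correct)
  also have "\<dots> \<le> (s + 1) * real (len n) ^ 2"
    using len_ge_1[of n] by (simp add: distrib_right)
  finally show "real (expo n) \<le> (s + 1) * real (len n) ^ 2" .
  show "expo n > 0"
    using p 1 by linarith
qed

lemma expo_over_len_square: "(\<lambda>n. real (expo n) / real (len n) ^ 2) \<longlonglongrightarrow> s"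
proof (rule tendsto_sandwich)
  show "eventually (\<lambda>n. s \<le> real (expo n) / real (len n) ^ 2) sequentially"
    using expo_bounds(1) len_pos by (simp add: field_simps)
  have "real (expo n) / real (len n) ^ 2 \<le> s + 1 / real (len n) ^ 2" for n
  proof -
    have "real (expo n) \<le> s * real (len n) ^ 2 + 1"
      using s unfolding expo_def by (simp add: of_nat_nat)
    then show ?thesis
      using len_pos[of n] by (simp add: field_simps)
  qed
  then show "eventually (\<lambda>n. real (expo n) / real (len n) ^ 2 \<le> s + 1 / real (len n) ^ 2) sequentially"
    by simp
  have "(\<lambda>n. s + 1 / real (2 * n + 1) ^ 2) \<longlonglongrightarrow> s"
    by real_asymp
  then show "(\<lambda>n. s + 1 / real (len n) ^ 2) \<longlonglongrightarrow> s"
    by (simp add: len_def)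
qed simp

lemma len_square_over_expo: "(\<lambda>n. real (len n) ^ 2 / real (expo n)) \<longlonglongrightarrow> 1 / s"
  using tendsto_inverse[OF expo_over_len_square] s by (simp add: inverse_eq_divide)

lemma len_over_expo: "(\<lambda>n. real (len n) / real (expo n)) \<longlonglongrightarrow> 0"
proof -
  have "(\<lambda>n. real (len n) ^ 2 / real (expo n) * (1 / real (len n))) \<longlonglongrightarrow> 1 / s * 0"
  proof (intro tendsto_mult len_square_over_expo)
    have "(\<lambda>n. 1 / real (2 * n + 1)) \<longlonglongrightarrow> 0"
      by real_asymp
    then show "(\<lambda>n. 1 / real (len n)) \<longlonglongrightarrow> 0"
      by (simp add: len_def)
  qed
  moreover have "real (len n) ^ 2 / real (expo n) * (1 / real (len n)) = real (len n) / real (expo n)" for n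
    using len_pos[of n] by (simp add: power2_eq_square)
  ultimately show ?thesis
    by simp
qed

lemma inverse_expo: "(\<lambda>n. 1 / real (expo n)) \<longlonglongrightarrow> 0"
proof (rule tendsto_sandwich[OF _ _ tendsto_const len_over_expo])
  show "eventually (\<lambda>n. 1 / real (expo n) \<le> real (len n) / real (expo n)) sequentially"
    using len_ge_1 by (simp add: divide_right_mono)
qed simp

lemma filterlim_expo: "filterlim expo at_top sequentially"
proof -
  have "filterlim (\<lambda>n. inverse (1 / real (expo n))) at_top sequentially"
    using expo_bounds(3) by (intro filterlim_inverse_at_top inverse_expo) simp
  then show ?thesis
    by (simp add: filterlim_sequentially_iff_filterlim_real)
qed

definition cos_term :: "nat \<Rightarrow> int \<Rightarrow> real" where
  "cos_term n k = (if \<bar>k\<bar> \<le> int n then cos (pi * real_of_int k / real (len n)) ^ (2 * expo n) else 0)"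

text \<open>The coefficients on both sides of the centre agree, so the absolute value of
  \<open>j\<close> suffices and keeps the lower index a natural number.\<close>

definition binom_term :: "nat \<Rightarrow> int \<Rightarrow> real" where
  "binom_term n j = (if int (len n) * \<bar>j\<bar> \<le> int (expo n)
     then real (len n) / 4 ^ expo n * real ((2 * expo n) choose (expo n + len n * nat \<bar>j\<bar>)) else 0)"

text \<open>The finite averaging identity \<open>sum_cos_power\<close>, with both sides padded by
  zeros to sums over all integers so that dominated convergence applies to each.\<close>

lemma infsum_cos_term_eq: "infsum (cos_term n) UNIV = infsum (binom_term n) UNIV"
proof -
  let ?l = "len n" and ?m = "expo n"
  have "infsum (cos_term n) UNIV = infsum (cos_term n) {- int n..int n}"
    by (rule infsum_cong_neutral) (auto simp: cos_term_def)
  also have "\<dots> = (\<Sum>k\<in>{- int n..int n}. cos_term n k)"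
    by simp
  also have "\<dots> = (\<Sum>i<?l. cos (pi * (real i - real n) / real ?l) ^ (2 * ?m))"
    by (rule sum.reindex_bij_witness[where i="\<lambda>i. int i - int n" and j="\<lambda>k. nat (k + int n)"])
      (auto simp: cos_term_def len_def)
  also have "\<dots> = real ?l / 4 ^ ?m * (\<Sum>r | r \<le> 2 * ?m \<and> int ?l dvd int r - int ?m. real ((2 * ?m) choose r))"
    unfolding len_def by (rule sum_cos_power)
  also have "\<dots> = (\<Sum>r | r \<le> 2 * ?m \<and> int ?l dvd int r - int ?m. real ?l / 4 ^ ?m * real ((2 * ?m) choose r))"
    by (simp add: sum_distrib_left)
  also have "\<dots> = sum (binom_term n) {j. int ?l * \<bar>j\<bar> \<le> int ?m}"
  proof (rule sum.reindex_bij_witness[where j="\<lambda>r. (int r - int ?m) div int ?l" and i="\<lambda>j. nat (int ?m + int ?l * j)"])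
    fix r assume "r \<in> {r. r \<le> 2 * ?m \<and> int ?l dvd int r - int ?m}"
    then obtain j where r: "r \<le> 2 * ?m" and j: "int r - int ?m = int ?l * j"
      by blast
    have d: "(int r - int ?m) div int ?l = j"
      unfolding j using len_pos[of n] by simp
    have rj: "int r = int ?m + int ?l * j"
      using j by simp
    show "nat (int ?m + int ?l * ((int r - int ?m) div int ?l)) = r"
      unfolding d using rj by linarith
    have abs: "int ?l * \<bar>j\<bar> = \<bar>int r - int ?m\<bar>"
      unfolding j by (simp add: abs_mult)
    then show "(int r - int ?m) div int ?l \<in> {j. int ?l * \<bar>j\<bar> \<le> int ?m}"
      unfolding d using r by simp
    have "(2 * ?m) choose (?m + ?l * nat \<bar>j\<bar>) = (2 * ?m) choose r"
    proof (cases "j \<ge> 0")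
      case True
      then have "int (?m + ?l * nat \<bar>j\<bar>) = int r"
        using rj by simp
      then show ?thesis
        by (simp only: of_nat_eq_iff)
    next
      case False
      then have "int (?m + ?l * nat \<bar>j\<bar>) = int (2 * ?m - r)"
        using rj r by (simp add: of_nat_diff)
      then have "?m + ?l * nat \<bar>j\<bar> = 2 * ?m - r"
        by (simp only: of_nat_eq_iff)
      then show ?thesis
        using binomial_symmetric[OF r] by simp
    qed
    moreover have "int ?l * \<bar>j\<bar> \<le> int ?m"
      using abs r by linarith
    ultimately show "binom_term n ((int r - int ?m) div int ?l) = real ?l / 4 ^ ?m * real ((2 * ?m) choose r)"
      unfolding d by (simp add: binom_term_def)
  next
    fix j assume j: "j \<in> {j. int ?l * \<bar>j\<bar> \<le> int ?m}"
    then have "\<bar>int ?l * j\<bar> \<le> int ?m"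
      by (simp add: abs_mult)
    then have "0 \<le> int ?m + int ?l * j" "int ?m + int ?l * j \<le> 2 * int ?m"
      by linarith+
    then show "(int (nat (int ?m + int ?l * j)) - int ?m) div int ?l = j"
      "nat (int ?m + int ?l * j) \<in> {r. r \<le> 2 * ?m \<and> int ?l dvd int r - int ?m}"
      using len_pos[of n] by auto
  qed
  also have "\<dots> = infsum (binom_term n) {j. int ?l * \<bar>j\<bar> \<le> int ?m}"
  proof -
    have "{j. int ?l * \<bar>j\<bar> \<le> int ?m} \<subseteq> {- int ?m..int ?m}"
    proof
      fix j assume "j \<in> {j. int ?l * \<bar>j\<bar> \<le> int ?m}"
      moreover have "1 * \<bar>j\<bar> \<le> int ?l * \<bar>j\<bar>"
        using len_pos[of n] by (intro mult_right_mono) auto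
      ultimately show "j \<in> {- int ?m..int ?m}"
        by auto
    qed
    then have "finite {j. int ?l * \<bar>j\<bar> \<le> int ?m}"
      using finite_subset by blast
    then show ?thesis
      by simp
  qed
  also have "\<dots> = infsum (binom_term n) UNIV"
    by (rule infsum_cong_neutral) (auto simp: binom_term_def)
  finally show ?thesis .
qed

text \<open>Combines \<open>1 - sin y ^ 2 <= exp (- (sin y ^ 2))\<close> with Jordan's inequality,
  which applies because \<open>k\<close> between \<open>- n\<close> and \<open>n\<close> keeps the
  angle below \<open>pi / 2\<close>.\<close>

lemma cos_term_bound: "\<bar>cos_term n k\<bar> \<le> exp (- (4 * s * (real_of_int k)\<^sup>2))"
proof (cases "\<bar>k\<bar> \<le> int n")
  case True
  define y where "y = pi * real_of_int \<bar>k\<bar> / real (len n)"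
  have "2 * real_of_int \<bar>k\<bar> \<le> real (len n)"
    using True unfolding len_def by linarith
  then have "y \<le> pi / 2"
    using len_pos[of n] by (simp add: y_def field_simps)
  moreover have "0 \<le> y"
    by (simp add: y_def)
  ultimately have "2 / pi * y \<le> sin y"
    by (intro two_div_pi_le_sin)
  then have "2 * real_of_int \<bar>k\<bar> / real (len n) \<le> sin y"
    by (simp add: y_def)
  then have "(2 * real_of_int \<bar>k\<bar> / real (len n)) ^ 2 \<le> sin y ^ 2"
    by (intro power_mono) auto
  then have sin2: "real (expo n) * (4 * (real_of_int k)\<^sup>2 / real (len n) ^ 2) \<le> real (expo n) * sin y ^ 2"
    by (intro mult_left_mono) (auto simp: power_divide power_mult_distrib)
  have "s \<le> real (expo n) / real (len n) ^ 2"
    using expo_bounds(1)[of n] len_pos[of n] by (simp add: field_simps)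
  then have "s * (4 * (real_of_int k)\<^sup>2) \<le> real (expo n) / real (len n) ^ 2 * (4 * (real_of_int k)\<^sup>2)"
    by (intro mult_right_mono) auto
  then have 1: "4 * s * (real_of_int k)\<^sup>2 \<le> real (expo n) * sin y ^ 2"
    using sin2 by (simp add: mult_ac)
  have "cos (pi * real_of_int k / real (len n)) = cos y"
  proof -
    have "y = \<bar>pi * real_of_int k / real (len n)\<bar>"
      by (simp add: y_def abs_mult)
    then show ?thesis
      by (simp only: cos_abs_real)
  qed
  then have "cos_term n k = (1 - sin y ^ 2) ^ expo n"
    using True by (simp add: cos_term_def power_mult cos_squared_eq)
  moreover have "\<bar>(1 - sin y ^ 2) ^ expo n\<bar> \<le> exp (- (sin y ^ 2)) ^ expo n"
  proof -
    have "0 \<le> 1 - sin y ^ 2"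
      by (simp add: abs_square_le_1)
    moreover have "1 - sin y ^ 2 \<le> exp (- (sin y ^ 2))"
      using exp_ge_add_one_self[of "- (sin y ^ 2)"] by simp
    ultimately show ?thesis
      by (simp add: power_mono)
  qed
  moreover have "exp (- (sin y ^ 2)) ^ expo n \<le> exp (- (4 * s * (real_of_int k)\<^sup>2))"
    using 1 by (simp add: exp_of_nat_mult[symmetric])
  ultimately show ?thesis
    by linarith
qed (simp add: cos_term_def)

text \<open>\<open>len n * sin (c / len n)\<close> tends to \<open>c\<close>, so
  \<open>expo n\<close> times the squared sine tends to \<open>s * c ^ 2\<close>.\<close>

lemma cos_term_tendsto: "(\<lambda>n. cos_term n k) \<longlonglongrightarrow> exp (- (pi\<^sup>2 * s * (real_of_int k)\<^sup>2))"
proof -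
  define c where "c = pi * real_of_int k"
  have lin: "(\<lambda>n. real (len n) * sin (c / real (len n))) \<longlonglongrightarrow> c"
  proof -
    have "(\<lambda>n. (2 * real n + 1) * sin (c / (2 * real n + 1))) \<longlonglongrightarrow> c"
      by (cases c "0::real" rule: linorder_cases) real_asymp+
    then show ?thesis
      by (simp add: len_def add.commute)
  qed
  have inv: "(\<lambda>n. 1 / real (len n)) \<longlonglongrightarrow> 0"
  proof -
    have "(\<lambda>n. 1 / real (2 * n + 1)) \<longlonglongrightarrow> 0"
      by real_asymp
    then show ?thesis
      by (simp add: len_def)
  qed
  have sq: "sin (c / real (len n)) ^ 2 = (real (len n) * sin (c / real (len n)) * (1 / real (len n))) ^ 2" for n
    using len_pos[of n] by simp
  have msq: "real (expo n) * sin (c / real (len n)) ^ 2 = real (expo n) / real (len n) ^ 2 * (real (len n) * sin (c / real (len n))) ^ 2" for n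
    using len_pos[of n] by (simp add: power_mult_distrib)
  have "(\<lambda>n. sin (c / real (len n)) ^ 2) \<longlonglongrightarrow> (c * 0) ^ 2"
    unfolding sq by (intro tendsto_intros lin inv)
  moreover have "(\<lambda>n. real (expo n) * sin (c / real (len n)) ^ 2) \<longlonglongrightarrow> s * c ^ 2"
    unfolding msq by (intro tendsto_intros lin expo_over_len_square)
  ultimately have "(\<lambda>n. (1 - sin (c / real (len n)) ^ 2) ^ expo n) \<longlonglongrightarrow> exp (- (s * c ^ 2))"
    by (intro power_tendsto_exp) auto
  moreover have "s * c ^ 2 = pi\<^sup>2 * s * (real_of_int k)\<^sup>2"
    by (simp add: c_def power_mult_distrib)
  moreover have "eventually (\<lambda>n. cos_term n k = (1 - sin (c / real (len n)) ^ 2) ^ expo n) sequentially"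
    using eventually_ge_at_top[of "nat \<bar>k\<bar>"]
    by eventually_elim (simp add: cos_term_def c_def power_mult cos_squared_eq)
  ultimately show ?thesis
    using tendsto_cong by fastforce
qed

lemma binom_tendsto:
  "(\<lambda>n. real (len n) * (real ((2 * expo n) choose expo n) / 4 ^ expo n)) \<longlonglongrightarrow> 1 / sqrt (pi * s)"
proof -
  have "(\<lambda>n. sqrt (real (len n) ^ 2 / real (expo n)) * (sqrt (real (expo n)) * (real ((2 * expo n) choose expo n) / 4 ^ expo n)))
     \<longlonglongrightarrow> sqrt (1 / s) * (1 / sqrt pi)"
    by (intro tendsto_mult tendsto_real_sqrt len_square_over_expo filterlim_compose[OF central_binomial_asymptotic filterlim_expo])
  moreover have "sqrt (real (len n) ^ 2 / real (expo n)) * (sqrt (real (expo n)) * (real ((2 * expo n) choose expo n) / 4 ^ expo n))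
     = real (len n) * (real ((2 * expo n) choose expo n) / 4 ^ expo n)" for n
    using expo_bounds(3)[of n] by (simp add: real_sqrt_divide)
  ultimately show ?thesis
    by (simp add: real_sqrt_divide real_sqrt_mult mult.commute)
qed

text \<open>The ratio to the central coefficient is at most
  \<open>exp (- (r * r / (expo n + r)))\<close>. Since \<open>r <= expo n\<close>, the denominator
  is at most \<open>2 * (s + 1) * len n ^ 2\<close>, which explains the constant in the
  exponent.\<close>

lemma binom_term_bound:
  "\<exists>K. \<forall>n j. \<bar>binom_term n j\<bar> \<le> K * exp (- (1 / (2 * (s + 1)) * (real_of_int j)\<^sup>2))"
proof -
  have "Bseq (\<lambda>n. real (len n) * (real ((2 * expo n) choose expo n) / 4 ^ expo n))"
    by (rule convergent_imp_Bseq[OF convergentI[OF binom_tendsto]])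
  then obtain K where K: "K > 0" "\<And>n. \<bar>real (len n) * (real ((2 * expo n) choose expo n) / 4 ^ expo n)\<bar> \<le> K"
    by (auto simp: Bseq_def)
  have "\<bar>binom_term n j\<bar> \<le> K * exp (- (1 / (2 * (s + 1)) * (real_of_int j)\<^sup>2))" for n j
  proof (cases "int (len n) * \<bar>j\<bar> \<le> int (expo n)")
    case True
    define r where "r = len n * nat \<bar>j\<bar>"
    define x where "x = real ((2 * expo n) choose (expo n + r)) / real ((2 * expo n) choose expo n)"
    have rj: "real r = real (len n) * real_of_int \<bar>j\<bar>"
      by (simp add: r_def)
    have "int r = int (len n) * \<bar>j\<bar>"
      by (simp add: r_def)
    then have r: "r \<le> expo n"
      using True by linarith
    have b0: "real ((2 * expo n) choose expo n) > 0"
      by simp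
    have "x \<le> (1 - real r / (real (expo n) + real r)) ^ r"
      unfolding x_def by (rule binomial_ratio_bounds[OF r expo_bounds(3)])
    also have "\<dots> \<le> exp (- (real r / (real (expo n) + real r))) ^ r"
      using exp_ge_add_one_self[of "- (real r / (real (expo n) + real r))"] expo_bounds(3)[of n]
      by (intro power_mono) (auto simp: field_simps)
    also have "\<dots> = exp (- (real r * (real r / (real (expo n) + real r))))"
      by (simp add: exp_of_nat_mult[symmetric])
    also have "\<dots> \<le> exp (- (1 / (2 * (s + 1)) * (real_of_int j)\<^sup>2))"
    proof -
      have "real (expo n) + real r \<le> 2 * (s + 1) * real (len n) ^ 2"
        using r expo_bounds(2)[of n] by linarith
      moreover have "real (expo n) + real r > 0"
        using expo_bounds(3)[of n] by simp
      ultimately have "(real r)\<^sup>2 / (2 * (s + 1) * real (len n) ^ 2) \<le> (real r)\<^sup>2 / (real (expo n) + real r)"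
        by (intro divide_left_mono) auto
      moreover have "(real r)\<^sup>2 / (2 * (s + 1) * real (len n) ^ 2) = 1 / (2 * (s + 1)) * (real_of_int j)\<^sup>2"
        unfolding rj using len_pos[of n] by (simp add: power_mult_distrib)
      ultimately show ?thesis
        by (simp add: power2_eq_square)
    qed
    finally have x: "x \<le> exp (- (1 / (2 * (s + 1)) * (real_of_int j)\<^sup>2))" .
    have "binom_term n j = real (len n) * (real ((2 * expo n) choose expo n) / 4 ^ expo n) * x"
      using True b0 by (simp add: binom_term_def x_def r_def)
    moreover have "0 \<le> x"
      by (simp add: x_def)
    ultimately have "\<bar>binom_term n j\<bar> = \<bar>real (len n) * (real ((2 * expo n) choose expo n) / 4 ^ expo n)\<bar> * x"
      by (simp add: abs_mult)
    also have "\<dots> \<le> K * exp (- (1 / (2 * (s + 1)) * (real_of_int j)\<^sup>2))"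
      using K(1) \<open>0 \<le> x\<close> by (intro mult_mono K(2) x) auto
    finally show ?thesis .
  next
    case False
    then show ?thesis
      using K by (simp add: binom_term_def)
  qed
  then show ?thesis
    by blast
qed

text \<open>The local central limit theorem for the symmetric binomial distribution: both bounds of
  \<open>binomial_ratio_bounds\<close> have the same Gaussian limit.\<close>

lemma binom_term_tendsto: "(\<lambda>n. binom_term n j) \<longlonglongrightarrow> 1 / sqrt (pi * s) * exp (- ((real_of_int j)\<^sup>2 / s))"
proof -
  define a where "a = real_of_int \<bar>j\<bar>"
  have a0: "a \<ge> 0"
    by (simp add: a_def)
  define r where "r n = len n * nat \<bar>j\<bar>" for n
  have ra: "real (r n) = real (len n) * a" for n
    by (simp add: r_def a_def)
  have m0: "real (expo n) > 0" for n
    using expo_bounds(3) by simp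
  define x where "x n = real ((2 * expo n) choose (expo n + r n)) / real ((2 * expo n) choose expo n)" for n
  have l1: "(\<lambda>n. (1 - real (r n) / (real (expo n) + 1)) ^ r n) \<longlonglongrightarrow> exp (- (a\<^sup>2 / s))"
  proof (rule power_tendsto_exp)
    have eq1: "real (r n) / (real (expo n) + 1) = a * (real (len n) / real (expo n)) / (1 + 1 / real (expo n))"
      and eq2: "real (r n) * (real (r n) / (real (expo n) + 1)) = a\<^sup>2 * (real (len n) ^ 2 / real (expo n)) / (1 + 1 / real (expo n))" for n
      using m0[of n] by (simp_all add: ra field_simps power2_eq_square)
    have "(\<lambda>n. real (r n) / (real (expo n) + 1)) \<longlonglongrightarrow> a * 0 / (1 + 0)"
      unfolding eq1 by (intro tendsto_intros len_over_expo inverse_expo) auto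
    then show "(\<lambda>n. real (r n) / (real (expo n) + 1)) \<longlonglongrightarrow> 0"
      by simp
    have "(\<lambda>n. real (r n) * (real (r n) / (real (expo n) + 1))) \<longlonglongrightarrow> a\<^sup>2 * (1 / s) / (1 + 0)"
      unfolding eq2 by (intro tendsto_intros len_square_over_expo inverse_expo) auto
    then show "(\<lambda>n. real (r n) * (real (r n) / (real (expo n) + 1))) \<longlonglongrightarrow> a\<^sup>2 / s"
      by simp
  qed simp
  have l2: "(\<lambda>n. (1 - real (r n) / (real (expo n) + real (r n))) ^ r n) \<longlonglongrightarrow> exp (- (a\<^sup>2 / s))"
  proof (rule power_tendsto_exp)
    have eq1: "real (r n) / (real (expo n) + real (r n)) = a * (real (len n) / real (expo n)) / (1 + a * (real (len n) / real (expo n)))"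
      and eq2: "real (r n) * (real (r n) / (real (expo n) + real (r n))) = a\<^sup>2 * (real (len n) ^ 2 / real (expo n)) / (1 + a * (real (len n) / real (expo n)))" for n
    proof -
      have "1 + a * (real (len n) / real (expo n)) = (real (expo n) + real (r n)) / real (expo n)"
        using m0[of n] by (simp add: ra field_simps)
      then show "real (r n) / (real (expo n) + real (r n)) = a * (real (len n) / real (expo n)) / (1 + a * (real (len n) / real (expo n)))"
        "real (r n) * (real (r n) / (real (expo n) + real (r n))) = a\<^sup>2 * (real (len n) ^ 2 / real (expo n)) / (1 + a * (real (len n) / real (expo n)))"
        using m0[of n] by (simp_all add: ra power2_eq_square mult_ac)
    qed
    have "(\<lambda>n. real (r n) / (real (expo n) + real (r n))) \<longlonglongrightarrow> a * 0 / (1 + a * 0)"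
      unfolding eq1 by (intro tendsto_intros len_over_expo) auto
    then show "(\<lambda>n. real (r n) / (real (expo n) + real (r n))) \<longlonglongrightarrow> 0"
      by simp
    have "(\<lambda>n. real (r n) * (real (r n) / (real (expo n) + real (r n)))) \<longlonglongrightarrow> a\<^sup>2 * (1 / s) / (1 + a * 0)"
      unfolding eq2 by (intro tendsto_intros len_square_over_expo len_over_expo) auto
    then show "(\<lambda>n. real (r n) * (real (r n) / (real (expo n) + real (r n)))) \<longlonglongrightarrow> a\<^sup>2 / s"
      by simp
  qed simp
  have "(\<lambda>n. a * (real (len n) / real (expo n))) \<longlonglongrightarrow> a * 0"
    by (intro tendsto_intros len_over_expo)
  then have "eventually (\<lambda>n. a * (real (len n) / real (expo n)) < 1) sequentially"
    by (rule order_tendstoD) simp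
  then have ev: "eventually (\<lambda>n. r n \<le> expo n) sequentially"
  proof eventually_elim
    case (elim n)
    then have "real (r n) < real (expo n)"
      using m0[of n] by (simp add: ra field_simps)
    then show ?case
      by simp
  qed
  have "x \<longlonglongrightarrow> exp (- (a\<^sup>2 / s))"
  proof (rule tendsto_sandwich[OF _ _ l1 l2])
    show "eventually (\<lambda>n. (1 - real (r n) / (real (expo n) + 1)) ^ r n \<le> x n) sequentially"
      using ev by eventually_elim (simp add: x_def binomial_ratio_bounds expo_bounds(3))
    show "eventually (\<lambda>n. x n \<le> (1 - real (r n) / (real (expo n) + real (r n))) ^ r n) sequentially"
      using ev by eventually_elim (simp add: x_def binomial_ratio_bounds expo_bounds(3))
  qed
  then have "(\<lambda>n. real (len n) * (real ((2 * expo n) choose expo n) / 4 ^ expo n) * x n) \<longlonglongrightarrow> 1 / sqrt (pi * s) * exp (- (a\<^sup>2 / s))"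
    by (intro tendsto_mult binom_tendsto)
  moreover have "eventually (\<lambda>n. binom_term n j = real (len n) * (real ((2 * expo n) choose expo n) / 4 ^ expo n) * x n) sequentially"
    using ev
  proof eventually_elim
    case (elim n)
    have "int (r n) = int (len n) * \<bar>j\<bar>"
      by (simp add: r_def)
    then have "int (len n) * \<bar>j\<bar> \<le> int (expo n)"
      using elim by linarith
    then show ?case
      by (simp add: binom_term_def x_def r_def)
  qed
  moreover have "a\<^sup>2 = (real_of_int j)\<^sup>2"
    by (simp add: a_def)
  ultimately show ?thesis
    using tendsto_cong by fastforce
qed

theorem gaussian_sum_inversion:
  "(\<Sum>\<^sub>\<infinity>k::int. exp (- (pi\<^sup>2 * s * (real_of_int k)\<^sup>2))) = 1 / sqrt (pi * s) * (\<Sum>\<^sub>\<infinity>j::int. exp (- ((real_of_int j)\<^sup>2 / s)))"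
proof -
  have "(\<lambda>n. infsum (cos_term n) UNIV) \<longlonglongrightarrow> (\<Sum>\<^sub>\<infinity>k::int. exp (- (pi\<^sup>2 * s * (real_of_int k)\<^sup>2)))"
    using s by (intro tendsto_infsum_dominated[OF summable_gaussian cos_term_bound cos_term_tendsto]) simp
  moreover obtain K where K: "\<And>n j. \<bar>binom_term n j\<bar> \<le> K * exp (- (1 / (2 * (s + 1)) * (real_of_int j)\<^sup>2))"
    using binom_term_bound by metis
  have "(\<lambda>n. infsum (binom_term n) UNIV) \<longlonglongrightarrow> (\<Sum>\<^sub>\<infinity>j::int. 1 / sqrt (pi * s) * exp (- ((real_of_int j)\<^sup>2 / s)))"
    using s by (intro tendsto_infsum_dominated[OF summable_on_cmult_right[OF summable_gaussian] K binom_term_tendsto]) simp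
  ultimately show ?thesis
    unfolding infsum_cos_term_eq infsum_cmult_right' by (rule LIMSEQ_unique)
qed

end

definition theta3 :: "real \<Rightarrow> real" where
  "theta3 t = (\<Sum>\<^sub>\<infinity>k::int. exp (- (pi * t * (real_of_int k)\<^sup>2)))"

theorem theta3_inversion:
  assumes "t > 0"
  shows "theta3 (1 / t) = sqrt t * theta3 t"
proof -
  \<comment> \<open>With \<open>s = t / pi\<close> both Gaussian exponents become multiples of
    \<open>pi\<close>.\<close>
  have "theta3 t = 1 / sqrt t * theta3 (1 / t)"
    using gaussian_sum_inversion[of "t / pi"] assms by (simp add: theta3_def power2_eq_square mult_ac)
  then show ?thesis
    using assms by simp
qed

section \<open>The eta function and the Weber functions on the imaginary axis\<close>

text \<open>
  \<open>eta t\<close> is the Dedekind eta function at \<open>i t\<close>, and \<open>weber0\<close>, \<open>weber1\<close>, \<open>weber2\<close> are Weber's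
  functions \<open>\<ff>\<close>, \<open>\<ff>\<^sub>1\<close>, \<open>\<ff>\<^sub>2\<close> there.
\<close>

definition nome :: "real \<Rightarrow> real" where "nome t = exp (- pi * t)"

definition eta :: "real \<Rightarrow> real" where
  "eta t = exp (- pi * t / 12) * qpoch (nome (2 * t)) (nome (2 * t))"

definition weber0 :: "real \<Rightarrow> real" where "weber0 t = exp (pi * t / 24) * w0 (nome t)"
definition weber1 :: "real \<Rightarrow> real" where "weber1 t = exp (pi * t / 24) * w1 (nome t)"
definition weber2 :: "real \<Rightarrow> real" where "weber2 t = sqrt 2 * exp (- pi * t / 12) * w2 (nome t)"

lemma nome_bounds: "t > 0 \<Longrightarrow> 0 < nome t" "t > 0 \<Longrightarrow> nome t < 1"
  by (simp_all add: nome_def)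

lemma nome_mult: "nome (real n * t) = nome t ^ n"
  by (simp add: nome_def exp_of_nat_mult[symmetric] mult_ac)

lemma nome_double: "nome (2 * t) = (nome t)\<^sup>2"
  using nome_mult[of 2 t] by simp

lemma exp_shift: "exp (real n * x) = exp x ^ n" "exp (- (real n * x)) = 1 / exp x ^ n"
  by (simp_all only: exp_of_nat_mult exp_minus inverse_eq_divide)

context
  fixes t :: real
  assumes t: "t > 0"
begin

lemma weber_pos: "weber0 t > 0" "weber1 t > 0" "weber2 t > 0"
  using w_pos[OF nome_bounds[OF t]] by (simp_all add: weber0_def weber1_def weber2_def)

lemma eta_pos: "eta t > 0"
  using qpoch_pos'[OF nome_bounds[OF t], of 2 2] by (simp add: eta_def nome_double)

lemma weber_prod: "weber0 t * weber1 t * weber2 t = sqrt 2"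
proof -
  have "weber0 t * weber1 t * weber2 t =
      (exp (pi * t / 24) * exp (pi * t / 24) * exp (- pi * t / 12)) * sqrt 2 * (w0 (nome t) * w1 (nome t) * w2 (nome t))"
    by (simp add: weber0_def weber1_def weber2_def)
  also have "exp (pi * t / 24) * exp (pi * t / 24) * exp (- pi * t / 12) = 1"
    by (simp add: exp_add[symmetric])
  finally show ?thesis
    using w_prod[OF nome_bounds[OF t]] by simp
qed

lemma weber_jacobi: "weber0 t ^ 8 = weber1 t ^ 8 + weber2 t ^ 8"
proof -
  \<comment> \<open>\<open>a\<close> is the nome to the power -1/24, so every prefactor is an
    integral power of \<open>a\<close>. The factor \<open>16 * q\<close> in \<open>w_jacobi\<close>
    is matched by \<open>sqrt 2 ^ 8\<close> and \<open>q = 1 / a ^ 24\<close>.\<close>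
  define a where "a = exp (pi * t / 24)"
  have a: "a > 0" "exp (- pi * t / 12) = 1 / a\<^sup>2" "nome t = 1 / a ^ 24"
    using exp_shift(2)[of 2 "pi * t / 24"] exp_shift(2)[of 24 "pi * t / 24"] by (simp_all add: a_def nome_def)
  have s: "sqrt 2 ^ 8 = (16 :: real)"
    using power_mult[of "sqrt 2" 2 4] by simp
  have "a ^ 8 * (16 * nome t * w2 (nome t) ^ 8) = weber2 t ^ 8"
    unfolding weber2_def a(2) power_mult_distrib s
    using a(1) by (simp add: a(3) field_simps flip: power_mult power_add)
  then show ?thesis
    using w_jacobi[OF nome_bounds[OF t]]
    by (simp add: weber0_def weber1_def power_mult_distrib distrib_left flip: a_def)
qed

lemma weber_degree_7: "weber0 t * weber0 (7 * t) = weber1 t * weber1 (7 * t) + weber2 t * weber2 (7 * t)"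
proof -
  define a where "a = exp (pi * t / 24)"
  have a: "a > 0" "exp (- pi * t / 12) = 1 / a\<^sup>2" "nome t = 1 / a ^ 24"
      "exp (pi * (7 * t) / 24) = a ^ 7" "exp (- pi * (7 * t) / 12) = 1 / a ^ 14"
    using exp_shift(2)[of 2 "pi * t / 24"] exp_shift(2)[of 24 "pi * t / 24"]
      exp_shift(1)[of 7 "pi * t / 24"] exp_shift(2)[of 14 "pi * t / 24"] by (simp_all add: a_def nome_def mult_ac)
  have n: "nome (7 * t) = nome t ^ 7"
    using nome_mult[of 7 t] by simp
  have "a ^ 8 * (2 * nome t * w2 (nome t) * w2 (nome t ^ 7)) = weber2 t * weber2 (7 * t)"
    unfolding weber2_def a n using a(1) by (simp add: field_simps flip: power_add)
  moreover have "a ^ 8 = a * a ^ 7"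
    by (simp add: eval_nat_numeral)
  ultimately show ?thesis
    using w_degree_7[OF nome_bounds[OF t]]
    unfolding weber0_def weber1_def a n by (simp only: a_def[symmetric]) (simp add: algebra_simps)
qed

lemma weber_degree_3:
  shows "weber1 (3 * t) ^ 3 / weber1 t = weber0 (3 * t) ^ 3 / weber0 t + weber2 (3 * t) ^ 3 / weber2 t"
    and "weber2 t ^ 3 / weber2 (3 * t) = weber0 t ^ 3 / weber0 (3 * t) + weber1 t ^ 3 / weber1 (3 * t)"
    and "2 * weber2 t * weber1 (3 * t) ^ 3 / (weber1 t * weber2 (3 * t) ^ 3) =
      1 + (eta t / eta (3 * t))\<^sup>2 * (weber2 t / weber2 (3 * t)) ^ 4"
proof -
  define a where "a = exp (pi * t / 24)"
  have a: "a > 0" "exp (- pi * t / 12) = 1 / a\<^sup>2" "nome t = 1 / a ^ 24"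
      "exp (pi * (3 * t) / 24) = a ^ 3" "exp (- pi * (3 * t) / 12) = 1 / a ^ 6"
    using exp_shift(2)[of 2 "pi * t / 24"] exp_shift(2)[of 24 "pi * t / 24"]
      exp_shift(1)[of 3 "pi * t / 24"] exp_shift(2)[of 6 "pi * t / 24"] by (simp_all add: a_def nome_def mult_ac)
  have n: "nome (3 * t) = nome t ^ 3" "nome (2 * t) = nome t ^ 2" "nome (2 * (3 * t)) = nome t ^ 6"
    using nome_mult[of 3 t] nome_mult[of 2 t] nome_mult[of 6 t] by simp_all
  let ?q = "nome t"
  have pos: "w0 ?q > 0" "w1 ?q > 0" "w2 ?q > 0" "w0 (?q ^ 3) > 0" "w1 (?q ^ 3) > 0" "w2 (?q ^ 3) > 0"
    "qpoch (?q ^ 6) (?q ^ 6) > 0"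
    using w_pos[OF nome_bounds[OF t]] w_pos[OF nome_bounds, of "3 * t"] t n(1)
      qpoch_pos'[OF nome_bounds[OF t], of 6 6] by simp_all
  have W: "weber0 t = a * w0 ?q" "weber1 t = a * w1 ?q" "weber2 t = sqrt 2 / a\<^sup>2 * w2 ?q"
     "weber0 (3 * t) = a ^ 3 * w0 (?q ^ 3)" "weber1 (3 * t) = a ^ 3 * w1 (?q ^ 3)" "weber2 (3 * t) = sqrt 2 / a ^ 6 * w2 (?q ^ 3)"
    unfolding weber0_def weber1_def weber2_def a(2,4,5) n(1) by (simp_all add: a_def)
  have s3: "sqrt 2 ^ 3 = 2 * sqrt 2"
    by (simp add: eval_nat_numeral)
  have P: "(a ^ 3 * x) ^ 3 / (a * y) = a ^ 8 * (x ^ 3 / y)" "(a * y) ^ 3 / (a ^ 3 * x) = y ^ 3 / x" for x y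
  proof -
    have "(a ^ 3) ^ 3 = a * a ^ 8"
      by (simp add: eval_nat_numeral)
    then show "(a ^ 3 * x) ^ 3 / (a * y) = a ^ 8 * (x ^ 3 / y)"
      unfolding power_mult_distrib using a(1) by simp
    show "(a * y) ^ 3 / (a ^ 3 * x) = y ^ 3 / x"
      unfolding power_mult_distrib using a(1) by simp
  qed
  have Q: "(sqrt 2 / a ^ 6 * x) ^ 3 / (sqrt 2 / a\<^sup>2 * y) = a ^ 8 * (2 * ?q * x ^ 3 / y)"
    "(sqrt 2 / a\<^sup>2 * y) ^ 3 / (sqrt 2 / a ^ 6 * x) = 2 * y ^ 3 / x" for x y
  proof -
    have e: "(a ^ 6) ^ 3 = a\<^sup>2 * a ^ 16" "a ^ 24 = a ^ 8 * a ^ 16"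
      by (simp_all flip: power_add)
    have alg: "2 * S / (A * B) * X / (S / A * Y) = C * (2 * (1 / (C * B)) * X / Y)"
      if "S \<noteq> 0" "A \<noteq> 0" "B \<noteq> 0" "C \<noteq> 0" for S A B C X Y :: real
      using that by simp
    show "(sqrt 2 / a ^ 6 * x) ^ 3 / (sqrt 2 / a\<^sup>2 * y) = a ^ 8 * (2 * ?q * x ^ 3 / y)"
      unfolding power_mult_distrib power_divide s3 a(3) e using a(1) by (intro alg) simp_all
    show "(sqrt 2 / a\<^sup>2 * y) ^ 3 / (sqrt 2 / a ^ 6 * x) = 2 * y ^ 3 / x"
      unfolding power_mult_distrib power_divide s3
      using a(1) by (simp add: field_simps)
  qed
  show "weber1 (3 * t) ^ 3 / weber1 t = weber0 (3 * t) ^ 3 / weber0 t + weber2 (3 * t) ^ 3 / weber2 t"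
    unfolding W P Q w_degree_3(1)[OF nome_bounds[OF t]] by (simp only: distrib_left)
  show "weber2 t ^ 3 / weber2 (3 * t) = weber0 t ^ 3 / weber0 (3 * t) + weber1 t ^ 3 / weber1 (3 * t)"
    unfolding W P Q by (rule w_degree_3(2)[OF nome_bounds[OF t]])
  have E: "eta t / eta (3 * t) = a ^ 4 * (qpoch (?q ^ 2) (?q ^ 2) / qpoch (?q ^ 6) (?q ^ 6))"
  proof -
    have alg: "1 / A * X / (1 / (A * B) * Y) = B * (X / Y)" if "A \<noteq> 0" "B \<noteq> 0" for A B X Y :: real
      using that by simp
    have e: "a ^ 6 = a\<^sup>2 * a ^ 4"
      by (simp flip: power_add)
    show ?thesis
      unfolding eta_def a(2,5) n e using a(1) by (intro alg) simp_all
  qed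
  have R: "weber2 t / weber2 (3 * t) = a ^ 4 * (w2 ?q / w2 (?q ^ 3))"
  proof -
    have alg: "S / A * X / (S / (A * B) * Y) = B * (X / Y)" if "S \<noteq> 0" "A \<noteq> 0" "B \<noteq> 0" for S A B X Y :: real
      using that by simp
    have e: "a ^ 6 = a\<^sup>2 * a ^ 4"
      by (simp flip: power_add)
    show ?thesis
      unfolding W e using a(1) by (intro alg) simp_all
  qed
  have "2 * weber2 t * weber1 (3 * t) ^ 3 / (weber1 t * weber2 (3 * t) ^ 3) = a ^ 24 * (w2 ?q * w1 (?q ^ 3) ^ 3 / (w1 ?q * w2 (?q ^ 3) ^ 3))"
  proof -
    have alg: "2 * (S / A * X) * ((a * C) * Y) / (a * U * (2 * S / (A * B) * V)) = (C * B) * (X * Y / (U * V))"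
      if "S \<noteq> 0" "A \<noteq> 0" "B \<noteq> 0" "C \<noteq> 0" for S A B C X Y U V :: real
      using that a(1) by simp
    have e: "(a ^ 3) ^ 3 = a * a ^ 8" "(a ^ 6) ^ 3 = a\<^sup>2 * a ^ 16" "a ^ 24 = a ^ 8 * a ^ 16"
      by (simp_all add: eval_nat_numeral)
    show ?thesis
      unfolding W power_mult_distrib power_divide s3 e using a(1) by (intro alg) simp_all
  qed
  also have "\<dots> = a ^ 24 * ?q + (a ^ 24 * (qpoch (?q ^ 2) (?q ^ 2) / qpoch (?q ^ 6) (?q ^ 6))\<^sup>2 * (w2 ?q / w2 (?q ^ 3)) ^ 4)"
    unfolding w_degree_3_multiplier[OF nome_bounds[OF t]] by (simp only: distrib_left mult.assoc)
  also have "a ^ 24 * ?q = 1"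
    unfolding a(3) using a(1) by simp
  also have "a ^ 24 * (qpoch (?q ^ 2) (?q ^ 2) / qpoch (?q ^ 6) (?q ^ 6))\<^sup>2 * (w2 ?q / w2 (?q ^ 3)) ^ 4 = (eta t / eta (3 * t))\<^sup>2 * (weber2 t / weber2 (3 * t)) ^ 4"
    unfolding E R power_mult_distrib by (simp flip: power_mult power_add)
  finally show "2 * weber2 t * weber1 (3 * t) ^ 3 / (weber1 t * weber2 (3 * t) ^ 3) =
      1 + (eta t / eta (3 * t))\<^sup>2 * (weber2 t / weber2 (3 * t)) ^ 4" .
qed

lemma weber1_eta: "weber1 t = eta (t / 2) / eta t"
proof -
  have e: "qpoch ((nome t)\<^sup>2) ((nome t)\<^sup>2) > 0"
    using qpoch_pos'[OF nome_bounds[OF t], of 2 2] by simp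
  have "eta (t / 2) = exp (- pi * t / 24) * (w1 (nome t) * qpoch ((nome t)\<^sup>2) ((nome t)\<^sup>2))"
    using qpoch_q_q[OF nome_bounds[OF t]] by (simp add: eta_def)
  moreover have "exp (- pi * t / 24) = exp (pi * t / 24) * exp (- pi * t / 12)"
    by (simp add: exp_add[symmetric])
  ultimately show ?thesis
    using e by (simp add: weber1_def eta_def nome_double)
qed

lemma weber2_eta: "weber2 t = sqrt 2 * eta (2 * t) / eta t"
proof -
  have e: "qpoch ((nome t)\<^sup>2) ((nome t)\<^sup>2) > 0"
    using qpoch_pos'[OF nome_bounds[OF t], of 2 2] by simp
  have "eta (2 * t) = exp (- pi * t / 6) * (w2 (nome t) * qpoch ((nome t)\<^sup>2) ((nome t)\<^sup>2))"
    using qpoch_square[OF nome_bounds[OF t]] nome_mult[of 4 t] by (simp add: eta_def)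
  moreover have "exp (- pi * t / 6) = exp (- pi * t / 12) * exp (- pi * t / 12)"
    by (simp add: exp_add[symmetric])
  ultimately show ?thesis
    using e by (simp add: weber2_def eta_def nome_double)
qed

end

section \<open>Theta constants and the transformation law of eta\<close>

definition theta2 :: "real \<Rightarrow> real" where
  "theta2 t = (\<Sum>\<^sub>\<infinity>k::int. exp (- (pi * t * (real_of_int k + 1 / 2)\<^sup>2)))"

definition theta4 :: "real \<Rightarrow> real" where
  "theta4 t = (\<Sum>\<^sub>\<infinity>k::int. (- 1) powi k * exp (- (pi * t * (real_of_int k)\<^sup>2)))"

text \<open>The sums are split by the parity of \<open>k\<close>. This lets the transformations of
  \<open>theta2\<close> and \<open>theta4\<close> be read off from that of \<open>theta3\<close>,
  with no further summation formula.\<close>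

lemma theta_dissection:
  assumes t: "t > 0"
  shows "theta3 t = theta3 (4 * t) + theta2 (4 * t)" "theta4 t = theta3 (4 * t) - theta2 (4 * t)"
proof -
  let ?a = "\<lambda>k::int. exp (- (pi * t * (real_of_int k)\<^sup>2))"
  let ?b = "\<lambda>k::int. (- 1) powi k * exp (- (pi * t * (real_of_int k)\<^sup>2))"
  have s: "?a summable_on UNIV"
    using summable_gaussian[of "pi * t"] t by simp
  have sb: "?b summable_on UNIV"
  proof (rule abs_summable_summable)
    show "(\<lambda>k. norm (?b k)) summable_on UNIV"
      using s by (simp add: abs_mult power_int_abs)
  qed
  have split: "infsum f UNIV = infsum f {k. even k} + infsum f {k. odd k}" if "f summable_on UNIV" for f :: "int \<Rightarrow> real"
  proof -
    have "UNIV = {k::int. even k} \<union> {k. odd k}"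
      by auto
    then show ?thesis
      using infsum_Un_disjoint[of f "{k. even k}" "{k. odd k}"] that summable_on_subset_banach[OF that] by auto
  qed
  have e: "infsum ?a {k. even k} = theta3 (4 * t)"
    unfolding theta3_def
    by (rule infsum_reindex_bij_witness[where i="\<lambda>k. 2 * k" and j="\<lambda>k. k div 2"]) (auto simp: power_mult_distrib elim!: evenE)
  have o: "infsum ?a {k. odd k} = theta2 (4 * t)"
    unfolding theta2_def
    by (rule infsum_reindex_bij_witness[where i="\<lambda>k. 2 * k + 1" and j="\<lambda>k. k div 2"]) (auto simp: power2_eq_square field_simps elim!: oddE)
  show "theta3 t = theta3 (4 * t) + theta2 (4 * t)"
    using split[OF s] e o by (simp add: theta3_def)
  have "infsum ?b {k. even k} = infsum ?a {k. even k}"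
    by (rule infsum_cong) (auto simp: power_int_minus_left)
  moreover have "infsum ?b {k. odd k} = infsum (\<lambda>k. - ?a k) {k. odd k}"
    by (rule infsum_cong) (auto simp: power_int_minus_left)
  ultimately show "theta4 t = theta3 (4 * t) - theta2 (4 * t)"
    using split[OF sb] e o by (simp add: theta4_def infsum_uminus)
qed

lemma theta2_inversion:
  assumes "t > 0"
  shows "theta2 (1 / t) = sqrt t * theta4 t" "theta4 (1 / t) = sqrt t * theta2 t"
proof -
  have *: "theta3 (1 / (4 * t)) = 2 * sqrt t * theta3 (4 * t)" "theta3 (4 / t) = sqrt t / 2 * theta3 (t / 4)"
    using theta3_inversion[of "4 * t"] theta3_inversion[of "t / 4"] assms by (simp_all add: real_sqrt_mult real_sqrt_divide)
  have "theta2 (1 / t) = theta3 (1 / (4 * t)) - theta3 (1 / t)" "theta4 t = 2 * theta3 (4 * t) - theta3 t"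
    using theta_dissection(1)[of "1 / (4 * t)"] theta_dissection[of t] assms by simp_all
  then show "theta2 (1 / t) = sqrt t * theta4 t"
    using theta3_inversion[OF assms] *(1) by (simp add: right_diff_distrib)
  have "theta4 (1 / t) = 2 * theta3 (4 / t) - theta3 (1 / t)" "theta2 t = theta3 (t / 4) - theta3 t"
    using theta_dissection[of "1 / t"] theta_dissection(1)[of "t / 4"] assms by simp_all
  then show "theta4 (1 / t) = sqrt t * theta2 t"
    using theta3_inversion[OF assms] *(2) by (simp add: right_diff_distrib)
qed

text \<open>By the triple product each theta constant is, up to an elementary factor, a squared
  Weber product times \<open>e\<close>; the three Weber products multiply to 1, so only a cube of
  eta remains.\<close>

lemma theta_eta_product:
  assumes t: "t > 0"
  shows "theta2 t * theta3 t * theta4 t = 2 * eta t ^ 3"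
proof -
  define q where "q = nome t"
  have q: "0 < q" "q < 1"
    using nome_bounds[OF t] by (simp_all add: q_def)
  define e where "e = qpoch (q\<^sup>2) (q\<^sup>2)"
  have triple: "theta_series z (q\<^sup>2) = theta_prod z (q\<^sup>2) * e" if "z \<noteq> 0" for z
    unfolding e_def using jacobi_triple_product[OF that, of "q\<^sup>2"] q q_power_lt[OF q, of 2] by simp
  have qk: "q powi j = exp (- (pi * t * real_of_int j))" for j
    by (simp add: q_def nome_def exp_power_int mult_ac)
  have pw: "(q\<^sup>2) powi tri k = exp (- (pi * t * (real_of_int k * (real_of_int k - 1))))" for k
    using powi_tri_square[of q k] q qk[of "k * (k - 1)"] by simp
  have "theta3 t = theta_series (- q) (q\<^sup>2)"
    unfolding theta3_def theta_series_def pw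
    by (intro infsum_cong) (simp add: qk exp_add[symmetric] power2_eq_square algebra_simps)
  then have 3: "theta3 t = (w0 q)\<^sup>2 * e"
    using triple[of "-q"] q theta_monomial[OF q, of 1 2 "-1"] by (simp add: w0_def power2_eq_square)
  have "theta4 t = theta_series q (q\<^sup>2)"
    unfolding theta4_def theta_series_def pw
  proof (intro infsum_cong)
    fix k
    have "(- q) powi k = (- 1) powi k * q powi k"
      using power_int_mult_distrib[of "-1" q k] by simp
    then show "(- 1) powi k * exp (- (pi * t * (real_of_int k)\<^sup>2)) = (- q) powi k * exp (- (pi * t * (real_of_int k * (real_of_int k - 1))))"
      by (simp add: qk exp_add[symmetric] power2_eq_square algebra_simps)
  qed
  then have 4: "theta4 t = (w1 q)\<^sup>2 * e"
    using triple[of q] q theta_monomial[OF q, of 1 2 1] by (simp add: w1_def power2_eq_square)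
  have "theta2 t = (\<Sum>\<^sub>\<infinity>k. exp (- pi * t / 4) * ((- (- (q\<^sup>2))) powi k * (q\<^sup>2) powi tri k))"
    unfolding theta2_def pw
  proof (intro infsum_cong)
    fix k
    have "(- (- (q\<^sup>2))) powi k = exp (- (pi * t * (2 * real_of_int k)))"
      using qk[of "2 * k"] by (simp add: power_int_mult)
    then show "exp (- (pi * t * (real_of_int k + 1 / 2)\<^sup>2)) = exp (- pi * t / 4) * ((- (- (q\<^sup>2))) powi k * exp (- (pi * t * (real_of_int k * (real_of_int k - 1)))))"
      by (simp add: exp_add[symmetric] power2_eq_square algebra_simps)
  qed
  also have "\<dots> = exp (- pi * t / 4) * theta_series (- (q\<^sup>2)) (q\<^sup>2)"
    unfolding theta_series_def by (rule infsum_cmult_right')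
  finally have 2: "theta2 t = exp (- pi * t / 4) * (2 * (w2 q)\<^sup>2) * e"
    using triple[of "- (q\<^sup>2)"] q theta_monomial_sym[OF q, of 0 2 "-1"] theta_prod_minus_1[OF q, of 2] by (simp add: w2_def)
  have "theta2 t * theta3 t * theta4 t = 2 * exp (- pi * t / 4) * e ^ 3 * (w0 q * w1 q * w2 q)\<^sup>2"
    unfolding 2 3 4 by (simp add: eval_nat_numeral)
  also have "\<dots> = 2 * (exp (- pi * t / 12) ^ 3 * e ^ 3)"
    using w_prod[OF q] by (simp add: exp_of_nat_mult[symmetric])
  finally show ?thesis
    by (simp add: eta_def e_def q_def nome_double power_mult_distrib)
qed

text \<open>The cube of eta is transformed as a product of three theta constants; the cube root is
  unambiguous because eta is positive here.\<close>

theorem eta_inversion: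
  assumes t: "t > 0"
  shows "eta (1 / t) = sqrt t * eta t"
proof -
  have "theta2 (1 / t) * theta3 (1 / t) * theta4 (1 / t) = sqrt t ^ 3 * (theta2 t * theta3 t * theta4 t)"
    unfolding theta2_inversion[OF t] theta3_inversion[OF t] by (simp only: power3_eq_cube mult_ac)
  then have "2 * eta (1 / t) ^ 3 = sqrt t ^ 3 * (theta2 t * theta3 t * theta4 t)"
    using theta_eta_product[of "1 / t"] t by simp
  then have "eta (1 / t) ^ 3 = (sqrt t * eta t) ^ 3"
    using theta_eta_product[OF t] by (simp add: power_mult_distrib)
  moreover have "0 \<le> eta (1 / t)" "0 \<le> sqrt t * eta t"
    using eta_pos[of "1 / t"] eta_pos[OF t] t by (simp_all add: less_imp_le)
  ultimately show ?thesis
    by (rule power_eq_imp_eq_base) simp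
qed

text \<open>\<open>weber1\<close> and \<open>weber2\<close> are eta quotients which the inversion
  exchanges; for \<open>weber0\<close> the constant product of the three functions suffices.\<close>

lemma weber_inversion:
  assumes t: "t > 0"
  shows "weber1 (1 / t) = weber2 t" "weber2 (1 / t) = weber1 t" "weber0 (1 / t) = weber0 t"
proof -
  have e: "eta (1 / t) = sqrt t * eta t" "eta (1 / t / 2) = sqrt (2 * t) * eta (2 * t)" "eta (2 / t) = sqrt (t / 2) * eta (t / 2)"
    using eta_inversion[of t] eta_inversion[of "2 * t"] eta_inversion[of "t / 2"] t by (simp_all add: mult.commute)
  show 1: "weber1 (1 / t) = weber2 t"
  proof -
    have w: "weber1 (1 / t) = eta (1 / t / 2) / eta (1 / t)"
      by (rule weber1_eta) (use t in simp)
    show ?thesis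
      unfolding w e weber2_eta[OF t] using t by (simp add: real_sqrt_mult)
  qed
  show 2: "weber2 (1 / t) = weber1 t"
    using e t weber2_eta[of "1 / t"] weber1_eta[of t] by (simp add: real_sqrt_divide)
  show "weber0 (1 / t) = weber0 t"
  proof -
    have "weber0 (1 / t) * (weber1 t * weber2 t) = weber0 t * (weber1 t * weber2 t)"
      using weber_prod[of "1 / t"] weber_prod[of t] t unfolding 1 2 by (simp add: mult_ac)
    then show "weber0 (1 / t) = weber0 t"
      using weber_pos[OF t] by simp
  qed
qed

text \<open>Inversion at \<open>t / 2\<close> turns the first factor into
  \<open>weber2 (t / 2)\<close>, which up to \<open>sqrt 2\<close> is the reciprocal eta quotient of
  \<open>weber1 t\<close>.\<close>

lemma weber1_half: "t > 0 \<Longrightarrow> weber1 (2 / t) * weber1 t = sqrt 2"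
  using weber_inversion(1)[of "t / 2"] weber2_eta[of "t / 2"] weber1_eta[of t] eta_pos[of t] eta_pos[of "t / 2"] by simp

text \<open>Euler's pentagonal number theorem. As
  \<open>m * (3 * m - 1) div 2 = m + 3 * tri m\<close>, the series is a theta series in base
  \<open>y ^ 3\<close>, and its three products are the residue classes modulo 3 of a single
  product.\<close>

lemma theta_f_eq_qpoch:
  fixes x :: real
  assumes "x \<noteq> 0" "\<bar>x\<bar> < 1"
  shows "theta_f x = qpoch (- x) (- x)"
proof -
  define y where "y = - x"
  have y: "y \<noteq> 0" "\<bar>y\<bar> < 1"
    using assms by (simp_all add: y_def)
  have y3: "\<bar>y ^ 3\<bar> < 1"
    using y by (simp add: power_abs power_less_one_iff)
  have "(- 1) powi m * y ^ nat (m * (3 * m - 1) div 2) = (- y) powi m * (y ^ 3) powi tri m" for m :: int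
  proof -
    have "2 * (m + 3 * tri m) = 2 * m + 3 * (2 * tri m)"
      by (simp only: distrib_left mult.left_commute)
    also have "\<dots> = m * (3 * m - 1)"
      unfolding two_tri by (simp add: algebra_simps)
    finally have e: "m * (3 * m - 1) div 2 = m + 3 * tri m"
      by (metis nonzero_mult_div_cancel_left zero_neq_numeral)
    have "0 \<le> m * (3 * m - 1)"
      by (cases "m \<le> 0") (auto intro: mult_nonneg_nonneg mult_nonpos_nonpos)
    then have "y ^ nat (m * (3 * m - 1) div 2) = y powi (m * (3 * m - 1) div 2)"
      by (intro power_int_nonneg_exp[symmetric]) (simp add: pos_imp_zdiv_nonneg_iff)
    also have "\<dots> = y powi m * (y ^ 3) powi tri m"
      unfolding e using y by (simp add: power_int_add power_int_mult)
    finally show ?thesis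
      using power_int_mult_distrib[of "-1" y m] by simp
  qed
  then have "theta_f x = theta_series y (y ^ 3)"
    unfolding theta_f_def theta_series_def y_def by simp
  also have "\<dots> = theta_prod y (y ^ 3) * qpoch (y ^ 3) (y ^ 3)"
    using y y3 by (intro jacobi_triple_product) auto
  also have "\<dots> = qpoch y (y ^ 3) * qpoch (y * y) (y ^ 3) * qpoch (y * (y * y)) (y ^ 3)"
    using y by (simp add: theta_prod_def eval_nat_numeral)
  also have "\<dots> = qpoch y y"
    using qpoch_split[OF y(2), of 3 y] by (simp add: eval_nat_numeral mult_ac)
  finally show ?thesis
    by (simp add: y_def)
qed

text \<open>The power \<open>q ^ ((k - 1) / 24)\<close> in \<open>theta_r\<close> is exactly what
  completes both products to eta values.\<close>

lemma theta_r_eq_eta: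
  assumes "n > 0"
  defines "t \<equiv> sqrt (n / 7)"
  shows "theta_r 7 n = eta t / (7 powr (1/4) * eta (7 * t))"
proof -
  have t: "t > 0"
    using assms by simp
  define q where "q = nome (2 * t)"
  have q: "0 < q" "q < 1" "q = exp (- 2 * pi * t)"
    using t by (simp_all add: q_def nome_def)
  have q7: "q powr 7 = nome (2 * (7 * t))" "q powr ((7 - 1) / 24) = exp (- pi * t / 2)"
    by (simp_all add: q(3) nome_def powr_def mult_ac)
  have "theta_f (- q) = exp (pi * t / 12) * eta t"
    using theta_f_eq_qpoch[of "-q"] q by (simp add: eta_def flip: q_def mult.assoc exp_add)
  moreover have "theta_f (- (q powr 7)) = exp (7 * pi * t / 12) * eta (7 * t)"
    using theta_f_eq_qpoch[of "- (q powr 7)"] nome_bounds[of "2 * (7 * t)"] t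
    unfolding q7 by (simp add: eta_def flip: mult.assoc exp_add)
  moreover have "exp (pi * t / 12) = exp (- pi * t / 2) * exp (7 * pi * t / 12)"
    by (simp add: exp_add[symmetric])
  ultimately have "theta_f (- q) / (7 powr (1/4) * q powr ((7 - 1) / 24) * theta_f (- (q powr 7))) = eta t / (7 powr (1/4) * eta (7 * t))"
    unfolding q7(2) by simp
  then show ?thesis
    unfolding theta_r_def Let_def t_def[symmetric] q(3) .
qed

text \<open>At a positive argument \<open>q\<close> the pentagonal product has base
  \<open>- q\<close>. Split by parity it is \<open>w0 q\<close> times the product in
  \<open>q ^ 2\<close>, that is, a \<open>weber0\<close> factor times eta up to an
  exponential.\<close>

lemma theta_r'_eq_eta:
  assumes "n > 0"
  defines "t \<equiv> sqrt (n / 7)"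
  shows "theta_r' 7 n = theta_r 7 n * (weber0 t / weber0 (7 * t))"
proof -
  have t: "t > 0"
    using assms by simp
  define q where "q = nome t"
  have q: "0 < q" "q < 1" "q = exp (- pi * t)"
    using t by (simp_all add: q_def nome_def)
  have q7: "q powr 7 = nome (7 * t)" "q powr ((7 - 1) / 24) = exp (- pi * t / 4)"
    by (simp_all add: q(3) nome_def powr_def mult_ac)
  have f: "theta_f (nome s) = exp (pi * s / 24) * (weber0 s * eta s)" if "s > 0" for s
  proof -
    have b: "0 < nome s" "nome s < 1"
      using nome_bounds[OF that] .
    have "theta_f (nome s) = w0 (nome s) * qpoch ((nome s)\<^sup>2) ((nome s)\<^sup>2)"
      using theta_f_eq_qpoch[of "nome s"] qpoch_split[of "- nome s" 2 "- nome s"] b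
      by (simp add: w0_def eval_nat_numeral)
    moreover have "exp (pi * s / 24) * exp (pi * s / 24) * exp (- pi * s / 12) = 1"
      by (simp add: exp_add[symmetric])
    moreover have "exp (pi * s / 24) * (weber0 s * eta s) = (exp (pi * s / 24) * exp (pi * s / 24) * exp (- pi * s / 12)) *
        (w0 (nome s) * qpoch ((nome s)\<^sup>2) ((nome s)\<^sup>2))"
      by (simp add: weber0_def eta_def nome_double)
    ultimately show ?thesis
      by simp
  qed
  have "exp (pi * t / 24) = exp (- pi * t / 4) * exp (pi * (7 * t) / 24)"
    by (simp add: exp_add[symmetric])
  then have "theta_f q / (7 powr (1/4) * q powr ((7 - 1) / 24) * theta_f (q powr 7)) =
     eta t / (7 powr (1/4) * eta (7 * t)) * (weber0 t / weber0 (7 * t))"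
    unfolding q7 using f[OF t] f[of "7 * t"] t by (simp add: q_def mult_ac)
  then have "theta_r' 7 n = eta t / (7 powr (1/4) * eta (7 * t)) * (weber0 t / weber0 (7 * t))"
    unfolding theta_r'_def Let_def t_def[symmetric] q(3) .
  then show ?thesis
    using theta_r_eq_eta[OF assms(1)] by (simp add: t_def)
qed

section \<open>Relations between the Weber functions\<close>

text \<open>For \<open>M = m + 1 / m\<close> one has
  \<open>m ^ 3 + 1 / m ^ 3 = M * (M ^ 2 - 3)\<close>. Squaring and putting \<open>N = M ^ 2\<close>
  gives the function treated here; \<open>N >= 4\<close> reflects \<open>M >= 2\<close>.\<close>

lemma cubic_inj:
  fixes N N' :: real
  assumes "N * (N - 3)\<^sup>2 = N' * (N' - 3)\<^sup>2" "N \<ge> 4" "N' \<ge> 4"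
  shows "N = N'"
proof -
  have less: "x * (x - 3)\<^sup>2 < y * (y - 3)\<^sup>2" if "x < y" "x \<ge> 4" for x y :: real
    using that by (intro mult_strict_mono power_strict_mono) auto
  show ?thesis
    using less[of N N'] less[of N' N] assms by (cases N N' rule: linorder_cases) auto
qed

lemma add_inverse_ge_2:
  fixes m :: real
  assumes "m > 0"
  shows "m + 1 / m \<ge> 2"
  using assms sum_squares_ge_zero[of "m - 1" 0] by (simp add: field_simps power2_eq_square)

text \<open>The left side is \<open>p * (1 + p) + P * (1 + P)\<close> when
  \<open>p + P = \<sigma>\<close> and \<open>p * P = s ^ 8\<close>. With \<open>M0 = K / w\<close>
  the right side is \<open>w ^ 4 * (M0 ^ 3 - 3 * M0)\<close>, the shape of
  \<open>m ^ 3 + 1 / m ^ 3\<close> as a polynomial in \<open>m + 1 / m\<close>.\<close>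

lemma degree_7_polynomial:
  fixes s :: real
  defines "w \<equiv> s * (1 + s)" and "\<sigma> \<equiv> (1 + s) ^ 8 - 1 - s ^ 8"
  defines "K \<equiv> 2 + 7 * w + 4 * w\<^sup>2"
  shows "\<sigma> + \<sigma>\<^sup>2 - 2 * s ^ 8 = w * (K ^ 3 - 3 * K * w\<^sup>2)"
  unfolding K_def \<sigma>_def w_def by algebra

text \<open>
  The unknowns \<open>p\<close> and \<open>P\<close> are the two roots of a quadratic whose coefficients are
  polynomials in \<open>s\<close>. This determines \<open>m\<^sup>6\<close> up to inversion, and the value of
  \<open>m + 1 / m\<close> follows since \<open>N (N - 3)\<^sup>2\<close> is increasing for \<open>N \<ge> 4\<close>.
\<close>

lemma degree_7_algebra:
  fixes p P s m :: real
  defines "w \<equiv> s * (1 + s)"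
  assumes pP: "p * P = s ^ 8" and qQ: "(1 + p) * (1 + P) = (1 + s) ^ 8" and w: "w \<noteq> 0"
    and m: "m > 0" and m6: "m ^ 6 * (p * (1 + p)) = P * (1 + P)"
  shows "(m + 1 / m)\<^sup>2 = (2 / w + 4 * w + 7)\<^sup>2"
proof -
  define X where "X = P * (1 + P)"
  define Y where "Y = p * (1 + p)"
  define K where "K = 2 + 7 * w + 4 * w\<^sup>2"
  define M where "M = m + 1 / m"
  define M0 where "M0 = 2 / w + 4 * w + 7"
  have M0: "M0 = K / w"
    using w by (simp add: M0_def K_def field_simps power2_eq_square)
  have XY: "X * Y = w ^ 8"
  proof -
    have "X * Y = (p * P) * ((1 + p) * (1 + P))"
      by (simp add: X_def Y_def)
    then show ?thesis
      unfolding pP qQ by (simp add: w_def power_mult_distrib)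
  qed
  have sum: "X + Y = w * (K ^ 3 - 3 * K * w\<^sup>2)"
  proof -
    have "p + P = (1 + s) ^ 8 - 1 - s ^ 8"
      using pP qQ by (simp add: algebra_simps)
    moreover have "X + Y = (p + P) + (p + P)\<^sup>2 - 2 * (p * P)"
      by (simp add: X_def Y_def power2_eq_square algebra_simps)
    ultimately show ?thesis
      unfolding pP K_def w_def using degree_7_polynomial[of s] by simp
  qed
  have Y0: "Y \<noteq> 0"
    using XY w by auto
  have X: "X = m ^ 6 * Y"
    using m6 by (simp add: X_def Y_def)
  have "(M * (M\<^sup>2 - 3))\<^sup>2 = (m ^ 3 + 1 / m ^ 3)\<^sup>2"
    using m by (simp add: M_def field_simps power2_eq_square power3_eq_cube)
  also have "\<dots> = (X + Y)\<^sup>2 / (X * Y)"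
  proof -
    have e: "m ^ 6 = (m ^ 3)\<^sup>2"
      by (simp flip: power_mult)
    show ?thesis
      unfolding X e using m Y0 by (simp add: field_simps power2_eq_square)
  qed
  also have "\<dots> = (M0 * (M0\<^sup>2 - 3))\<^sup>2"
  proof -
    have "M0 * (M0\<^sup>2 - 3) = (K ^ 3 - 3 * K * w\<^sup>2) / w ^ 3"
      unfolding M0 using w by (simp add: field_simps power2_eq_square power3_eq_cube)
    moreover have "(w * z)\<^sup>2 / w ^ 8 = (z / w ^ 3)\<^sup>2" for z
      using w by (simp add: power_mult_distrib power_divide eval_nat_numeral)
    ultimately show ?thesis
      unfolding sum XY by simp
  qed
  finally have "M\<^sup>2 * (M\<^sup>2 - 3)\<^sup>2 = M0\<^sup>2 * (M0\<^sup>2 - 3)\<^sup>2"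
    by (simp add: power_mult_distrib)
  moreover have "M\<^sup>2 \<ge> 2\<^sup>2"
    using add_inverse_ge_2[OF m] unfolding M_def by (intro power_mono) auto
  moreover have "M0\<^sup>2 \<ge> 2\<^sup>2"
  proof (cases "w > 0")
    case True
    then have "M0 \<ge> 2"
      by (simp add: M0_def)
    then show ?thesis
      by (intro power_mono) auto
  next
    case False
    then have neg: "w < 0"
      using w by simp
    \<comment> \<open>Negative \<open>w\<close> occurs in the application to \<open>weber0\<close>,
      where \<open>s\<close> is negative. The bound follows from \<open>4 * w + 1 >= 0\<close> and
      the factorization \<open>K + 2 * w = (4 * w + 1) * (w + 2)\<close>.\<close>
    have "4 * w + 1 = (2 * s + 1)\<^sup>2"
      by (simp add: w_def power2_eq_square algebra_simps)
    then have q: "4 * w + 1 \<ge> 0"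
      by simp
    then have "0 \<le> (4 * w + 1) * (w + 2)"
      by (intro mult_nonneg_nonneg) auto
    then have "- 2 * w \<le> K"
      by (simp add: K_def power2_eq_square algebra_simps)
    then have "M0 \<le> - 2"
      unfolding M0 using neg by (simp add: field_simps)
    then have "2\<^sup>2 \<le> (- M0)\<^sup>2"
      by (intro power_mono) auto
    then show ?thesis
      by simp
  qed
  ultimately have "M\<^sup>2 = M0\<^sup>2"
    using cubic_inj[of "M\<^sup>2" "M0\<^sup>2"] by simp
  then show ?thesis
    by (simp add: M_def M0_def)
qed

lemma pos_power_eq:
  fixes a b :: real
  shows "a ^ n = b ^ n \<Longrightarrow> 0 < a \<Longrightarrow> 0 < b \<Longrightarrow> 0 < n \<Longrightarrow> a = b"
  using power_eq_imp_eq_base[of a n b] by simp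

lemma sqrt2_power8: "sqrt 2 ^ 8 = (16 :: real)"
  using power_mult[of "sqrt 2" 2 4] by simp

text \<open>\<open>degree_7_algebra\<close> is applied to \<open>p = (f2 / f1) ^ 8\<close> with
  \<open>s = Y / U\<close>, and for \<open>weber0\<close> to \<open>p = - ((f2 / f0) ^ 8)\<close>
  with \<open>s = - Y / F\<close>. The second identity stays squared, which is the form that
  \<open>root_selection\<close> takes.\<close>

lemma weber_degree_7_values:
  assumes t: "t > 0"
  defines "U \<equiv> weber1 t * weber1 (7 * t)" and "F \<equiv> weber0 t * weber0 (7 * t)"
  shows "(weber1 t / weber1 (7 * t)) ^ 4 + 1 / (weber1 t / weber1 (7 * t)) ^ 4 = U ^ 3 + 8 / U ^ 3 + 7"
    and "((weber0 t / weber0 (7 * t)) ^ 4 + 1 / (weber0 t / weber0 (7 * t)) ^ 4)\<^sup>2 = (F ^ 3 + 8 / F ^ 3 - 7)\<^sup>2"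
proof -
  have t7: "7 * t > 0"
    using t by simp
  define f0 f1 f2 g0 g1 g2 where f: "f0 = weber0 t" "f1 = weber1 t" "f2 = weber2 t"
    "g0 = weber0 (7 * t)" "g1 = weber1 (7 * t)" "g2 = weber2 (7 * t)"
  have pos: "f0 > 0" "f1 > 0" "f2 > 0" "g0 > 0" "g1 > 0" "g2 > 0"
    using weber_pos[OF t] weber_pos[OF t7] by (simp_all add: f)
  have pr: "f0 * f1 * f2 = sqrt 2" "g0 * g1 * g2 = sqrt 2"
    using weber_prod[OF t] weber_prod[OF t7] by (simp_all add: f)
  have pr8: "f0 ^ 8 * f1 ^ 8 * f2 ^ 8 = 16" "g0 ^ 8 * g1 ^ 8 * g2 ^ 8 = 16"
    using pr by (simp_all only: power_mult_distrib[symmetric] sqrt2_power8)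
  have jac: "f0 ^ 8 = f1 ^ 8 + f2 ^ 8" "g0 ^ 8 = g1 ^ 8 + g2 ^ 8"
    using weber_jacobi[OF t] weber_jacobi[OF t7] by (simp_all add: f)
  define Y where "Y = f2 * g2"
  have UF: "U = f1 * g1" "F = f0 * g0"
    by (simp_all add: U_def F_def f)
  have FUY: "F = U + Y"
    using weber_degree_7[OF t] by (simp add: UF Y_def f)
  have prod: "F * U * Y = 2"
  proof -
    have "F * U * Y = (f0 * f1 * f2) * (g0 * g1 * g2)"
      by (simp add: UF Y_def)
    then show ?thesis
      unfolding pr by simp
  qed
  have UFp: "U > 0" "F > 0" "Y > 0"
    using pos by (simp_all add: UF Y_def)
  have Fe: "f0 ^ 8 * g0 ^ 8 = F ^ 8" "f1 ^ 8 * g1 ^ 8 = U ^ 8" "f2 ^ 8 * g2 ^ 8 = Y ^ 8"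
    by (simp_all add: UF Y_def power_mult_distrib)
  have ev: "(- x / y) ^ 8 = x ^ 8 / y ^ 8" for x y :: real
    by (simp add: power_divide)
  have m6: "((x / y) ^ 4) ^ 6 = x ^ 24 / y ^ 24" for x y :: real
    by (simp add: power_divide)
  have x24: "x ^ 24 = x ^ 8 * x ^ 8 * x ^ 8" for x :: real
    by (simp flip: power_add)
  have alg: "b / a * (c / a) = 16 / (a * a * a)" if "a * b * c = 16" "a \<noteq> 0" for a b c :: real
    unfolding that(1)[symmetric] using that(2) by simp
  define m where "m = (f1 / g1) ^ 4"
  have w1: "Y / U * (1 + Y / U) = 2 / U ^ 3"
  proof -
    have "Y / U * (1 + Y / U) = (F * U * Y) / U ^ 3"
      using UFp by (simp add: FUY field_simps eval_nat_numeral)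
    then show ?thesis
      unfolding prod .
  qed
  have "(m + 1 / m)\<^sup>2 = (2 / (Y / U * (1 + Y / U)) + 4 * (Y / U * (1 + Y / U)) + 7)\<^sup>2"
  proof (rule degree_7_algebra)
    show "f2 ^ 8 / f1 ^ 8 * (g2 ^ 8 / g1 ^ 8) = (Y / U) ^ 8"
      by (simp add: power_divide flip: Fe)
    have "1 + f2 ^ 8 / f1 ^ 8 = f0 ^ 8 / f1 ^ 8" "1 + g2 ^ 8 / g1 ^ 8 = g0 ^ 8 / g1 ^ 8"
      unfolding jac using pos by (simp_all add: add_divide_distrib)
    note e = this
    have "1 + Y / U = F / U"
      using UFp by (simp add: FUY add_divide_distrib)
    then show "(1 + f2 ^ 8 / f1 ^ 8) * (1 + g2 ^ 8 / g1 ^ 8) = (1 + Y / U) ^ 8"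
      unfolding e by (simp add: power_divide flip: Fe)
    show "Y / U * (1 + Y / U) \<noteq> 0"
      unfolding w1 using UFp by simp
    show "m > 0"
      using pos by (simp add: m_def)
    \<comment> \<open>Because \<open>f0 * f1 * f2 = sqrt 2\<close>, the quantity
      \<open>p * (1 + p)\<close> is \<open>16 / f1 ^ 24\<close>; this is why \<open>m\<close> is a
      fourth power and enters as \<open>m ^ 6\<close>.\<close>
    have "f2 ^ 8 / f1 ^ 8 * (f0 ^ 8 / f1 ^ 8) = 16 / f1 ^ 24" "g2 ^ 8 / g1 ^ 8 * (g0 ^ 8 / g1 ^ 8) = 16 / g1 ^ 24"
      unfolding x24 using pos pr8 by (intro alg; simp add: mult_ac)+
    then show "m ^ 6 * (f2 ^ 8 / f1 ^ 8 * (1 + f2 ^ 8 / f1 ^ 8)) = g2 ^ 8 / g1 ^ 8 * (1 + g2 ^ 8 / g1 ^ 8)"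
      unfolding e m_def m6 using pos by simp
  qed
  then have "(m + 1 / m)\<^sup>2 = (U ^ 3 + 8 / U ^ 3 + 7)\<^sup>2"
    unfolding w1 by simp
  moreover have "m + 1 / m \<ge> 0" "U ^ 3 + 8 / U ^ 3 + 7 \<ge> 0"
    using pos UFp by (simp_all add: m_def)
  ultimately have "m + 1 / m = U ^ 3 + 8 / U ^ 3 + 7"
    by (rule power2_eq_imp_eq)
  then show "(weber1 t / weber1 (7 * t)) ^ 4 + 1 / (weber1 t / weber1 (7 * t)) ^ 4 = U ^ 3 + 8 / U ^ 3 + 7"
    by (simp add: m_def f)
  define m' where "m' = (f0 / g0) ^ 4"
  have w0: "- Y / F * (1 + - Y / F) = - (2 / F ^ 3)"
  proof -
    have "1 + - Y / F = U / F"
      using UFp by (simp add: FUY field_simps)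
    then have "- Y / F * (1 + - Y / F) = - ((F * U * Y) / F ^ 3)"
      using UFp by (simp add: eval_nat_numeral)
    then show ?thesis
      unfolding prod .
  qed
  have "(m' + 1 / m')\<^sup>2 = (2 / (- Y / F * (1 + - Y / F)) + 4 * (- Y / F * (1 + - Y / F)) + 7)\<^sup>2"
  proof (rule degree_7_algebra)
    show "- (f2 ^ 8 / f0 ^ 8) * - (g2 ^ 8 / g0 ^ 8) = (- Y / F) ^ 8"
      unfolding ev by (simp flip: Fe)
    have "1 + - (f2 ^ 8 / f0 ^ 8) = f1 ^ 8 / f0 ^ 8" "1 + - (g2 ^ 8 / g0 ^ 8) = g1 ^ 8 / g0 ^ 8"
    proof -
      have "f1 ^ 8 = f0 ^ 8 - f2 ^ 8" "g1 ^ 8 = g0 ^ 8 - g2 ^ 8"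
        using jac by simp_all
      then show "1 + - (f2 ^ 8 / f0 ^ 8) = f1 ^ 8 / f0 ^ 8" "1 + - (g2 ^ 8 / g0 ^ 8) = g1 ^ 8 / g0 ^ 8"
        using pos by (simp_all add: diff_divide_distrib)
    qed
    note e = this
    have "1 + - Y / F = U / F"
      using UFp by (simp add: FUY field_simps)
    then show "(1 + - (f2 ^ 8 / f0 ^ 8)) * (1 + - (g2 ^ 8 / g0 ^ 8)) = (1 + - Y / F) ^ 8"
      unfolding e by (simp add: power_divide flip: Fe)
    show "- Y / F * (1 + - Y / F) \<noteq> 0"
      unfolding w0 using UFp by simp
    show "m' > 0"
      using pos by (simp add: m'_def)
    have "f2 ^ 8 / f0 ^ 8 * (f1 ^ 8 / f0 ^ 8) = 16 / f0 ^ 24" "g2 ^ 8 / g0 ^ 8 * (g1 ^ 8 / g0 ^ 8) = 16 / g0 ^ 24"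
      unfolding x24 using pos pr8 by (intro alg; simp add: mult_ac)+
    then show "m' ^ 6 * (- (f2 ^ 8 / f0 ^ 8) * (1 + - (f2 ^ 8 / f0 ^ 8))) = - (g2 ^ 8 / g0 ^ 8) * (1 + - (g2 ^ 8 / g0 ^ 8))"
      unfolding e m'_def m6 using pos by simp
  qed
  then have "(m' + 1 / m')\<^sup>2 = (- (F ^ 3 + 8 / F ^ 3 - 7))\<^sup>2"
    unfolding w0 by (simp add: algebra_simps)
  then show "((weber0 t / weber0 (7 * t)) ^ 4 + 1 / (weber0 t / weber0 (7 * t)) ^ 4)\<^sup>2 = (F ^ 3 + 8 / F ^ 3 - 7)\<^sup>2"
    by (simp only: m'_def f power2_minus)
qed

text \<open>The hypothesis makes \<open>X\<close> a rational function of \<open>v\<close>; over the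
  common denominator \<open>v * A * B\<close> both claims become the polynomial identities
  \<open>i1\<close> and \<open>i2\<close> in \<open>v\<close>.\<close>

lemma degree_3_algebra:
  fixes X v :: real
  assumes "X > 0" "v > 0" "X * (2 + v) = 1 - 4 * v"
  defines "R \<equiv> X * v" and "U \<equiv> 4 * X / v" and "K \<equiv> (2 + v)\<^sup>2 * X / v"
  shows "R + 1 / R = U + 64 / U + 18" "K + 81 / K + 16 = R + 1 / R"
proof -
  have v2: "2 + v > 0" and "X * (2 + v) > 0"
    using assms(1,2) by simp_all
  then have v4: "1 - 4 * v > 0"
    by (simp only: assms(3))
  have X: "X = (1 - 4 * v) / (2 + v)"
    using assms(3) v2 by (simp add: field_simps)
  define A where "A = 1 - 4 * v"
  define B where "B = 2 + v"
  have AB: "A > 0" "B > 0" "X = A / B"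
    using X v4 v2 by (simp_all add: A_def B_def)
  have i1: "A\<^sup>2 * v\<^sup>2 + B\<^sup>2 = 4 * A\<^sup>2 + 16 * v\<^sup>2 * B\<^sup>2 + 18 * v * A * B"
    unfolding A_def B_def by algebra
  have i2: "B\<^sup>2 * A\<^sup>2 + 81 * v\<^sup>2 + 16 * v * A * B = A\<^sup>2 * v\<^sup>2 + B\<^sup>2"
    unfolding A_def B_def by algebra
  have "R + 1 / R = (A\<^sup>2 * v\<^sup>2 + B\<^sup>2) / (v * A * B)"
    unfolding R_def AB(3) using AB(1,2) assms(2) by (simp add: field_simps power2_eq_square)
  moreover have "U + 64 / U + 18 = (4 * A\<^sup>2 + 16 * v\<^sup>2 * B\<^sup>2 + 18 * v * A * B) / (v * A * B)"
    unfolding U_def AB(3) using AB(1,2) assms(2) by (simp add: field_simps power2_eq_square)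
  moreover have "K + 81 / K + 16 = (B\<^sup>2 * A\<^sup>2 + 81 * v\<^sup>2 + 16 * v * A * B) / (v * A * B)"
    unfolding K_def B_def[symmetric] AB(3) using AB(1,2) assms(2) by (simp add: field_simps power2_eq_square)
  ultimately show "R + 1 / R = U + 64 / U + 18" "K + 81 / K + 16 = R + 1 / R"
    unfolding i1 i2 by simp_all
qed

text \<open>
  The parametrization of the proof is classical: with \<open>p = b ^ 3 / a\<close> and \<open>z = (2 + p) / (1 + 2 * p)\<close> the squared
  moduli \<open>a ^ 8\<close> and \<open>b ^ 8\<close> at \<open>t\<close> and \<open>3 t\<close> are \<open>p * z ^ 3\<close> and \<open>p ^ 3 * z\<close>.
\<close>

lemma weber_degree_3_values:
  assumes t: "t > 0"
  defines "U \<equiv> weber1 t * weber1 (3 * t)" and "r \<equiv> weber1 t / weber1 (3 * t)"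
    and "K \<equiv> ((eta t / eta (3 * t))\<^sup>2 * (weber1 t / weber1 (3 * t))) ^ 4"
  shows "r ^ 12 + 1 / r ^ 12 = U ^ 6 + 64 / U ^ 6 + 18" "K + 81 / K + 16 = r ^ 12 + 1 / r ^ 12"
proof -
  have t3: "3 * t > 0"
    using t by simp
  define f0 f1 f2 g0 g1 g2 where f: "f0 = weber0 t" "f1 = weber1 t" "f2 = weber2 t"
    "g0 = weber0 (3 * t)" "g1 = weber1 (3 * t)" "g2 = weber2 (3 * t)"
  have pos: "f0 > 0" "f1 > 0" "f2 > 0" "g0 > 0" "g1 > 0" "g2 > 0"
    using weber_pos[OF t] weber_pos[OF t3] by (simp_all add: f)
  define m where "m = (eta t / eta (3 * t))\<^sup>2"
  have m: "m > 0"
    using eta_pos[OF t] eta_pos[OF t3] by (simp add: m_def)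
  define a a1 b b1 where ab: "a = f2 / f0" "a1 = f1 / f0" "b = g2 / g0" "b1 = g1 / g0"
  have abp: "a > 0" "a1 > 0" "b > 0" "b1 > 0"
    using pos by (simp_all add: ab)
  have fs: "f1 = a1 * f0" "f2 = a * f0" "g1 = b1 * g0" "g2 = b * g0"
    using pos by (simp_all add: ab)
  define p where "p = b ^ 3 / a"
  define z where "z = a ^ 3 / b"
  define y where "y = a1 ^ 3 / b1"
  have pyz: "p > 0" "y > 0" "z > 0"
    using abp by (simp_all add: p_def y_def z_def)
  have b1p: "b1 ^ 3 / a1 = 1 + p"
  proof -
    have "(g0 ^ 3 / f0) * (b1 ^ 3 / a1) = (g0 ^ 3 / f0) * (1 + p)"
      using weber_degree_3(1)[OF t] pos unfolding f[symmetric] fs p_def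
      by (simp add: power_mult_distrib distrib_left mult_ac)
    then show ?thesis
      by (rule mult_left_cancel[THEN iffD1, rotated]) (use pos in simp)
  qed
  have zy: "z = 1 + y"
  proof -
    have "(f0 ^ 3 / g0) * z = (f0 ^ 3 / g0) * (1 + y)"
      using weber_degree_3(2)[OF t] pos unfolding f[symmetric] fs z_def y_def
      by (simp add: power_mult_distrib distrib_left mult_ac)
    then show ?thesis
      by (rule mult_left_cancel[THEN iffD1, rotated]) (use pos in simp)
  qed
  have a8: "a ^ 8 = p * z ^ 3"
    unfolding p_def z_def using abp by (simp add: power_divide) (simp add: eval_nat_numeral)
  have a18: "a1 ^ 8 = (1 + p) * y ^ 3"
    unfolding b1p[symmetric] y_def using abp by (simp add: power_divide) (simp add: eval_nat_numeral)
  have b8: "b ^ 8 = p ^ 3 * z"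
    unfolding p_def z_def using abp by (simp add: power_divide) (simp add: eval_nat_numeral)
  have b18: "b1 ^ 8 = (1 + p) ^ 3 * y"
    unfolding b1p[symmetric] y_def using abp by (simp add: power_divide) (simp add: eval_nat_numeral)
  \<comment> \<open>Jacobi's identity at \<open>3 * t\<close> determines \<open>y\<close> from
    \<open>p\<close>: the resulting polynomial splits into the positive factor
    \<open>1 + p + p ^ 2\<close> and a factor linear in \<open>y\<close>.\<close>
  have "g0 ^ 8 * (b ^ 8 + b1 ^ 8) = g0 ^ 8 * 1"
    using weber_jacobi[OF t3] unfolding f[symmetric] fs by (simp add: power_mult_distrib distrib_left mult_ac)
  then have "p ^ 3 * z + (1 + p) ^ 3 * y = 1"
    using pos unfolding b8 b18 by simp
  then have "(1 + p + p\<^sup>2) * (y * (1 + 2 * p) - (1 - p)) = 0"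
    unfolding zy by algebra
  moreover have "1 + p + p\<^sup>2 \<noteq> 0"
    using pyz(1) by (simp add: add_pos_pos less_imp_neq[symmetric])
  ultimately have "y * (1 + 2 * p) - (1 - p) = 0"
    by (metis mult_eq_0_iff)
  then have y: "y = (1 - p) / (1 + 2 * p)"
    using pyz(1) by (simp add: field_simps)
  then have z: "z = (2 + p) / (1 + 2 * p)"
    unfolding zy using pyz(1) by (simp add: field_simps)
  have p1: "1 - p > 0"
    using pyz(1,2) unfolding y by (simp add: zero_less_divide_iff)
  have x24: "x ^ 24 = (x ^ 8) ^ 3" for x :: real
    by (simp flip: power_mult)
  have s24: "sqrt 2 ^ 8 = (16::real)"
    by (rule sqrt2_power8)
  \<comment> \<open>The constant product \<open>sqrt 2\<close> turns the 24th powers of the Weber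
    functions into functions of the moduli alone.\<close>
  have f24: "f0 ^ 24 * (a ^ 8 * a1 ^ 8) = 16" "g0 ^ 24 * (b ^ 8 * b1 ^ 8) = 16"
  proof -
    have "f0 ^ 24 * (a ^ 8 * a1 ^ 8) = (f0 * f1 * f2) ^ 8" "g0 ^ 24 * (b ^ 8 * b1 ^ 8) = (g0 * g1 * g2) ^ 8"
      unfolding fs by (simp_all add: power_mult_distrib flip: power_add)
    then show "f0 ^ 24 * (a ^ 8 * a1 ^ 8) = 16" "g0 ^ 24 * (b ^ 8 * b1 ^ 8) = 16"
      using weber_prod[OF t] weber_prod[OF t3] by (simp_all add: f s24)
  qed
  have F24: "f0 ^ 24 = 16 / (a ^ 8 * a1 ^ 8)" "g0 ^ 24 = 16 / (b ^ 8 * b1 ^ 8)"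
    using f24 abp by (simp_all add: field_simps)
  have alg: "A ^ 3 * (16 / (B * A)) = 16 * A\<^sup>2 / B" "A ^ 3 * (16 / (A * B)) = 16 * A\<^sup>2 / B" if "A \<noteq> 0" for A B :: real
    using that by (simp_all add: power2_eq_square power3_eq_cube)
  have f1_24: "f1 ^ 24 = 16 * (a1 ^ 8)\<^sup>2 / a ^ 8" "g1 ^ 24 = 16 * (b1 ^ 8)\<^sup>2 / b ^ 8"
    unfolding fs power_mult_distrib F24 unfolding x24 using abp by (intro alg; simp)+
  have f2_24: "f2 ^ 24 = 16 * (a ^ 8)\<^sup>2 / a1 ^ 8" "g2 ^ 24 = 16 * (b ^ 8)\<^sup>2 / b1 ^ 8"
    unfolding fs power_mult_distrib F24 unfolding x24 using abp by (intro alg; simp)+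
  have r: "r = f1 / g1" and U: "U = f1 * g1"
    by (simp_all add: r_def U_def f)
  define P where "P = 1 + p"
  have Pp: "P > 0"
    using pyz by (simp add: P_def)
  note ab8 = a8 a18[folded P_def] b8 b18[folded P_def]
  have "(U ^ 6) ^ 4 = (4 * P\<^sup>2 * y\<^sup>2 / (p * z)) ^ 4"
  proof -
    have "(U ^ 6) ^ 4 = f1 ^ 24 * g1 ^ 24"
      by (simp add: U power_mult_distrib)
    then show ?thesis
      unfolding f1_24 ab8 using pyz Pp by (simp add: field_simps eval_nat_numeral)
  qed
  then have U6: "U ^ 6 = 4 * P\<^sup>2 * y\<^sup>2 / (p * z)"
    by (rule pos_power_eq) (use pos pyz Pp in \<open>simp_all add: U\<close>)
  have "(r ^ 12)\<^sup>2 = (y\<^sup>2 * p / (z * P\<^sup>2))\<^sup>2"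
  proof -
    have "(r ^ 12)\<^sup>2 = f1 ^ 24 / g1 ^ 24"
      by (simp add: r power_divide)
    then show ?thesis
      unfolding f1_24 ab8 using pyz Pp by (simp add: field_simps eval_nat_numeral)
  qed
  then have r12: "r ^ 12 = y\<^sup>2 * p / (z * P\<^sup>2)"
    by (rule pos_power_eq) (use pos pyz Pp in \<open>simp_all add: r\<close>)
  \<comment> \<open>\<open>h\<close> is eliminated: the multiplier relation yields
    \<open>m * h ^ 4\<close>, while \<open>h ^ 12\<close> and \<open>r ^ 12\<close> are known, and
    together they determine \<open>K ^ 3 = (m * r) ^ 12\<close>.\<close>
  define h where "h = f2 / g2"
  have hp: "h > 0"
    using pos by (simp add: h_def)
  have "(h ^ 12)\<^sup>2 = (z\<^sup>2 * P / (p\<^sup>2 * y))\<^sup>2"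
  proof -
    have "(h ^ 12)\<^sup>2 = f2 ^ 24 / g2 ^ 24"
      by (simp add: h_def power_divide)
    then show ?thesis
      unfolding f2_24 ab8 using pyz Pp by (simp add: field_simps eval_nat_numeral)
  qed
  then have h12: "h ^ 12 = z\<^sup>2 * P / (p\<^sup>2 * y)"
    by (rule pos_power_eq) (use hp pyz Pp in \<open>simp_all\<close>)
  have mh: "m * h ^ 4 = (2 + p) / p"
  proof -
    have "1 + m * h ^ 4 = 2 * f2 * g1 ^ 3 / (f1 * g2 ^ 3)"
      using weber_degree_3(3)[OF t] by (simp add: f m_def h_def)
    also have "\<dots> = 2 * ((b1 ^ 3 / a1) / (b ^ 3 / a))"
      unfolding fs using pos abp by (simp add: field_simps)
    also have "\<dots> = 1 + (2 + p) / p"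
      unfolding b1p p_def[symmetric] using pyz by (simp add: field_simps)
    finally show ?thesis
      by simp
  qed
  have "K ^ 3 = ((2 + p) ^ 4 * y\<^sup>2 / (p * z ^ 3 * P\<^sup>2)) ^ 3"
  proof -
    have "K ^ 3 * (h ^ 12) ^ 4 = (m * h ^ 4) ^ 12 * r ^ 12"
    proof -
      have "K = (m * r) ^ 4"
        by (simp only: K_def m_def r_def)
      then show ?thesis
        by (simp add: power_mult_distrib)
    qed
    also have "\<dots> = ((2 + p) / p) ^ 12 * (y\<^sup>2 * p / (z * P\<^sup>2))"
      unfolding mh r12 ..
    also have "\<dots> = ((2 + p) ^ 4 * y\<^sup>2 / (p * z ^ 3 * P\<^sup>2)) ^ 3 * (h ^ 12) ^ 4"
    proof -
      define Q where "Q = (2 + p) ^ 4"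
      have "((2 + p) / p) ^ 12 = Q ^ 3 / p ^ 12"
        by (simp add: Q_def power_divide)
      then show ?thesis
        unfolding h12 Q_def[symmetric] using pyz Pp by (simp add: field_simps eval_nat_numeral)
    qed
    finally show ?thesis
      using hp by simp
  qed
  moreover have "0 \<le> K" "0 \<le> (2 + p) ^ 4 * y\<^sup>2 / (p * z ^ 3 * P\<^sup>2)"
    using pyz Pp pos by (simp_all add: K_def)
  ultimately have K: "K = (2 + p) ^ 4 * y\<^sup>2 / (p * z ^ 3 * P\<^sup>2)"
    by (rule power_eq_imp_eq_base) simp
  \<comment> \<open>\<open>X\<close> and \<open>v\<close> are unchanged when \<open>p\<close> is
    replaced by \<open>1 / p\<close>; in them \<open>r ^ 12\<close>, \<open>U ^ 6\<close> and
    \<open>K\<close> have low degree.\<close>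
  define X where "X = (1 - p)\<^sup>2 / ((1 + 2 * p) * (2 + p))"
  define v where "v = p / P\<^sup>2"
  have q: "1 + 2 * p > 0" "2 + p > 0"
    using pyz by simp_all
  have Xv: "X > 0" "v > 0"
    using pyz p1 Pp by (simp_all add: X_def v_def)
  have v2: "2 + v = (1 + 2 * p) * (2 + p) / P\<^sup>2" and v4: "1 - 4 * v = (1 - p)\<^sup>2 / P\<^sup>2"
    unfolding v_def using Pp by (simp_all add: field_simps) (simp_all add: P_def power2_eq_square algebra_simps)
  have rel: "X * (2 + v) = 1 - 4 * v"
    unfolding v2 v4 X_def using q by simp
  define D E N where "D = 1 + 2 * p" and "E = 2 + p" and "N = 1 - p"
  note DEN = D_def[symmetric] E_def[symmetric] N_def[symmetric]
  have DE: "D > 0" "E > 0"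
    using q by (simp_all add: D_def E_def)
  have R: "r ^ 12 = X * v"
    unfolding r12 y z X_def v_def DEN using DE Pp by (simp add: field_simps power2_eq_square)
  have U6': "U ^ 6 = 4 * X / v"
    unfolding U6 y z X_def v_def DEN using DE Pp pyz by (simp add: field_simps power2_eq_square)
  have K': "K = (2 + v)\<^sup>2 * X / v"
    unfolding K v2 unfolding y z X_def v_def DEN using DE Pp pyz by (simp add: field_simps eval_nat_numeral)
  show "r ^ 12 + 1 / r ^ 12 = U ^ 6 + 64 / U ^ 6 + 18" "K + 81 / K + 16 = r ^ 12 + 1 / r ^ 12"
    using degree_3_algebra[OF Xv rel] unfolding R U6' K' by simp_all
qed

section \<open>Bounds that single out the right roots\<close>

text \<open>The exponential and the product of the factors \<open>1 - q ^ (2 * n + 1)\<close> both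
  grow with the argument.\<close>

lemma weber1_strict_mono:
  assumes "0 < s" "s < t"
  shows "weber1 s < weber1 t"
proof -
  define q where "q = nome t"
  define r where "r = nome s"
  have q: "0 < q" "q < 1" and r: "0 < r" "r < 1" and le: "q \<le> r"
    using assms nome_bounds[of s] nome_bounds[of t] by (simp_all add: q_def r_def nome_def)
  have "w1 r \<le> w1 q"
    unfolding w1_def
  proof (rule LIMSEQ_le[OF qpoch_LIMSEQ qpoch_LIMSEQ])
    show "\<exists>N. \<forall>n\<ge>N. (\<Prod>k<n. 1 - r * (r\<^sup>2) ^ k) \<le> (\<Prod>k<n. 1 - q * (q\<^sup>2) ^ k)"
    proof (intro exI allI impI prod_mono conjI)
      fix k
      have "r * (r\<^sup>2) ^ k \<le> 1"
        using r by (intro mult_le_one power_le_one) auto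
      then show "0 \<le> 1 - r * (r\<^sup>2) ^ k"
        by simp
      have "q * (q\<^sup>2) ^ k \<le> r * (r\<^sup>2) ^ k"
        using q r le by (intro mult_mono power_mono) auto
      then show "1 - r * (r\<^sup>2) ^ k \<le> 1 - q * (q\<^sup>2) ^ k"
        by simp
    qed
  qed (use q_power_lt[OF q, of 2] q_power_lt[OF r, of 2] in auto)
  moreover have "exp (pi * s / 24) < exp (pi * t / 24)"
    using assms by simp
  ultimately show ?thesis
    unfolding weber1_def q_def[symmetric] r_def[symmetric]
    using w_pos(2)[OF r] by (intro mult_less_le_imp_less) auto
qed

lemma w0_bounds:
  assumes q: "0 < q" "q < 1"
  shows "1 \<le> w0 q" "w0 q \<le> exp (q / (1 - q\<^sup>2))"
proof -
  have lim: "(\<lambda>n. \<Prod>k<n. 1 - (- q) * (q\<^sup>2) ^ k) \<longlonglongrightarrow> w0 q"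
    unfolding w0_def using q_power_lt[OF q, of 2] by (intro qpoch_LIMSEQ) simp
  have q2: "0 < q\<^sup>2" "q\<^sup>2 < 1"
    using q q_power_lt[OF q, of 2] by simp_all
  show "1 \<le> w0 q"
    using q by (intro LIMSEQ_le_const[OF lim]) (auto intro!: prod_ge_1)
  show "w0 q \<le> exp (q / (1 - q\<^sup>2))"
  proof (rule LIMSEQ_le_const2[OF lim], intro exI allI impI)
    fix n
    have "(\<Prod>k<n. 1 - (- q) * (q\<^sup>2) ^ k) \<le> (\<Prod>k<n. exp (q * (q\<^sup>2) ^ k))"
      using q by (intro prod_mono conjI) (auto simp: exp_ge_add_one_self)
    also have "\<dots> = exp (q * (\<Sum>k<n. (q\<^sup>2) ^ k))"
      by (simp add: exp_sum sum_distrib_left)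
    also have "\<dots> \<le> exp (q * (1 / (1 - q\<^sup>2)))"
    proof -
      have "(\<Sum>k<n. (q\<^sup>2) ^ k) = (1 - (q\<^sup>2) ^ n) / (1 - q\<^sup>2)"
        using q2 by (subst sum_gp_strict) simp
      also have "\<dots> \<le> 1 / (1 - q\<^sup>2)"
        using q2 by (intro divide_right_mono) auto
      finally have "q * (\<Sum>k<n. (q\<^sup>2) ^ k) \<le> q * (1 / (1 - q\<^sup>2))"
        using q by (intro mult_left_mono) auto
      then show ?thesis
        by (simp only: exp_le_cancel_iff)
    qed
    finally show "(\<Prod>k<n. 1 - (- q) * (q\<^sup>2) ^ k) \<le> exp (q / (1 - q\<^sup>2))"
      by simp
  qed
qed

lemma exp_minus_3_le: "exp (- 3) \<le> (1 / 8 :: real)"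
proof -
  have "(2 :: real) ^ 3 \<le> exp 1 ^ 3"
    using exp_ge_add_one_self[of 1] by (intro power_mono) auto
  also have "\<dots> = exp 3"
    by (simp add: exp_of_nat_mult[symmetric])
  finally have "8 \<le> (exp 3 :: real)"
    by simp
  then show ?thesis
    by (simp add: exp_minus field_simps)
qed

text \<open>The exponential grows but the product \<open>w0\<close> shrinks, so a gap is demanded.
  For \<open>s >= 1\<close> the nome is at most 1/8, and the estimate works for gaps above 64/63.
  The constant 106/100 is above that and below \<open>u / 6\<close> for \<open>u >= 64 / 10\<close>,
  the smallest gap needed later.\<close>

lemma weber0_less:
  assumes "1 \<le> s" "s + 106 / 100 \<le> t"
  shows "weber0 s < weber0 t"
proof -
  define q where "q = nome s"
  have q: "0 < q" "q < 1"
    using assms nome_bounds[of s] by (simp_all add: q_def)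
  have "3 \<le> pi * s"
    using pi_gt3 assms mult_mono[of 3 pi 1 s] by simp
  then have "q \<le> exp (- 3)"
    by (simp add: q_def nome_def)
  then have q8: "q \<le> 1 / 8"
    using exp_minus_3_le by linarith
  have "q\<^sup>2 \<le> (1 / 8)\<^sup>2"
    using q q8 by (intro power_mono) auto
  then have "q / (1 - q\<^sup>2) \<le> (1 / 8) / (1 - (1 / 8)\<^sup>2)"
    using q q8 by (intro frac_le) (auto simp: power2_eq_square)
  also have "\<dots> < 3 * (106 / 100) / 24"
    by (simp add: power2_eq_square)
  also have "\<dots> \<le> pi * (t - s) / 24"
    using pi_gt3 assms mult_mono[of 3 pi "106 / 100" "t - s"] by simp
  also have "\<dots> = pi * t / 24 - pi * s / 24"
    by (simp add: right_diff_distrib diff_divide_distrib)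
  finally have *: "pi * s / 24 + q / (1 - q\<^sup>2) < pi * t / 24"
    by linarith
  have "weber0 s \<le> exp (pi * s / 24) * exp (q / (1 - q\<^sup>2))"
    unfolding weber0_def q_def[symmetric] using w0_bounds(2)[OF q] by (intro mult_left_mono) auto
  also have "\<dots> = exp (pi * s / 24 + q / (1 - q\<^sup>2))"
    by (simp add: exp_add)
  also have "\<dots> < exp (pi * t / 24)"
    using * by simp
  also have "\<dots> \<le> weber0 t"
    unfolding weber0_def using w0_bounds(1)[OF nome_bounds, of t] assms by simp
  finally show ?thesis .
qed

text \<open>The value 2/3 separates two effects: the product at \<open>t\<close> is at least 2/3,
  and tripling \<open>t\<close> multiplies the exponential prefactor by at most 2/3. It serves to
  bound \<open>r6 * r32\<close> from below.\<close>

lemma eta_triple_le: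
  assumes "1 \<le> t"
  shows "eta (3 * t) \<le> eta t"
proof -
  define x where "x = nome (2 * t)"
  define y where "y = nome (2 * (3 * t))"
  have x: "0 < x" "x < 1" and y: "0 < y" "y < 1"
    using assms nome_bounds[of "2 * t"] nome_bounds[of "2 * (3 * t)"] by (simp_all add: x_def y_def)
  have xy1: "\<bar>x\<bar> < 1" "\<bar>y\<bar> < 1"
    using x y by simp_all
  have t3: "3 \<le> pi * t"
    using pi_gt3 assms mult_mono[of 3 pi 1 t] by simp
  then have "x \<le> exp (- 3)"
    by (simp add: x_def nome_def)
  then have x8: "x \<le> 1 / 8"
    using exp_minus_3_le by linarith
  have "qpoch y y \<le> 1"
  proof (rule LIMSEQ_le_const2[OF qpoch_LIMSEQ[OF xy1(2)]], intro exI allI impI)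
    fix n
    have "y * y ^ k \<le> 1" for k
      using y by (intro mult_le_one power_le_one) auto
    then show "(\<Prod>k<n. 1 - y * y ^ k) \<le> 1"
      using y by (intro prod_le_1) auto
  qed
  moreover have "2 / 3 \<le> qpoch x x"
  proof (rule LIMSEQ_le_const[OF qpoch_LIMSEQ[OF xy1(1)]], intro exI allI impI)
    fix n
    have "(\<Sum>k<n. x ^ k) = (1 - x ^ n) / (1 - x)"
      using x by (subst sum_gp_strict) simp
    also have "\<dots> \<le> 1 / (1 - x)"
      using x by (intro divide_right_mono) auto
    finally have "x * (\<Sum>k<n. x ^ k) \<le> x * (1 / (1 - x))"
      using x by (intro mult_left_mono) auto
    also have "\<dots> \<le> 1 / 3"
      using x x8 by (simp add: field_simps)
    finally have "2 / 3 \<le> 1 - (\<Sum>k<n. x * x ^ k)"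
      by (simp add: sum_distrib_left)
    also have "\<dots> \<le> (\<Prod>k<n. 1 - x * x ^ k)"
    proof (rule Weierstrass_prod_ineq)
      fix k
      have "x * x ^ k \<le> 1"
        using x by (intro mult_le_one power_le_one) auto
      then show "x * x ^ k \<in> {0..1}"
        using x by simp
    qed
    finally show "2 / 3 \<le> (\<Prod>k<n. 1 - x * x ^ k)" .
  qed
  moreover have "exp (- pi * (3 * t) / 12) \<le> exp (- pi * t / 12) * (2 / 3)"
  proof -
    have "3 / 2 \<le> exp (1 / 2 :: real)"
      using exp_ge_add_one_self[of "1 / 2"] by simp
    also have "\<dots> \<le> exp (pi * t / 6)"
      using t3 by simp
    finally have "exp (- (pi * t / 6)) \<le> 2 / 3"
      by (simp add: exp_minus field_simps)
    then have "exp (- pi * t / 12) * exp (- (pi * t / 6)) \<le> exp (- pi * t / 12) * (2 / 3)"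
      by (intro mult_left_mono) auto
    moreover have "exp (- pi * (3 * t) / 12) = exp (- pi * t / 12) * exp (- (pi * t / 6))"
      by (simp add: exp_add[symmetric])
    ultimately show ?thesis
      by simp
  qed
  ultimately have "exp (- pi * (3 * t) / 12) * qpoch y y \<le> exp (- pi * t / 12) * (2 / 3) * 1"
    using qpoch_pos[of y y] y by (intro mult_mono) auto
  also have "\<dots> \<le> exp (- pi * t / 12) * qpoch x x"
    using \<open>2 / 3 \<le> qpoch x x\<close> by simp
  finally show ?thesis
    by (simp add: eta_def x_def y_def)
qed

section \<open>The evaluation\<close>

text \<open>The final equations all have this reciprocal form; a separate bound then excludes one of
  the two roots.\<close>

lemma add_inverse_inj:
  fixes x y :: real
  assumes "x + 1 / x = y + 1 / y" "x > 0" "y > 0"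
  shows "x = y \<or> x * y = 1"
proof -
  have "(x - y) * (x * y - 1) = 0"
    using assms by (simp add: field_simps)
  then show ?thesis
    by auto
qed

lemma add_inverse_square:
  fixes x :: real
  assumes "x \<noteq> 0"
  shows "x\<^sup>2 + 1 / x\<^sup>2 = (x + 1 / x)\<^sup>2 - 2"
  using assms by (simp add: field_simps power2_eq_square)

text \<open>Both equations are reciprocal and reduce to \<open>S = c ^ 2 + 1 / c ^ 2\<close> and
  \<open>T = V + 1 / V\<close>. The first expresses \<open>T\<close> by \<open>S ^ 2 - 9\<close>,
  and elimination leaves a polynomial of degree 8 in \<open>S\<close> with the root 5.\<close>

lemma modular_system:
  fixes c V :: real
  assumes c: "c > 0" and V: "V > 0"
    and 1: "c ^ 4 + 1 / c ^ 4 = sqrt 8 * (V + 1 / V) + 7"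
    and 2: "V ^ 4 + 1 / V ^ 4 = 8 * (c ^ 6 + 1 / c ^ 6) + 18"
  shows "c\<^sup>2 + 1 / c\<^sup>2 = 5" "V + 1 / V = 4 * sqrt 2"
proof -
  define S where "S = c\<^sup>2 + 1 / c\<^sup>2"
  define T where "T = V + 1 / V"
  have S2: "S \<ge> 2" and T2: "T \<ge> 2"
    using add_inverse_ge_2[of "c\<^sup>2"] add_inverse_ge_2[OF V] c by (simp_all add: S_def T_def)
  have c4: "c ^ 4 + 1 / c ^ 4 = S\<^sup>2 - 2"
    using add_inverse_square[of "c\<^sup>2"] c by (simp add: S_def flip: power_mult)
  have c6: "c ^ 6 + 1 / c ^ 6 = S ^ 3 - 3 * S"
  proof -
    have "x ^ 3 + 1 / x ^ 3 = (x + 1 / x) ^ 3 - 3 * (x + 1 / x)" if "x > 0" for x :: real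
      using that by (simp add: field_simps power3_eq_cube)
    from this[of "c\<^sup>2"] show ?thesis
      using c by (simp add: S_def flip: power_mult)
  qed
  have V4: "V ^ 4 + 1 / V ^ 4 = (T\<^sup>2 - 2)\<^sup>2 - 2"
    using add_inverse_square[of "V\<^sup>2"] add_inverse_square[of V] V by (simp add: T_def flip: power_mult)
  have e1: "S\<^sup>2 - 9 = sqrt 8 * T"
    using 1 c4 by (simp add: T_def)
  have e2: "(T\<^sup>2 - 2)\<^sup>2 = 8 * (S ^ 3 - 3 * S) + 20"
    using 2 unfolding V4 c6 by simp
  have "(S\<^sup>2 - 9)\<^sup>2 = 8 * T\<^sup>2"
    unfolding e1 by (simp add: power_mult_distrib)
  then have "((S\<^sup>2 - 9)\<^sup>2 - 16)\<^sup>2 = 64 * (T\<^sup>2 - 2)\<^sup>2"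
    by (simp add: power2_eq_square algebra_simps)
  then have "((S\<^sup>2 - 9)\<^sup>2 - 16)\<^sup>2 = 64 * (8 * (S ^ 3 - 3 * S) + 20)"
    unfolding e2 .
  \<comment> \<open>The second factor is positive for \<open>S ^ 2 \<ge> 14\<close>, which follows from \<open>T \<ge> 2\<close>.\<close>
  then have h: "(S - 5) * (S ^ 5 * (S\<^sup>2 - 11) + 5 * S ^ 4 * (S\<^sup>2 - 11) + S * (179 * S\<^sup>2 - 425) + (383 * S\<^sup>2 - 589)) = 0"
    by algebra
  \<comment> \<open>A lower bound sufficient for \<open>S ^ 2 >= 9 + 54 / 10\<close>, which exceeds
    14.\<close>
  have "sqrt 8 \<ge> 27 / 10"
    by (rule real_le_rsqrt) (simp add: power2_eq_square)
  then have "27 / 10 * 2 \<le> sqrt 8 * T"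
    using T2 by (intro mult_mono) auto
  then have S14: "S\<^sup>2 \<ge> 14"
    using e1 by linarith
  have "S ^ 5 * (S\<^sup>2 - 11) > 0" "5 * S ^ 4 * (S\<^sup>2 - 11) > 0" "S * (179 * S\<^sup>2 - 425) > 0"
    using S2 S14 by simp_all
  moreover have "383 * S\<^sup>2 - 589 > 0"
    using S14 by simp
  ultimately have "S ^ 5 * (S\<^sup>2 - 11) + 5 * S ^ 4 * (S\<^sup>2 - 11) + S * (179 * S\<^sup>2 - 425) + (383 * S\<^sup>2 - 589) > 0"
    by linarith
  then have S: "S = 5"
    using h by simp
  then show "c\<^sup>2 + 1 / c\<^sup>2 = 5"
    by (simp add: S_def)
  have "sqrt 8 = 2 * sqrt 2"
    using real_sqrt_mult[of 4 2] by simp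
  then have "sqrt 2 * T = 8"
    using e1 S by (simp add: mult.commute)
  then have "(sqrt 2 * sqrt 2) * T = sqrt 2 * 8"
    by (simp only: mult.assoc)
  then show "V + 1 / V = 4 * sqrt 2"
    by (simp add: T_def)
qed

lemma add_inverse_of_square:
  fixes x :: real
  assumes "x > 0" "x\<^sup>2 + 1 / x\<^sup>2 = y - 2"
  shows "x + 1 / x = sqrt y"
  using assms add_inverse_square[of x] by (intro real_sqrt_unique[symmetric]) auto

lemma sqrt_42_bounds:
  "sqrt 42 * sqrt 42 = (42 :: real)" "sqrt 42 \<ge> (64 / 10 :: real)"
proof -
  show "sqrt 42 \<ge> (64 / 10 :: real)"
    by (rule real_le_rsqrt) (simp add: power2_eq_square)
qed simp

text \<open>The assumptions only name quantities and are discharged by reflexivity at the end.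
  \<open>V\<close> rescales \<open>U ^ 3\<close> so that \<open>U ^ 3 + 8 / U ^ 3\<close> becomes
  \<open>sqrt 8 * (V + 1 / V)\<close>.\<close>

context
  fixes u U V c r6 r32 :: real
  assumes u_def: "u = sqrt 42"
    and U_def: "U = weber1 (u / 7) * weber1 u"
    and V_def: "V = U ^ 3 / sqrt 8"
    and c_def: "c = weber1 u / weber1 (u / 7)"
    and r6_def: "r6 = theta_r 7 6"
    and r32_def: "r32 = theta_r 7 (3 / 2)"
begin

lemma u_facts: "u > 0" "u * u = 42" "u \<ge> 64 / 10"
  using sqrt_42_bounds by (simp_all add: u_def)

lemma u_inversions: "2 / (u / 7) = u / 3" "1 / (u / 7) = u / 6" "2 / u = u / 21"
  using u_facts by (simp_all add: field_simps)

lemma sqrt_args: "sqrt (6 / 7) = u / 7" "sqrt (3 / 2 / 7) = u / 14"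
proof -
  show "sqrt (6 / 7) = u / 7"
    by (rule real_sqrt_unique) (use u_facts in \<open>simp_all add: power2_eq_square\<close>)
  show "sqrt (3 / 2 / 7) = u / 14"
    by (rule real_sqrt_unique) (use u_facts in \<open>simp_all add: power2_eq_square\<close>)
qed

lemma r6_eq: "r6 = eta (u / 7) / (7 powr (1/4) * eta u)"
  using theta_r_eq_eta[of 6] unfolding sqrt_args r6_def by simp

lemma r32_eq: "r32 = eta (u / 14) / (7 powr (1/4) * eta (u / 2))"
  using theta_r_eq_eta[of "3 / 2"] unfolding sqrt_args r32_def by simp

lemma eta_u_pos: "eta u > 0" "eta (u / 2) > 0" "eta (u / 3) > 0" "eta (u / 6) > 0" "eta (u / 7) > 0" "eta (u / 14) > 0"
  using u_facts by (auto intro!: eta_pos)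

lemma r_pos: "r6 > 0" "r32 > 0"
  unfolding r6_eq r32_eq using eta_u_pos by simp_all

lemma weber1_u_pos: "weber1 u > 0" "weber1 (u / 7) > 0" "weber1 (u / 3) > 0"
  using u_facts by (auto intro!: weber_pos)

lemma weber1_u3: "weber1 (u / 3) = sqrt 2 / weber1 (u / 7)"
  using weber1_half[of "u / 7"] u_facts weber1_u_pos unfolding u_inversions by (simp add: field_simps)

lemma U_pos: "U > 0" and c_pos: "c > 0" and V_pos: "V > 0"
  using weber1_u_pos by (simp_all add: U_def c_def V_def)

lemma c_gt_1: "c > 1"
  using weber1_strict_mono[of "u / 7" u] u_facts weber1_u_pos by (simp add: c_def)

lemma sqrt8: "sqrt 8 = 2 * sqrt 2"
  using real_sqrt_mult[of 4 2] by simp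

lemma V_gt_1: "V > 1"
proof -
  have "weber1 (u / 3) < weber1 u"
    using u_facts by (intro weber1_strict_mono) auto
  then have "sqrt 2 < U"
    unfolding weber1_u3 U_def using weber1_u_pos by (simp add: field_simps)
  then have "sqrt 2 ^ 3 < U ^ 3"
    by (intro power_strict_mono) auto
  then show ?thesis
    unfolding V_def sqrt8 by (simp add: eval_nat_numeral)
qed

text \<open>\<open>weber1 t\<close> is \<open>eta (t / 2) / eta t\<close>, and the eta arguments in
  \<open>r32\<close> are half those in \<open>r6\<close>.\<close>

lemma c_eq_ratio: "c = r6 / r32"
  unfolding c_def r6_eq r32_eq using weber1_eta[of u] weber1_eta[of "u / 7"] u_facts eta_u_pos
  by simp

lemma degree_7_at_u: "c ^ 4 + 1 / c ^ 4 = sqrt 8 * (V + 1 / V) + 7"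
proof -
  have "(1 / c) ^ 4 + 1 / (1 / c) ^ 4 = U ^ 3 + 8 / U ^ 3 + 7"
    using weber_degree_7_values(1)[of "u / 7"] u_facts by (simp add: c_def U_def)
  moreover have "sqrt 8 * (V + 1 / V) = U ^ 3 + 8 / U ^ 3"
    using U_pos by (simp add: V_def field_simps)
  ultimately show ?thesis
    by (simp add: power_divide)
qed

text \<open>At \<open>u / 3\<close> the product of the \<open>weber1\<close> values is
  \<open>sqrt 2 * c\<close> and their quotient is \<open>sqrt 2 / U\<close>, so the system closes
  without a new unknown. Two eta inversions turn the multiplier term into
  \<open>9 * (r6 * r32) ^ 4\<close>.\<close>

lemma degree_3_at_u:
  shows "V ^ 4 + 1 / V ^ 4 = 8 * (c ^ 6 + 1 / c ^ 6) + 18"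
    and "9 * ((r6 * r32) ^ 4 + 1 / (r6 * r32) ^ 4) + 16 = V ^ 4 + 1 / V ^ 4"
    and "r6 * r32 \<ge> 1 / sqrt 3"
proof -
  define r where "r = weber1 (u / 3) / weber1 u"
  have r: "r = sqrt 2 / U"
    using weber1_u_pos by (simp add: r_def weber1_u3 U_def)
  have s12: "sqrt 2 ^ 12 = (64 :: real)" "sqrt 8 ^ 4 = (64 :: real)" "sqrt 2 ^ 6 = (8 :: real)"
    using power_mult[of "sqrt 2" 2 6] power_mult[of "sqrt 8" 2 2] power_mult[of "sqrt 2" 2 3] by simp_all
  have r12: "r ^ 12 = 1 / V ^ 4"
    unfolding r V_def power_divide s12 using U_pos by simp
  have U3: "weber1 (u / 3) * weber1 u = sqrt 2 * c"
    by (simp add: weber1_u3 c_def)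
  have d3: "r ^ 12 + 1 / r ^ 12 = (sqrt 2 * c) ^ 6 + 64 / (sqrt 2 * c) ^ 6 + 18"
    using weber_degree_3_values(1)[of "u / 3"] u_facts unfolding U3[symmetric] r_def by simp
  then show "V ^ 4 + 1 / V ^ 4 = 8 * (c ^ 6 + 1 / c ^ 6) + 18"
    unfolding r12 power_mult_distrib s12 using c_pos by (simp add: add.commute)
  define K where "K = ((eta (u / 3) / eta u)\<^sup>2 * r) ^ 4"
  have K: "K + 81 / K + 16 = V ^ 4 + 1 / V ^ 4"
    using weber_degree_3_values(2)[of "u / 3"] u_facts by (simp add: K_def r_def[symmetric] r12 add.commute)
  have prod: "(eta (u / 3) / eta u)\<^sup>2 * r = (eta (u / 3) / eta u) * (eta (u / 6) / eta (u / 2))"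
    unfolding r_def using weber1_eta[of u] weber1_eta[of "u / 3"] u_facts eta_u_pos
    by (simp add: power2_eq_square)
  have e6: "eta (u / 6) = sqrt (u / 7) * eta (u / 7)"
    using eta_inversion[of "u / 7"] u_facts unfolding u_inversions by simp
  have e3: "eta (u / 3) = sqrt (u / 14) * eta (u / 14)"
  proof -
    have "1 / (u / 14) = u / 3"
      using u_inversions(1) by simp
    then show ?thesis
      using eta_inversion[of "u / 14"] u_facts by (simp only: zero_less_divide_iff) simp
  qed
  have s7: "(7 powr (1/4) :: real) * 7 powr (1/4) = sqrt 7"
    by (simp add: powr_add[symmetric] powr_half_sqrt)
  have s3: "sqrt (u / 14) * sqrt (u / 7) * sqrt 7 = sqrt 3"
  proof -
    have "u / 14 * (u / 7) * 7 = 3"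
      using u_facts by simp
    then show ?thesis
      by (simp only: real_sqrt_mult[symmetric])
  qed
  have "sqrt 3 * (r6 * r32) = sqrt (u / 14) * sqrt (u / 7) * sqrt 7 * (eta (u / 7) * eta (u / 14) / (sqrt 7 * (eta u * eta (u / 2))))"
    unfolding s3 unfolding r6_eq r32_eq s7[symmetric] by (simp add: mult_ac)
  also have "\<dots> = (eta (u / 3) / eta u) * (eta (u / 6) / eta (u / 2))"
    unfolding e3 e6 by simp
  finally have d: "sqrt 3 * (r6 * r32) = (eta (u / 3) / eta u) * (eta (u / 6) / eta (u / 2))" .
  have "sqrt 3 ^ 4 = (9 :: real)"
    using power_mult[of "sqrt 3" 2 2] by simp
  then have "K = 9 * (r6 * r32) ^ 4"
    unfolding K_def prod d[symmetric] by (simp add: power_mult_distrib)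
  then show "9 * ((r6 * r32) ^ 4 + 1 / (r6 * r32) ^ 4) + 16 = V ^ 4 + 1 / V ^ 4"
    using K by simp
  have "eta u \<le> eta (u / 3)" "eta (u / 2) \<le> eta (u / 6)"
    using eta_triple_le[of "u / 3"] eta_triple_le[of "u / 6"] u_facts by simp_all
  then have "1 * 1 \<le> (eta (u / 3) / eta u) * (eta (u / 6) / eta (u / 2))"
    using eta_u_pos by (intro mult_mono) simp_all
  then show "r6 * r32 \<ge> 1 / sqrt 3"
    unfolding d[symmetric] by (simp add: field_simps)
qed

lemma system_at_u: "c\<^sup>2 + 1 / c\<^sup>2 = 5" "V + 1 / V = 4 * sqrt 2"
  using modular_system[OF c_pos V_pos degree_7_at_u degree_3_at_u(1)] by simp_all

text \<open>The square of \<open>c + 1 / c\<close> is 5 + 2, and \<open>c > 1\<close> excludes the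
  reciprocal root.\<close>

lemma c_value: "c = (sqrt 7 + sqrt 3) / 2"
proof -
  define a where "a = (sqrt 7 + sqrt 3) / 2"
  have "(sqrt 7 + sqrt 3) * (sqrt 7 - sqrt 3) = 4"
    by (simp add: algebra_simps)
  moreover have "a > 0"
    by (simp add: a_def add_pos_pos)
  ultimately have a: "1 / a = (sqrt 7 - sqrt 3) / 2"
    by (simp add: a_def field_simps)
  have "c + 1 / c = sqrt 7"
    using system_at_u(1) c_pos by (intro add_inverse_of_square) auto
  also have "\<dots> = a + 1 / a"
    unfolding a by (simp add: a_def field_simps)
  finally have "c = a \<or> c * a = 1"
    using c_pos \<open>a > 0\<close> by (intro add_inverse_inj)
  moreover have "c * a > 1"
  proof -
    have "1 + 1 < sqrt 7 + sqrt 3"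
      by (rule add_strict_mono) simp_all
    then have "a > 1"
      by (simp add: a_def)
    then show ?thesis
      using c_gt_1 less_1_mult by blast
  qed
  ultimately show ?thesis
    by (simp add: a_def)
qed

lemma V_value: "V = 2 * sqrt 2 + sqrt 7"
proof -
  define a where "a = 2 * sqrt 2 + sqrt 7"
  have "(2 * sqrt 2 + sqrt 7) * (2 * sqrt 2 - sqrt 7) = 1"
    by (simp add: algebra_simps)
  moreover have "0 + 1 < 2 * sqrt 2 + sqrt 7"
    by (rule add_strict_mono) simp_all
  then have a1: "a > 1"
    by (simp add: a_def)
  ultimately have a: "1 / a = 2 * sqrt 2 - sqrt 7"
    by (simp add: a_def field_simps)
  have "V + 1 / V = a + 1 / a"
    unfolding a system_at_u by (simp add: a_def)
  then have "V = a \<or> V * a = 1"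
    using V_pos a1 by (intro add_inverse_inj) auto
  moreover have "V * a > 1"
    using V_gt_1 a1 less_1_mult by blast
  ultimately show ?thesis
    by (simp add: a_def)
qed

lemma U3_value: "U ^ 3 = 8 + 2 * sqrt 7 * sqrt 2"
proof -
  have "U ^ 3 = 2 * sqrt 2 * V"
    by (simp add: V_def sqrt8)
  then show ?thesis
    unfolding V_value by (simp add: algebra_simps)
qed

text \<open>For \<open>V\<close> the reciprocal sums of powers 1, 2, 4 are
  \<open>4 * sqrt 2\<close>, 30, 898. Then \<open>(898 - 16) / 9 = 98\<close>, and for the product
  the sums of powers 4, 2, 1 descend as 98, 10, \<open>sqrt 12\<close>.\<close>

lemma r_product: "r6 * r32 = sqrt 3 + sqrt 2"
proof -
  define d where "d = r6 * r32"
  have dp: "d > 0"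
    using r_pos by (simp add: d_def)
  have "V\<^sup>2 + 1 / V\<^sup>2 = 30"
    using add_inverse_square[of V] V_pos system_at_u(2) by (simp add: power_mult_distrib)
  then have "V ^ 4 + 1 / V ^ 4 = 898"
    using add_inverse_square[of "V\<^sup>2"] V_pos by (simp flip: power_mult)
  then have "d ^ 4 + 1 / d ^ 4 = 98"
    using degree_3_at_u(2) by (simp add: d_def)
  then have "(d\<^sup>2)\<^sup>2 + 1 / (d\<^sup>2)\<^sup>2 = 100 - 2"
    by (simp flip: power_mult)
  then have "d\<^sup>2 + 1 / d\<^sup>2 = sqrt 100"
    using dp by (intro add_inverse_of_square) auto
  also have "sqrt 100 = (10 :: real)"
    by (rule real_sqrt_unique) simp_all
  finally have "d\<^sup>2 + 1 / d\<^sup>2 = 12 - 2"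
    by simp
  then have "d + 1 / d = sqrt 12"
    using dp by (intro add_inverse_of_square) auto
  also have "sqrt 12 = 2 * sqrt 3"
    using real_sqrt_mult[of 4 3] by simp
  also have "\<dots> = (sqrt 3 + sqrt 2) + 1 / (sqrt 3 + sqrt 2)"
  proof -
    have "(sqrt 3 + sqrt 2) * (sqrt 3 - sqrt 2) = 1"
      by (simp add: algebra_simps)
    moreover have "sqrt 3 + sqrt 2 \<noteq> 0"
      by (simp add: add_pos_pos less_imp_neq[symmetric])
    ultimately have "1 / (sqrt 3 + sqrt 2) = sqrt 3 - sqrt 2"
      by (simp only: divide_eq_eq mult.commute if_False) simp
    then show ?thesis
      by simp
  qed
  finally have "d = sqrt 3 + sqrt 2 \<or> d * (sqrt 3 + sqrt 2) = 1"
    using dp by (intro add_inverse_inj) (auto intro: add_pos_pos)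
  \<comment> \<open>The bound \<open>d >= 1 / sqrt 3\<close> suffices to exclude the reciprocal
    root, as \<open>(sqrt 3 + sqrt 2) / sqrt 3\<close> exceeds 1.\<close>
  moreover have "d * (sqrt 3 + sqrt 2) > 1"
  proof -
    have "1 / sqrt 3 * (sqrt 3 + sqrt 2) \<le> d * (sqrt 3 + sqrt 2)"
      using degree_3_at_u(3) by (intro mult_right_mono) (auto simp: d_def)
    moreover have "1 / sqrt 3 * (sqrt 3 + sqrt 2) > 1"
      by (simp add: field_simps)
    ultimately show ?thesis
      by linarith
  qed
  ultimately show ?thesis
    by (simp add: d_def)
qed

lemma r6_square: "r6\<^sup>2 = (sqrt 7 + sqrt 3) * (sqrt 3 + sqrt 2) / 2"
proof -
  have "r6\<^sup>2 = c * (r6 * r32)"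
    using r_pos by (simp add: c_eq_ratio power2_eq_square)
  then show ?thesis
    unfolding r_product c_value by simp
qed

lemma r32_square: "r32\<^sup>2 = (sqrt 7 - sqrt 3) * (sqrt 3 + sqrt 2) / 2"
proof -
  have "r32\<^sup>2 = (r6 * r32) * (1 / c)"
    using r_pos by (simp add: c_eq_ratio power2_eq_square)
  moreover have "1 / c = (sqrt 7 - sqrt 3) / 2"
  proof -
    have "c * ((sqrt 7 - sqrt 3) / 2) = 1"
      unfolding c_value by (simp add: algebra_simps)
    then show ?thesis
      using c_pos by (simp add: field_simps)
  qed
  ultimately show ?thesis
    unfolding r_product by (simp only: times_divide_eq_right mult.commute)
qed

text \<open>The values of \<open>F\<close> follow from \<open>U ^ 3\<close> by quadratic equations.
  The two cases are conjugate under \<open>sqrt 2\<close> to \<open>- sqrt 2\<close>, so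
  \<open>num1\<close> and \<open>num2\<close> are stated for any \<open>b\<close> with square 2 and
  used with both signs.\<close>

lemma weber0_ratio_u:
  shows "((weber0 (u / 7) / weber0 u) ^ 4 + 1 / (weber0 (u / 7) / weber0 u) ^ 4)\<^sup>2
      = (35 * sqrt 7 - 84 - 21 * (sqrt 7 * sqrt 2) + 60 * sqrt 2)\<^sup>2"
    and "((weber0 (u / 14) / weber0 (u / 2)) ^ 4 + 1 / (weber0 (u / 14) / weber0 (u / 2)) ^ 4)\<^sup>2
      = (35 * sqrt 7 - 84 + 21 * (sqrt 7 * sqrt 2) - 60 * sqrt 2)\<^sup>2"
proof -
  define a b :: real where ab: "a = sqrt 7" "b = sqrt 2"
  have a2: "a * a = 7" "b * b = 2" "a > 0" "b > 0" "b < a"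
    by (simp_all add: ab)
  have z: "a * a - 7 = 0" "b * b - 2 = 0"
    using a2 by simp_all
  have num1: "(8 + 2 * a * b) * (1 + a - b) ^ 3 = 8 * (7 + 3 * a + 2 * b + a * b)" if "b * b - 2 = 0" for b
    using z(1) that by algebra
  have num2: "(7 + 3 * a + 2 * b + a * b) * (- 84 + 32 * a + 58 * b - 22 * (a * b)) = 8" if "b * b - 2 = 0" for b
    using z(1) that by algebra
  have U3: "U ^ 3 = 8 + 2 * a * b"
    unfolding U3_value ab ..
  have pos: "weber0 (u / 7) > 0" "weber0 u > 0" "weber2 (u / 7) > 0" "weber2 u > 0"
      "weber0 (u / 14) > 0" "weber0 (u / 2) > 0" "weber1 (u / 14) > 0" "weber1 (u / 2) > 0"
    using u_facts by (auto intro!: weber_pos)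
  define F where "F = weber0 (u / 7) * weber0 u"
  define Y where "Y = weber2 (u / 7) * weber2 u"
  have FUY: "F = U + Y"
    using weber_degree_7[of "u / 7"] u_facts by (simp add: F_def U_def Y_def)
  have "F * U * Y = (weber0 (u / 7) * weber1 (u / 7) * weber2 (u / 7)) * (weber0 u * weber1 u * weber2 u)"
    by (simp add: F_def U_def Y_def)
  also have "\<dots> = 2"
    using weber_prod[of "u / 7"] weber_prod[of u] u_facts by simp
  finally have prod: "F * U * Y = 2" .
  have p: "F > 0" "Y > 0"
    using pos by (simp_all add: F_def Y_def)
  define x where "x = F / U"
  have F: "F = U * x"
    using U_pos by (simp add: x_def)
  \<comment> \<open>Multiplication by the conjugate \<open>8 - 2 * a * b\<close>, where the norm is
    8, gives \<open>4 * x * (x - 1) = 8 - 2 * a * b\<close>; completing the square leaves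
    \<open>9 - 2 * a * b\<close>.\<close>
  have "(2 * x - 1)\<^sup>2 = (a - b)\<^sup>2"
  proof -
    have "(8 + 2 * a * b) * (x * (x - 1)) = 2"
    proof -
      have Y: "Y = U * (x - 1)"
        using FUY by (simp add: F right_diff_distrib)
      have "F * U * Y = U ^ 3 * (x * (x - 1))"
        unfolding F Y by (simp add: eval_nat_numeral)
      then show ?thesis
        using prod U3 by simp
    qed
    then have "(8 - 2 * a * b) * ((8 + 2 * a * b) * (x * (x - 1))) = (8 - 2 * a * b) * 2"
      by simp
    then show ?thesis
      using z by algebra
  qed
  moreover have "0 \<le> 2 * x - 1" "0 \<le> a - b"
    using FUY p U_pos a2 by (simp_all add: x_def field_simps)
  ultimately have "2 * x - 1 = a - b"
    by (rule power2_eq_imp_eq)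
  then have x: "x = (1 + a - b) / 2"
    by simp
  have F3: "F ^ 3 = 7 + 3 * a + 2 * b + a * b"
  proof -
    have "F ^ 3 = (8 + 2 * a * b) * (1 + a - b) ^ 3 / 8"
      unfolding F power_mult_distrib U3 x by (simp add: power_divide)
    then show ?thesis
      unfolding num1[OF z(2)] by simp
  qed
  have F3': "8 / F ^ 3 = - 84 + 32 * a + 58 * b - 22 * (a * b)"
  proof -
    have "F ^ 3 * (- 84 + 32 * a + 58 * b - 22 * (a * b)) = 8"
      unfolding F3 by (rule num2[OF z(2)])
    then show ?thesis
      using p by (metis less_imp_neq nonzero_mult_div_cancel_left zero_less_power)
  qed
  have "((weber0 (u / 7) / weber0 u) ^ 4 + 1 / (weber0 (u / 7) / weber0 u) ^ 4)\<^sup>2 = (F ^ 3 + 8 / F ^ 3 - 7)\<^sup>2"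
    using weber_degree_7_values(2)[of "u / 7"] u_facts by (simp add: F_def)
  also have "F ^ 3 + 8 / F ^ 3 - 7 = 35 * sqrt 7 - 84 - 21 * (sqrt 7 * sqrt 2) + 60 * sqrt 2"
    unfolding F3' unfolding F3 unfolding ab by simp
  finally show "((weber0 (u / 7) / weber0 u) ^ 4 + 1 / (weber0 (u / 7) / weber0 u) ^ 4)\<^sup>2
      = (35 * sqrt 7 - 84 - 21 * (sqrt 7 * sqrt 2) + 60 * sqrt 2)\<^sup>2" .
  define F' where "F' = weber0 (u / 14) * weber0 (u / 2)"
  define U' where "U' = weber1 (u / 14) * weber1 (u / 2)"
  define Y' where "Y' = weber2 (u / 14) * weber2 (u / 2)"
  have FUY': "F' = U' + Y'"
    using weber_degree_7[of "u / 14"] u_facts by (simp add: F'_def U'_def Y'_def)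
  have "F' * U' * Y' = (weber0 (u / 14) * weber1 (u / 14) * weber2 (u / 14)) * (weber0 (u / 2) * weber1 (u / 2) * weber2 (u / 2))"
    by (simp add: F'_def U'_def Y'_def)
  also have "\<dots> = 2"
    using weber_prod[of "u / 14"] weber_prod[of "u / 2"] u_facts by simp
  finally have prod': "F' * U' * Y' = 2" .
  have p': "F' > 0" "U' > 0"
    using pos by (simp_all add: F'_def U'_def)
  \<comment> \<open>\<open>weber2 (t / 2) * weber1 t = sqrt 2\<close> links the arguments
    \<open>u / 14\<close>, \<open>u / 2\<close> to \<open>u / 7\<close>, \<open>u\<close>, so the
    known \<open>U\<close> can be reused.\<close>
  have Y': "Y' * U = 2"
  proof -
    have w: "weber2 (t / 2) * weber1 t = sqrt 2" if "t > 0" for t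
      using weber_inversion(1)[of "t / 2"] weber1_half[of t] that by simp
    have "Y' * U = (weber2 (u / 7 / 2) * weber1 (u / 7)) * (weber2 (u / 2) * weber1 u)"
      by (simp add: Y'_def U_def)
    then show ?thesis
      using w[of "u / 7"] w[of u] u_facts by simp
  qed
  define x' where "x' = F' * U"
  \<comment> \<open>Here \<open>x' * (x' - 2) = U ^ 3\<close>, hence the completed square is
    \<open>9 + 2 * a * b\<close>.\<close>
  have "(x' - 1)\<^sup>2 = (a + b)\<^sup>2"
  proof -
    have "F' * U' = U"
      using prod' Y' U_pos p' by (metis mult.commute mult_left_cancel mult_zero_left zero_neq_numeral)
    then have U: "F' * (F' - Y') = U"
      using FUY' by simp
    have "x' * x' - x' * (Y' * U) = (F' * (F' - Y')) * (U * U)"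
      by (simp add: x'_def algebra_simps)
    then have "x' * x' - x' * (Y' * U) = U ^ 3"
      unfolding U by (simp add: eval_nat_numeral)
    then show ?thesis
      unfolding Y' U3 using z by algebra
  qed
  moreover have "0 \<le> x' - 1" "0 \<le> a + b"
  proof -
    have "Y' * U \<le> F' * U"
      using FUY' p' U_pos by simp
    then show "0 \<le> x' - 1"
      unfolding Y' x'_def by simp
    show "0 \<le> a + b"
      using a2 by simp
  qed
  ultimately have "x' - 1 = a + b"
    by (rule power2_eq_imp_eq)
  then have x': "x' = 1 + a - (- b)"
    by simp
  have mb: "(- b) * (- b) - 2 = 0"
    using a2 by simp
  have G3: "F' ^ 3 = 7 + 3 * a + 2 * (- b) + a * (- b)"
  proof -
    have "(8 + 2 * a * b) * F' ^ 3 = (1 + a - (- b)) ^ 3"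
      unfolding x'[symmetric] x'_def power_mult_distrib U3 by simp
    then have "(8 + 2 * a * (- b)) * ((8 + 2 * a * b) * F' ^ 3) = 8 * (7 + 3 * a + 2 * (- b) + a * (- b))"
      using num1[OF mb] by simp
    moreover have "(8 + 2 * a * (- b)) * (8 + 2 * a * b) = 8"
      using z by algebra
    ultimately show ?thesis
      by (simp only: mult.assoc[symmetric]) simp
  qed
  have G3': "8 / F' ^ 3 = - 84 + 32 * a + 58 * (- b) - 22 * (a * (- b))"
  proof -
    have "F' ^ 3 * (- 84 + 32 * a + 58 * (- b) - 22 * (a * (- b))) = 8"
      unfolding G3 by (rule num2[OF mb])
    then show ?thesis
      using p' by (metis less_imp_neq nonzero_mult_div_cancel_left zero_less_power)
  qed
  have "((weber0 (u / 14) / weber0 (u / 2)) ^ 4 + 1 / (weber0 (u / 14) / weber0 (u / 2)) ^ 4)\<^sup>2 = (F' ^ 3 + 8 / F' ^ 3 - 7)\<^sup>2"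
    using weber_degree_7_values(2)[of "u / 14"] u_facts by (simp add: F'_def)
  also have "F' ^ 3 + 8 / F' ^ 3 - 7 = 35 * sqrt 7 - 84 + 21 * (sqrt 7 * sqrt 2) - 60 * sqrt 2"
    unfolding G3' unfolding G3 unfolding ab by simp
  finally show "((weber0 (u / 14) / weber0 (u / 2)) ^ 4 + 1 / (weber0 (u / 14) / weber0 (u / 2)) ^ 4)\<^sup>2
      = (35 * sqrt 7 - 84 + 21 * (sqrt 7 * sqrt 2) - 60 * sqrt 2)\<^sup>2" .
qed

text \<open>Inversion moves \<open>u / 7\<close> and \<open>u / 14\<close> to \<open>u / 6\<close>
  and \<open>u / 3\<close>, which are at least 1, so that \<open>weber0_less\<close>
  applies.\<close>

lemma weber0_ratio_less_1: "weber0 (u / 7) / weber0 u < 1" "weber0 (u / 14) / weber0 (u / 2) < 1"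
proof -
  have "weber0 (u / 6) < weber0 u" "weber0 (u / 3) < weber0 (u / 2)"
    using u_facts by (intro weber0_less; simp)+
  moreover have "weber0 (u / 6) = weber0 (u / 7)"
    using weber_inversion(3)[of "u / 7"] u_facts unfolding u_inversions by simp
  moreover have "weber0 (u / 3) = weber0 (u / 14)"
  proof -
    have "1 / (u / 14) = u / 3"
      using u_inversions(1) by simp
    then show ?thesis
      using weber_inversion(3)[of "u / 14"] u_facts by (simp only: zero_less_divide_iff) simp
  qed
  moreover have "weber0 u > 0" "weber0 (u / 2) > 0"
    using u_facts by (auto intro!: weber_pos)
  ultimately show "weber0 (u / 7) / weber0 u < 1" "weber0 (u / 14) / weber0 (u / 2) < 1"
    by simp_all
qed

lemma root_selection:
  fixes m n n' :: real
  assumes "m > 0" "m < 1" "n > 0" "n < 1" "n * n' = 1" "(m + 1 / m)\<^sup>2 = (n + n')\<^sup>2"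
  shows "m = n"
proof -
  have n': "n' = 1 / n"
    using assms by (simp add: field_simps)
  have "m + 1 / m = n + 1 / n"
    by (rule power2_eq_imp_eq) (use assms in \<open>simp_all add: n'\<close>)
  then have "m = n \<or> m * n = 1"
    using assms by (intro add_inverse_inj)
  moreover have "m * n < 1"
    using assms mult_strict_mono[of m 1 n 1] by simp
  ultimately show ?thesis
    by simp
qed

text \<open>The claimed value and its conjugate under \<open>sqrt 3\<close> to
  \<open>- sqrt 3\<close> have product 1 (\<open>norm\<close>), and their sum (\<open>trace\<close>)
  is the quantity squared in \<open>weber0_ratio_u\<close>. Both the fourth power of the ratio and
  the claimed value lie below 1, so they agree.\<close>

lemma weber0_ratio_value:
  shows "(weber0 (u / 7) / weber0 u) ^ 4 = (5 + sqrt 21) / 2 * (2 - sqrt 3)\<^sup>2 * (sqrt 7 - sqrt 6)"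
    and "(weber0 (u / 14) / weber0 (u / 2)) ^ 4 = (5 - sqrt 21) / 2 * (2 + sqrt 3)\<^sup>2 * (sqrt 7 - sqrt 6)"
proof -
  define a b e :: real where abe: "a = sqrt 7" "b = sqrt 2" "e = sqrt 3"
  have sq: "a * a = 7" "b * b = 2" "e * e = 3"
    by (simp_all add: abe)
  have z: "a * a - 7 = 0" "b * b - 2 = 0" "e * e - 3 = 0"
    using sq by simp_all
  have s: "sqrt 21 = a * e" "sqrt 6 = e * b"
    using real_sqrt_mult[of 7 3] real_sqrt_mult[of 3 2] by (simp_all add: abe)
  have norm: "((5 + a * e) / 2 * (2 - e)\<^sup>2 * (a - e * b)) * ((5 - a * e) / 2 * (2 + e)\<^sup>2 * (a + e * b)) = 1"
    "((5 - a * e) / 2 * (2 + e)\<^sup>2 * (a - e * b)) * ((5 + a * e) / 2 * (2 - e)\<^sup>2 * (a + e * b)) = 1"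
  proof -
    have "(5 + a * e) * (5 - a * e) = 4"
      using z by algebra
    moreover have "(2 - e) * (2 + e) = 1"
      using z by algebra
    moreover have "(a - e * b) * (a + e * b) = 1"
      using z by algebra
    ultimately have "((5 + a * e) * (5 - a * e)) / 4 * ((2 - e) * (2 + e))\<^sup>2 * ((a - e * b) * (a + e * b)) = 1"
      by simp
    then show "((5 + a * e) / 2 * (2 - e)\<^sup>2 * (a - e * b)) * ((5 - a * e) / 2 * (2 + e)\<^sup>2 * (a + e * b)) = 1"
      "((5 - a * e) / 2 * (2 + e)\<^sup>2 * (a - e * b)) * ((5 + a * e) / 2 * (2 - e)\<^sup>2 * (a + e * b)) = 1"
      by (simp_all add: power_mult_distrib mult_ac)
  qed
  have "(5 + a * e) * (2 - e)\<^sup>2 * (a - e * b) + (5 - a * e) * (2 + e)\<^sup>2 * (a + e * b) = 2 * (35 * a - 84 - 21 * (a * b) + 60 * b)"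
    using z by algebra
  moreover have "(5 - a * e) * (2 + e)\<^sup>2 * (a - e * b) + (5 + a * e) * (2 - e)\<^sup>2 * (a + e * b) = 2 * (35 * a - 84 + 21 * (a * b) - 60 * b)"
    using z by algebra
  ultimately have trace: "(5 + a * e) / 2 * (2 - e)\<^sup>2 * (a - e * b) + (5 - a * e) / 2 * (2 + e)\<^sup>2 * (a + e * b) = 35 * a - 84 - 21 * (a * b) + 60 * b"
    "(5 - a * e) / 2 * (2 + e)\<^sup>2 * (a - e * b) + (5 + a * e) / 2 * (2 - e)\<^sup>2 * (a + e * b) = 35 * a - 84 + 21 * (a * b) - 60 * b"
    by simp_all
  \<comment> \<open>Rational bounds on the surds for \<open>less1\<close> and \<open>less2\<close>;
    the second product is at most the square of \<open>0.21 * 3.74\<close>, which is below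
    1.\<close>
  have a_b: "a \<le> 265 / 100"
    unfolding abe by (rule real_le_lsqrt) (simp_all add: power2_eq_square)
  have e_b: "17 / 10 \<le> e" "e \<le> 174 / 100"
    unfolding abe by (rule real_le_rsqrt real_le_lsqrt; simp add: power2_eq_square)+
  have ae_b: "458 / 100 \<le> a * e" "a * e \<le> 459 / 100"
    unfolding s[symmetric] by (rule real_le_rsqrt real_le_lsqrt; simp add: power2_eq_square)+
  have eb_b: "244 / 100 \<le> e * b" "e * b < a"
  proof -
    show "244 / 100 \<le> e * b"
      unfolding s[symmetric] by (rule real_le_rsqrt) (simp add: power2_eq_square)
    show "e * b < a"
      unfolding s(2)[symmetric] unfolding abe by simp
  qed
  have bounds: "0 < (5 + a * e) / 2" "(5 + a * e) / 2 \<le> 5" "0 < (5 - a * e) / 2" "(5 - a * e) / 2 \<le> 21 / 100"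
     "0 < a - e * b" "a - e * b \<le> 21 / 100"
    using a_b ae_b eb_b by simp_all
  have sqs: "0 < (2 - e)\<^sup>2" "(2 - e)\<^sup>2 \<le> (3 / 10)\<^sup>2" "0 < (2 + e)\<^sup>2" "(2 + e)\<^sup>2 \<le> (374 / 100)\<^sup>2"
  proof -
    show "(2 - e)\<^sup>2 \<le> (3 / 10)\<^sup>2" "(2 + e)\<^sup>2 \<le> (374 / 100)\<^sup>2"
      using e_b by (intro power_mono; simp)+
    show "0 < (2 - e)\<^sup>2" "0 < (2 + e)\<^sup>2"
      using e_b by simp_all
  qed
  have pos: "0 < (5 + a * e) / 2 * (2 - e)\<^sup>2 * (a - e * b)" "0 < (5 - a * e) / 2 * (2 + e)\<^sup>2 * (a - e * b)"
    by (intro mult_pos_pos bounds sqs)+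
  have less1: "(5 + a * e) / 2 * (2 - e)\<^sup>2 * (a - e * b) < 1"
  proof -
    have "(5 + a * e) / 2 * (2 - e)\<^sup>2 * (a - e * b) \<le> 5 * (3 / 10)\<^sup>2 * (21 / 100)"
      using bounds sqs by (intro mult_mono mult_nonneg_nonneg) (simp_all add: less_imp_le)
    also have "\<dots> < 1"
      by (simp add: power2_eq_square)
    finally show ?thesis .
  qed
  have less2: "(5 - a * e) / 2 * (2 + e)\<^sup>2 * (a - e * b) < 1"
  proof -
    have "(5 - a * e) / 2 * (2 + e)\<^sup>2 * (a - e * b) \<le> 21 / 100 * (374 / 100)\<^sup>2 * (21 / 100)"
      using bounds sqs by (intro mult_mono mult_nonneg_nonneg) (simp_all add: less_imp_le)
    also have "\<dots> < 1"
      by (simp add: power2_eq_square)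
    finally show ?thesis .
  qed
  have wpos: "weber0 (u / 7) / weber0 u > 0" "weber0 (u / 14) / weber0 (u / 2) > 0"
    using u_facts by (auto intro!: divide_pos_pos weber_pos)
  have m: "0 < (weber0 (u / 7) / weber0 u) ^ 4" "(weber0 (u / 7) / weber0 u) ^ 4 < 1"
    "0 < (weber0 (u / 14) / weber0 (u / 2)) ^ 4" "(weber0 (u / 14) / weber0 (u / 2)) ^ 4 < 1"
    using wpos weber0_ratio_less_1 by (simp_all only: zero_less_power power_less_one_iff less_imp_le zero_less_numeral simp_thms)
  note R = weber0_ratio_u[folded abe]
  show "(weber0 (u / 7) / weber0 u) ^ 4 = (5 + sqrt 21) / 2 * (2 - sqrt 3)\<^sup>2 * (sqrt 7 - sqrt 6)"
    unfolding s abe[symmetric]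
    by (rule root_selection[OF m(1,2) pos(1) less1 norm(1)]) (use R(1) in \<open>simp only: trace\<close>)
  show "(weber0 (u / 14) / weber0 (u / 2)) ^ 4 = (5 - sqrt 21) / 2 * (2 + sqrt 3)\<^sup>2 * (sqrt 7 - sqrt 6)"
    unfolding s abe[symmetric]
    by (rule root_selection[OF m(3,4) pos(2) less2 norm(2)]) (use R(2) in \<open>simp only: trace\<close>)
qed

text \<open>The fourth power is taken because closed forms are at hand for \<open>r6 ^ 2\<close>,
  \<open>r32 ^ 2\<close> and the fourth powers of the \<open>weber0\<close> ratios.\<close>

lemma r'_power4:
  shows "theta_r' 7 6 ^ 4 = 1 / 4 * (5 + sqrt 21)\<^sup>2 * (2 - sqrt 3)\<^sup>2 * (sqrt 7 - sqrt 6) * (5 + 2 * sqrt 6)"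
    and "theta_r' 7 (3 / 2) ^ 4 = 1 / 4 * (5 - sqrt 21)\<^sup>2 * (2 + sqrt 3)\<^sup>2 * (sqrt 7 - sqrt 6) * (5 + 2 * sqrt 6)"
    and "theta_r' 7 6 > 0" "theta_r' 7 (3 / 2) > 0"
proof -
  define a b e :: real where abe: "a = sqrt 7" "b = sqrt 2" "e = sqrt 3"
  have sq: "a * a = 7" "b * b = 2" "e * e = 3"
    by (simp_all add: abe)
  have s: "sqrt 21 = a * e" "sqrt 6 = e * b"
    using real_sqrt_mult[of 7 3] real_sqrt_mult[of 3 2] by (simp_all add: abe)
  have r': "theta_r' 7 6 = r6 * (weber0 (u / 7) / weber0 u)" "theta_r' 7 (3 / 2) = r32 * (weber0 (u / 14) / weber0 (u / 2))"
    using theta_r'_eq_eta[of 6] theta_r'_eq_eta[of "3 / 2"] unfolding sqrt_args r6_def r32_def by simp_all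
  show "theta_r' 7 6 > 0" "theta_r' 7 (3 / 2) > 0"
    unfolding r' using u_facts r_pos by (auto intro!: mult_pos_pos divide_pos_pos weber_pos)
  have q: "(r * w) ^ 4 = (r\<^sup>2)\<^sup>2 * w ^ 4" for r w :: real
    by (simp add: power_mult_distrib)
  have sqs: "(a + e)\<^sup>2 = 2 * (5 + a * e)" "(a - e)\<^sup>2 = 2 * (5 - a * e)" "(e + b)\<^sup>2 = 5 + 2 * (e * b)"
    using sq by (simp_all add: power2_eq_square algebra_simps)
  show "theta_r' 7 6 ^ 4 = 1 / 4 * (5 + sqrt 21)\<^sup>2 * (2 - sqrt 3)\<^sup>2 * (sqrt 7 - sqrt 6) * (5 + 2 * sqrt 6)"
  proof -
    have "theta_r' 7 6 ^ 4 = ((a + e) * (e + b) / 2)\<^sup>2 * ((5 + a * e) / 2 * (2 - e)\<^sup>2 * (a - e * b))"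
      unfolding r' q r6_square weber0_ratio_value s abe ..
    also have "\<dots> = (a + e)\<^sup>2 * (e + b)\<^sup>2 / 4 * ((5 + a * e) / 2 * (2 - e)\<^sup>2 * (a - e * b))"
      by (simp add: power_divide power_mult_distrib)
    also have "\<dots> = 1 / 4 * (5 + a * e)\<^sup>2 * (2 - e)\<^sup>2 * (a - e * b) * (5 + 2 * (e * b))"
      unfolding sqs power2_eq_square[of "5 + a * e"] by (simp add: mult_ac)
    finally show ?thesis
      unfolding s abe .
  qed
  show "theta_r' 7 (3 / 2) ^ 4 = 1 / 4 * (5 - sqrt 21)\<^sup>2 * (2 + sqrt 3)\<^sup>2 * (sqrt 7 - sqrt 6) * (5 + 2 * sqrt 6)"
  proof -
    have "theta_r' 7 (3 / 2) ^ 4 = ((a - e) * (e + b) / 2)\<^sup>2 * ((5 - a * e) / 2 * (2 + e)\<^sup>2 * (a - e * b))"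
      unfolding r' q r32_square weber0_ratio_value s abe ..
    also have "\<dots> = (a - e)\<^sup>2 * (e + b)\<^sup>2 / 4 * ((5 - a * e) / 2 * (2 + e)\<^sup>2 * (a - e * b))"
      by (simp add: power_divide power_mult_distrib)
    also have "\<dots> = 1 / 4 * (5 - a * e)\<^sup>2 * (2 + e)\<^sup>2 * (a - e * b) * (5 + 2 * (e * b))"
      unfolding sqs power2_eq_square[of "5 - a * e"] by (simp add: mult_ac)
    finally show ?thesis
      unfolding s abe .
  qed
qed

lemma r_values: "(theta_r 7 6)\<^sup>2 = (sqrt 7 + sqrt 3) * (sqrt 3 + sqrt 2) / 2" "theta_r 7 6 > 0"
  "(theta_r 7 (3 / 2))\<^sup>2 = (sqrt 7 - sqrt 3) * (sqrt 3 + sqrt 2) / 2" "theta_r 7 (3 / 2) > 0"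
  using r6_square r32_square r_pos unfolding r6_def r32_def by simp_all

end

lemma powr_half_power: "x > 0 \<Longrightarrow> (x powr (1 / 2))\<^sup>2 = x" "x > 0 \<Longrightarrow> (x powr (1 / 2)) ^ 4 = x\<^sup>2"
  "x > 0 \<Longrightarrow> (x powr (1 / 4)) ^ 4 = x" "(2 powr (- 1 / 2))\<^sup>2 = (1 / 2 :: real)" "(2 powr (- 1 / 2)) ^ 4 = (1 / 4 :: real)"
  for x :: real
  by (simp_all add: powr_power powr_minus field_simps)

theorem theorem4p1:
  shows "theta_r 7 6 =
           2 powr (-1/2) * ((sqrt 7 + sqrt 3) * (sqrt 3 + sqrt 2)) powr (1/2)
       \<and> theta_r 7 (3/2) =
           2 powr (-1/2) * ((sqrt 7 - sqrt 3) * (sqrt 3 + sqrt 2)) powr (1/2)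
       \<and> theta_r' 7 6 =
           2 powr (-1/2) * (5 + sqrt 21) powr (1/2) * (2 - sqrt 3) powr (1/2)
             * (sqrt 7 - sqrt 6) powr (1/4) * (5 + 2 * sqrt 6) powr (1/4)
       \<and> theta_r' 7 (3/2) =
           2 powr (-1/2) * (5 - sqrt 21) powr (1/2) * (2 + sqrt 3) powr (1/2)
             * (sqrt 7 - sqrt 6) powr (1/4) * (5 + 2 * sqrt 6) powr (1/4)"
proof -
  \<comment> \<open>Reflexivity discharges the six naming assumptions; it remains to compare squares
    or fourth powers of positive numbers.\<close>
  note r = r_values[OF refl refl refl refl refl refl]
  note r' = r'_power4[OF refl refl refl refl refl refl]
  have "sqrt 3 < sqrt (2\<^sup>2)" "sqrt 21 < sqrt (5\<^sup>2)"
    by (simp_all only: real_sqrt_less_iff) simp_all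
  then have pos: "(sqrt 7 + sqrt 3) * (sqrt 3 + sqrt 2) > 0" "(sqrt 7 - sqrt 3) * (sqrt 3 + sqrt 2) > 0"
    "5 + sqrt 21 > 0" "2 - sqrt 3 > 0" "sqrt 7 - sqrt 6 > 0" "5 + 2 * sqrt 6 > 0" "5 - sqrt 21 > 0" "2 + sqrt 3 > 0"
    by (auto intro!: mult_pos_pos add_pos_pos)
  have powr_pos: "x powr y > 0" if "x > 0" for x y :: real
    using that by simp
  have "theta_r 7 6 = 2 powr (-1/2) * ((sqrt 7 + sqrt 3) * (sqrt 3 + sqrt 2)) powr (1/2)"
  proof (rule pos_power_eq[where n=2])
    show "(theta_r 7 6)\<^sup>2 = (2 powr (-1/2) * ((sqrt 7 + sqrt 3) * (sqrt 3 + sqrt 2)) powr (1/2))\<^sup>2"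
      unfolding r power_mult_distrib[of "2 powr (-1/2)"] powr_half_power powr_half_power(1)[OF pos(1)] by simp
    show "0 < 2 powr (-1/2) * ((sqrt 7 + sqrt 3) * (sqrt 3 + sqrt 2)) powr (1/2)"
      by (rule mult_pos_pos[OF powr_pos powr_pos[OF pos(1)]]) simp
  qed (use r in simp_all)
  moreover have "theta_r 7 (3/2) = 2 powr (-1/2) * ((sqrt 7 - sqrt 3) * (sqrt 3 + sqrt 2)) powr (1/2)"
  proof (rule pos_power_eq[where n=2])
    show "(theta_r 7 (3/2))\<^sup>2 = (2 powr (-1/2) * ((sqrt 7 - sqrt 3) * (sqrt 3 + sqrt 2)) powr (1/2))\<^sup>2"
      unfolding r power_mult_distrib[of "2 powr (-1/2)"] powr_half_power powr_half_power(1)[OF pos(2)] by simp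
    show "0 < 2 powr (-1/2) * ((sqrt 7 - sqrt 3) * (sqrt 3 + sqrt 2)) powr (1/2)"
      by (rule mult_pos_pos[OF powr_pos powr_pos[OF pos(2)]]) simp
  qed (use r in simp_all)
  moreover have "theta_r' 7 6 = 2 powr (-1/2) * (5 + sqrt 21) powr (1/2) * (2 - sqrt 3) powr (1/2)
             * (sqrt 7 - sqrt 6) powr (1/4) * (5 + 2 * sqrt 6) powr (1/4)"
  proof (rule pos_power_eq[where n=4])
    show "theta_r' 7 6 ^ 4 = (2 powr (-1/2) * (5 + sqrt 21) powr (1/2) * (2 - sqrt 3) powr (1/2)
             * (sqrt 7 - sqrt 6) powr (1/4) * (5 + 2 * sqrt 6) powr (1/4)) ^ 4"
      unfolding r'(1) power_mult_distrib powr_half_power(2)[OF pos(3)] powr_half_power(2)[OF pos(4)]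
        powr_half_power(3)[OF pos(5)] powr_half_power(3)[OF pos(6)] powr_half_power(5) ..
    show "0 < 2 powr (-1/2) * (5 + sqrt 21) powr (1/2) * (2 - sqrt 3) powr (1/2)
             * (sqrt 7 - sqrt 6) powr (1/4) * (5 + 2 * sqrt 6) powr (1/4)"
      by (intro mult_pos_pos powr_pos pos) simp
  qed (use r' in simp_all)
  moreover have "theta_r' 7 (3/2) = 2 powr (-1/2) * (5 - sqrt 21) powr (1/2) * (2 + sqrt 3) powr (1/2)
             * (sqrt 7 - sqrt 6) powr (1/4) * (5 + 2 * sqrt 6) powr (1/4)"
  proof (rule pos_power_eq[where n=4])
    show "theta_r' 7 (3/2) ^ 4 = (2 powr (-1/2) * (5 - sqrt 21) powr (1/2) * (2 + sqrt 3) powr (1/2)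
             * (sqrt 7 - sqrt 6) powr (1/4) * (5 + 2 * sqrt 6) powr (1/4)) ^ 4"
      unfolding r'(2) power_mult_distrib powr_half_power(2)[OF pos(7)] powr_half_power(2)[OF pos(8)]
        powr_half_power(3)[OF pos(5)] powr_half_power(3)[OF pos(6)] powr_half_power(5) ..
    show "0 < 2 powr (-1/2) * (5 - sqrt 21) powr (1/2) * (2 + sqrt 3) powr (1/2)
             * (sqrt 7 - sqrt 6) powr (1/4) * (5 + 2 * sqrt 6) powr (1/4)"
      by (intro mult_pos_pos powr_pos pos) simp
  qed (use r' in simp_all)
  ultimately show ?thesis
    by blast
qed

end
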